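(* Let $G$ be a finite $3$-dimensional crystallographic point group. Then every torsion unit of $V(\mathbb{Z}G)$ is conjugate within $\mathbb{Q}G$ to an element of $G$.
   Context: A finite $3$-dimensional crystallographic point group is a finite group of orthogonal transformations of $\mathbb{R}^3$ that maps some lattice of rank $3$ in $\mathbb{R}^3$ onto itself (equivalently, up to isomorphism, a finite subgroup of $GL_3(\mathbb{Z})$). For a finite group $G$, $V(\mathbb{Z}G)$ denotes the group of units of augmentation $1$ of the integral group ring $\mathbb{Z}G$, where the augmentation of $\sum_g \alpha_g g$ is $\sum_g \alpha_g$. A torsion unit is a unit of finite order; "conjugate within $\mathbb{Q}G$" means conjugate by a unit of the rational group algebra $\mathbb{Q}G$. *)

theory Defs
  imports "HOL-Analysis.Analysis"
begin

text \<open>A finite 3-dimensional crystallographic point group, realised (up to isomorphism)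
  as a finite subgroup of GL_3(Z): a finite set of integer 3x3 matrices containing the
  identity, closed under matrix multiplication and under inverses (within the set).\<close>

type_synonym mat3 = "int^3^3"

definition finite_subgroup_GL3Z :: "mat3 set \<Rightarrow> bool" where
  "finite_subgroup_GL3Z G \<longleftrightarrow>
     finite G \<and> mat 1 \<in> G \<and>
     (\<forall>A\<in>G. \<forall>B\<in>G. A ** B \<in> G) \<and>
     (\<forall>A\<in>G. \<exists>B\<in>G. A ** B = mat 1 \<and> B ** A = mat 1)"

definition gr_elem :: "mat3 set \<Rightarrow> (mat3 \<Rightarrow> 'r::comm_ring_1) \<Rightarrow> bool" where
  "gr_elem G a \<longleftrightarrow> (\<forall>h. h \<notin> G \<longrightarrow> a h = 0)"

definition gr_mult :: "mat3 set \<Rightarrow> (mat3 \<Rightarrow> 'r::comm_ring_1) \<Rightarrow> (mat3 \<Rightarrow> 'r) \<Rightarrow> (mat3 \<Rightarrow> 'r)" where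
  "gr_mult G a b = (\<lambda>h. \<Sum>p\<in>{p\<in>G \<times> G. fst p ** snd p = h}. a (fst p) * b (snd p))"

definition gr_basis :: "mat3 \<Rightarrow> (mat3 \<Rightarrow> 'r::comm_ring_1)" where
  "gr_basis g = (\<lambda>h. if h = g then 1 else 0)"

definition gr_one :: "mat3 \<Rightarrow> 'r::comm_ring_1" where
  "gr_one = gr_basis (mat 1)"

fun gr_pow :: "mat3 set \<Rightarrow> (mat3 \<Rightarrow> 'r::comm_ring_1) \<Rightarrow> nat \<Rightarrow> (mat3 \<Rightarrow> 'r)" where
  "gr_pow G a 0 = gr_one"
| "gr_pow G a (Suc n) = gr_mult G (gr_pow G a n) a"

definition augmentation :: "mat3 set \<Rightarrow> (mat3 \<Rightarrow> 'r::comm_ring_1) \<Rightarrow> 'r" where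
  "augmentation G a = (\<Sum>g\<in>G. a g)"

definition gr_unit :: "mat3 set \<Rightarrow> (mat3 \<Rightarrow> 'r::comm_ring_1) \<Rightarrow> bool" where
  "gr_unit G u \<longleftrightarrow> gr_elem G u \<and>
     (\<exists>v. gr_elem G v \<and> gr_mult G u v = gr_one \<and> gr_mult G v u = gr_one)"

definition in_V :: "mat3 set \<Rightarrow> (mat3 \<Rightarrow> int) \<Rightarrow> bool" where
  "in_V G u \<longleftrightarrow> gr_unit G u \<and> augmentation G u = 1"

definition torsion :: "mat3 set \<Rightarrow> (mat3 \<Rightarrow> 'r::comm_ring_1) \<Rightarrow> bool" where
  "torsion G u \<longleftrightarrow> (\<exists>n>0. gr_pow G u n = gr_one)"

definition conj_in_QG :: "mat3 set \<Rightarrow> (mat3 \<Rightarrow> rat) \<Rightarrow> (mat3 \<Rightarrow> rat) \<Rightarrow> bool" where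
  "conj_in_QG G a b \<longleftrightarrow>
     (\<exists>x y. gr_elem G x \<and> gr_elem G y \<and> gr_mult G x y = gr_one \<and> gr_mult G y x = gr_one \<and>
        gr_mult G (gr_mult G y a) x = b)"

end

theory Submission
  imports Defs "HOL-Number_Theory.Residues" "HOL-Library.Function_Algebras"
begin

text \<open>
  A torsion unit \<open>u\<close> of augmentation one is conjugate in the rational group algebra to a group
  element \<open>g\<close> as soon as all powers of \<open>u\<close> have the same partial augmentations as the
  corresponding powers of \<open>g\<close>: if \<open>a\<close> is a partial isomorphism of the bimodules defined by
  \<open>u\<close> and \<open>g\<close> which is not yet invertible, then a trace computation, which only sees partial
  augmentations, produces a nonzero intertwiner between the complements, and semisimplicity turns
  it into an enlargement of \<open>a\<close>. Because \<open>u\<close> raised to a prime \<open>p\<close> is congruent modulo \<open>p\<close>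
  and commutators to the sum of the \<open>p\<close>-th powers, it suffices that every torsion unit has exactly
  one nonvanishing partial augmentation.

  That property passes from a group to its product with a group of order two by a parity
  argument, so only finite groups of rotations with integral traces matter. If such a group has an
  invariant line, it is generalised dihedral with at most three squares of rotations, and the theorem of
  Berman and Higman together with the abelianisation determines everything. Otherwise the
  orthogonality relations and the sizes of centralisers leave the orders 12 and 24. A group of order 12
  is again determined by an abelian quotient. A group of order 24 is the octahedral group; there the
  quotient \<open>S\<^sub>3\<close>, the two three-dimensional representations, the congruence for squares and one
  integrality condition from the action on four diagonals suffice.
\<close>


text \<open>One principle serves both halves: over a field of characteristic 0 the trace of an
  idempotent is a natural number, and it vanishes only for the zero map. For spectral projections
  this bounds the trace of a matrix of finite order and settles the case of equality, which gives
  Berman-Higman. For the projection onto intertwiners it produces nonzero ones over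
  \<open>rat\<close> itself, without a splitting field. Integral matrices become rotations only
  after a real change of basis and multiplication by the determinant. The entries cease to be
  integers but the traces do not, and integral traces drive both the crystallographic restriction
  and the class counts. The bound three on squares has this origin: rotations about one axis form a
  cyclic group of order 1, 2, 3, 4 or 6. The octahedral group is the real obstacle. Over a
  transposition in \<open>s3\<close> quarter turns and half turns lie in the same fibre, so the
  quotient leaves one integer undetermined, which trace inequalities and parity have to fix. In
  order twelve, by contrast, noncentral elements with the same image in the quotient of order three
  are conjugate.\<close>

text \<open>Subtracting the rank one idempotent built from the row and the column through a nonzero entry
  lowers the trace by one and the number of nonzero rows.\<close>

lemma idempotent_trace:
  fixes P :: "'i \<Rightarrow> 'i \<Rightarrow> 'k::field_char_0"
  assumes fin: "finite I"
    and "\<And>x y. x \<in> I \<Longrightarrow> y \<in> I \<Longrightarrow> (\<Sum>z\<in>I. P x z * P z y) = P x y"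
  obtains r :: nat where "(\<Sum>x\<in>I. P x x) = of_nat r"
    and "r = 0 \<Longrightarrow> (\<forall>x\<in>I. \<forall>y\<in>I. P x y = 0)"
proof -
  have "\<exists>r::nat. (\<Sum>x\<in>I. P x x) = of_nat r \<and> (r = 0 \<longrightarrow> (\<forall>x\<in>I. \<forall>y\<in>I. P x y = 0))"
    using assms(2)
  proof (induction "card {x\<in>I. \<exists>y\<in>I. P x y \<noteq> 0}" arbitrary: P rule: less_induct)
    case less
    note idem = less.prems
    show ?case
    proof (cases "\<forall>x\<in>I. \<forall>y\<in>I. P x y = 0")
      case True
      then show ?thesis by (intro exI[of _ 0]) simp
    next
      case False
      then obtain i j where ij: "i \<in> I" "j \<in> I" "P i j \<noteq> 0" by blast
      define Q where "Q = (\<lambda>x z. P x j * P i z / P i j)"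
      define P' where "P' = (\<lambda>x z. P x z - Q x z)"
      have PQ: "(\<Sum>z\<in>I. P x z * Q z y) = Q x y" if "x \<in> I" "y \<in> I" for x y
      proof -
        have "(\<Sum>z\<in>I. P x z * Q z y) = (\<Sum>z\<in>I. P x z * P z j) * P i y / P i j"
          by (simp add: Q_def sum_distrib_right sum_divide_distrib mult.assoc)
        then show ?thesis using idem[of x j] that ij by (simp add: Q_def)
      qed
      have QP: "(\<Sum>z\<in>I. Q x z * P z y) = Q x y" if "x \<in> I" "y \<in> I" for x y
      proof -
        have "(\<Sum>z\<in>I. Q x z * P z y) = P x j * (\<Sum>z\<in>I. P i z * P z y) / P i j"
          by (simp add: Q_def sum_distrib_left sum_divide_distrib mult.assoc)
        then show ?thesis using idem[of i y] that ij by (simp add: Q_def)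
      qed
      have QQ: "(\<Sum>z\<in>I. Q x z * Q z y) = Q x y" if "x \<in> I" "y \<in> I" for x y
      proof -
        have "(\<Sum>z\<in>I. Q x z * Q z y) = (\<Sum>z\<in>I. Q x z * P z j) * P i y / P i j"
          by (simp add: Q_def sum_distrib_right sum_divide_distrib mult.assoc)
        then show ?thesis using QP[of x j] that ij by (simp add: Q_def)
      qed
      have idem': "(\<Sum>z\<in>I. P' x z * P' z y) = P' x y" if "x \<in> I" "y \<in> I" for x y
      proof -
        have "(\<Sum>z\<in>I. P' x z * P' z y) = (\<Sum>z\<in>I. P x z * P z y) - (\<Sum>z\<in>I. P x z * Q z y)
            - (\<Sum>z\<in>I. Q x z * P z y) + (\<Sum>z\<in>I. Q x z * Q z y)"
          by (simp add: P'_def algebra_simps sum.distrib sum_subtractf)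
        then show ?thesis using PQ QP QQ idem that by (simp add: P'_def)
      qed
      have "{x\<in>I. \<exists>y\<in>I. P' x y \<noteq> 0} \<subset> {x\<in>I. \<exists>y\<in>I. P x y \<noteq> 0}"
      proof
        show "{x\<in>I. \<exists>y\<in>I. P' x y \<noteq> 0} \<subseteq> {x\<in>I. \<exists>y\<in>I. P x y \<noteq> 0}"
          using ij unfolding P'_def Q_def by (auto) (metis diff_self div_0 mult_zero_left)
        have "i \<in> {x\<in>I. \<exists>y\<in>I. P x y \<noteq> 0}" "i \<notin> {x\<in>I. \<exists>y\<in>I. P' x y \<noteq> 0}"
          using ij by (auto simp: P'_def Q_def)
        then show "{x\<in>I. \<exists>y\<in>I. P' x y \<noteq> 0} \<noteq> {x\<in>I. \<exists>y\<in>I. P x y \<noteq> 0}" by blast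
      qed
      then have "card {x\<in>I. \<exists>y\<in>I. P' x y \<noteq> 0} < card {x\<in>I. \<exists>y\<in>I. P x y \<noteq> 0}"
        using fin by (intro psubset_card_mono) auto
      from less.hyps[OF this idem'] obtain r where r: "(\<Sum>x\<in>I. P' x x) = of_nat r" by blast
      have "(\<Sum>x\<in>I. Q x x) = (\<Sum>x\<in>I. P i x * P x j) / P i j"
        by (simp add: Q_def sum_divide_distrib mult.commute)
      also have "\<dots> = 1" using idem[of i j] ij by simp
      finally have "(\<Sum>x\<in>I. P x x) = of_nat (Suc r)"
        using r by (simp add: P'_def sum_subtractf algebra_simps)
      then show ?thesis by blast
    qed
  qed
  then show thesis using that by blast
qed

lemma sum_lessThan_shift_periodic:
  fixes f :: "nat \<Rightarrow> 'b::comm_monoid_add"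
  assumes "\<And>j. f (j + n) = f j"
  shows "(\<Sum>j<n. f (j + l)) = (\<Sum>j<n. f j)"
proof (induction l)
  case (Suc l)
  have "(\<Sum>j<n. f (j + Suc l)) = (\<Sum>j<n. f (j + l))"
  proof (cases n)
    case (Suc m)
    have "(\<Sum>j<Suc m. f (j + Suc l)) = (\<Sum>j<m. f (Suc j + l)) + f (l + n)"
      by (simp add: Suc add_ac)
    also have "f (l + n) = f (0 + l)" using assms by simp
    also have "(\<Sum>j<m. f (Suc j + l)) + f (0 + l) = (\<Sum>j<Suc m. f (j + l))"
      by (subst sum.lessThan_Suc_shift) (simp add: add.commute)
    finally show ?thesis by (simp add: Suc)
  qed simp
  then show ?case using Suc by simp
qed simp

text \<open>The powers of a matrix of finite order are combinations of the spectral idempotents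
  \<open>E k\<close>, whose traces are natural numbers.\<close>

lemma finite_order_trace:
  fixes M :: "nat \<Rightarrow> 'i \<Rightarrow> 'i \<Rightarrow> complex"
  assumes fin: "finite I" and n: "n > 0"
    and mult: "\<And>j k x y. x \<in> I \<Longrightarrow> y \<in> I \<Longrightarrow> (\<Sum>z\<in>I. M j x z * M k z y) = M (j + k) x y"
    and M0: "\<And>x y. x \<in> I \<Longrightarrow> y \<in> I \<Longrightarrow> M 0 x y = (if x = y then 1 else 0)"
    and Mn: "\<And>x y. x \<in> I \<Longrightarrow> y \<in> I \<Longrightarrow> M n x y = (if x = y then 1 else 0)"
  shows "Re (\<Sum>x\<in>I. M 1 x x) \<le> card I"
    and "Re (\<Sum>x\<in>I. M 1 x x) \<ge> card I \<Longrightarrow> x \<in> I \<Longrightarrow> y \<in> I \<Longrightarrow> M 1 x y = (if x = y then 1 else 0)"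
proof -
  \<comment> \<open>Doubling the exponent gives \<open>1 < m\<close> even for \<open>n = 1\<close>,
    so that \<open>recover\<close> applies to the index 1.\<close>
  define m where "m = 2 * n"
  have m: "m > 1" using n by (simp add: m_def)
  have period_n: "M (j + n) x y = M j x y" if "x \<in> I" "y \<in> I" for j x y
  proof -
    have "M (j + n) x y = (\<Sum>z\<in>I. M j x z * M n z y)" using mult that by simp
    also have "\<dots> = (\<Sum>z\<in>I. if z = y then M j x z else 0)"
      using that by (intro sum.cong) (auto simp: Mn)
    finally show ?thesis using fin that by simp
  qed
  have period: "M (j + m) x y = M j x y" if "x \<in> I" "y \<in> I" for j x y
    using period_n[OF that, of "j + n"] period_n[OF that, of j] by (simp add: m_def mult_2 add.assoc)
  define w where "w = (\<lambda>k. cis (2 * pi * real k / real m))"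
  have wm: "w k ^ m = 1" for k
  proof -
    have "real m * (2 * pi * real k / real m) = 2 * pi * real k" using m by simp
    then have "w k ^ m = cis (2 * pi * real k)" unfolding w_def by (subst Complex.DeMoivre) (rule arg_cong)
    then show ?thesis by (simp add: cis_multiple_2pi)
  qed
  have w_inj: "w j = w k \<Longrightarrow> j < m \<Longrightarrow> k < m \<Longrightarrow> j = k" for j k
    using Complex.bij_betw_roots_unity[of m] m unfolding bij_betw_def inj_on_def w_def by auto
  have w_nz: "w k \<noteq> 0" and norm_w: "norm (w k) = 1" for k by (simp_all add: w_def)
  have w_sym: "w k ^ j = w j ^ k" for j k by (simp add: w_def Complex.DeMoivre mult_ac)
  have ortho: "(\<Sum>k<m. w k ^ l / w k ^ j) = (if l = j then of_nat m else 0)" if "l < m" "j < m" for l j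
  proof (cases "l = j")
    case True
    then show ?thesis by (simp add: w_nz)
  next
    case False
    define q where "q = w l / w j"
    have q1: "q \<noteq> 1" using False w_inj that w_nz by (auto simp: q_def)
    have "q ^ m = 1" by (simp add: q_def power_divide wm)
    have "(\<Sum>k<m. w k ^ l / w k ^ j) = (\<Sum>k<m. q ^ k)"
      by (simp add: q_def power_divide w_sym)
    also have "\<dots> = 0" using q1 \<open>q ^ m = 1\<close> by (simp add: sum_gp_strict)
    finally show ?thesis using False by simp
  qed
  \<comment> \<open>A discrete Fourier transform of the powers: \<open>E k\<close> projects onto the
    eigenspace of \<open>M 1\<close> for the eigenvalue \<open>w k\<close>, and \<open>r k\<close>
    below is its dimension.\<close>
  define E where "E = (\<lambda>k x y. (\<Sum>j<m. M j x y / w k ^ j) / of_nat m)"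
  have E_idem: "(\<Sum>z\<in>I. E k x z * E k z y) = E k x y" if "x \<in> I" "y \<in> I" for k x y
  proof -
    have "(\<Sum>z\<in>I. E k x z * E k z y)
        = (\<Sum>z\<in>I. \<Sum>j<m. \<Sum>l<m. M j x z * M l z y / w k ^ (j + l)) / (of_nat m)\<^sup>2"
      by (simp add: E_def sum_product sum_divide_distrib power2_eq_square power_add mult.assoc mult.left_commute)
    also have "(\<Sum>z\<in>I. \<Sum>j<m. \<Sum>l<m. M j x z * M l z y / w k ^ (j + l))
        = (\<Sum>j<m. \<Sum>l<m. \<Sum>z\<in>I. M j x z * M l z y / w k ^ (j + l))"
      by (subst sum.swap) (intro sum.cong refl sum.swap)
    also have "\<dots> = (\<Sum>j<m. \<Sum>l<m. M (l + j) x y / w k ^ (l + j))"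
      using mult that by (simp add: sum_divide_distrib[symmetric] add.commute)
    also have "\<dots> = (\<Sum>j<m. \<Sum>l<m. M l x y / w k ^ l)"
      by (intro sum.cong refl sum_lessThan_shift_periodic)
         (simp add: period that power_add wm)
    also have "\<dots> = of_nat m * (\<Sum>l<m. M l x y / w k ^ l)" by simp
    finally show ?thesis using m by (simp add: E_def power2_eq_square)
  qed
  have recover: "(\<Sum>k<m. w k ^ l * E k x y) = M l x y" if "l < m" for l x y
  proof -
    have "(\<Sum>k<m. w k ^ l * E k x y) = (\<Sum>k<m. \<Sum>j<m. M j x y * (w k ^ l / w k ^ j)) / of_nat m"
      by (simp add: E_def sum_distrib_left sum_divide_distrib mult_ac)
    also have "(\<Sum>k<m. \<Sum>j<m. M j x y * (w k ^ l / w k ^ j)) = (\<Sum>j<m. M j x y * (\<Sum>k<m. w k ^ l / w k ^ j))"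
      by (subst sum.swap) (simp add: sum_distrib_left)
    also have "\<dots> = (\<Sum>j<m. if j = l then M j x y * of_nat m else 0)"
      using ortho that by (intro sum.cong) auto
    finally show ?thesis using m that by simp
  qed
  have "\<exists>r. \<forall>k. (\<Sum>x\<in>I. E k x x) = of_nat (r k) \<and> (r k = 0 \<longrightarrow> (\<forall>x\<in>I. \<forall>y\<in>I. E k x y = 0))"
    by (intro choice allI) (metis idempotent_trace[OF fin E_idem])
  then obtain r :: "nat \<Rightarrow> nat" where r: "\<And>k. (\<Sum>x\<in>I. E k x x) = of_nat (r k)"
    and r0: "\<And>k x y. r k = 0 \<Longrightarrow> x \<in> I \<Longrightarrow> y \<in> I \<Longrightarrow> E k x y = 0" by blast
  have tr: "(\<Sum>x\<in>I. M l x x) = (\<Sum>k<m. w k ^ l * of_nat (r k))" if "l < m" for l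
  proof -
    have "(\<Sum>x\<in>I. M l x x) = (\<Sum>x\<in>I. \<Sum>k<m. w k ^ l * E k x x)" using recover that by simp
    also have "\<dots> = (\<Sum>k<m. \<Sum>x\<in>I. w k ^ l * E k x x)" by (rule sum.swap)
    finally show ?thesis by (simp add: sum_distrib_left[symmetric] r)
  qed
  have "(\<Sum>x\<in>I. M 0 x x) = of_nat (card I)" using M0 by simp
  then have "(of_nat (card I) :: complex) = of_nat (\<Sum>k<m. r k)" using tr[of 0] m by simp
  then have cardI: "card I = (\<Sum>k<m. r k)" by (simp only: of_nat_eq_iff)
  have Re_tr: "Re (\<Sum>x\<in>I. M 1 x x) = (\<Sum>k<m. Re (w k) * r k)" using tr[of 1] m by simp
  have Re_le: "Re (w k) \<le> 1" for k using complex_Re_le_cmod[of "w k"] norm_w by simp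
  show "Re (\<Sum>x\<in>I. M 1 x x) \<le> card I"
  proof -
    have "Re (w k) * r k \<le> r k" for k using mult_right_mono[OF Re_le[of k], of "real (r k)"] by simp
    then show ?thesis unfolding Re_tr cardI of_nat_sum by (rule sum_mono)
  qed
  show "M 1 x y = (if x = y then 1 else 0)"
    if ge: "Re (\<Sum>x\<in>I. M 1 x x) \<ge> card I" and xy: "x \<in> I" "y \<in> I"
  proof -
    \<comment> \<open>In the case of equality a sum of nonnegative terms vanishes. Each eigenvalue
      that occurs therefore has real part 1, and being of modulus 1 it equals 1.\<close>
    have "(\<Sum>k<m. (1 - Re (w k)) * r k) \<le> 0"
      using ge unfolding Re_tr cardI by (simp add: algebra_simps sum_subtractf)
    moreover have nn: "(1 - Re (w k)) * r k \<ge> 0" for k using Re_le[of k] by simp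
    ultimately have "(\<Sum>k<m. (1 - Re (w k)) * r k) = 0" using sum_nonneg[of "{..<m}"] nn by (smt (verit))
    then have z: "(1 - Re (w k)) * r k = 0" if "k < m" for k
      using that nn by (subst (asm) sum_nonneg_eq_0_iff) auto
    have "w k * E k x y = E k x y" if "k < m" for k
    proof (cases "r k = 0")
      case True
      then show ?thesis using r0 xy by simp
    next
      case False
      then have "Re (w k) = 1" using z[OF that] by simp
      moreover have "(Re (w k))\<^sup>2 + (Im (w k))\<^sup>2 = 1" using norm_w[of k] by (simp add: cmod_def)
      ultimately have "w k = 1" by (simp add: complex_eq_iff)
      then show ?thesis by simp
    qed
    then have "(\<Sum>k<m. w k ^ 1 * E k x y) = (\<Sum>k<m. w k ^ 0 * E k x y)"
      by (intro sum.cong) auto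
    then have "M 1 x y = M 0 x y" using recover[of 1] recover[of 0] m by simp
    then show ?thesis using M0 xy by simp
  qed
qed

text \<open>The group ring operations are set up again for an arbitrary group with a carrier,
  because the argument passes to quotients and to images under homomorphisms;
  \<open>mat_group\<close> leads back to the operations of the statement.\<close>

definition grp_mult :: "('a, 'm) monoid_scheme \<Rightarrow> ('a \<Rightarrow> 'r::comm_ring_1) \<Rightarrow> ('a \<Rightarrow> 'r) \<Rightarrow> 'a \<Rightarrow> 'r" where
  "grp_mult G a b = (\<lambda>h. \<Sum>p\<in>{p\<in>carrier G \<times> carrier G. fst p \<otimes>\<^bsub>G\<^esub> snd p = h}. a (fst p) * b (snd p))"

definition grp_supp :: "('a, 'm) monoid_scheme \<Rightarrow> ('a \<Rightarrow> 'r::comm_ring_1) \<Rightarrow> bool" where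
  "grp_supp G a \<longleftrightarrow> (\<forall>h. h \<notin> carrier G \<longrightarrow> a h = 0)"

definition grp_basis :: "'a \<Rightarrow> 'a \<Rightarrow> 'r::comm_ring_1" where
  "grp_basis g = (\<lambda>h. if h = g then 1 else 0)"

fun grp_pow :: "('a, 'm) monoid_scheme \<Rightarrow> ('a \<Rightarrow> 'r::comm_ring_1) \<Rightarrow> nat \<Rightarrow> 'a \<Rightarrow> 'r" where
  "grp_pow G a 0 = grp_basis \<one>\<^bsub>G\<^esub>"
| "grp_pow G a (Suc n) = grp_mult G (grp_pow G a n) a"

definition conj_class :: "('a, 'm) monoid_scheme \<Rightarrow> 'a \<Rightarrow> 'a set" where
  "conj_class G h = (\<lambda>t. t \<otimes>\<^bsub>G\<^esub> h \<otimes>\<^bsub>G\<^esub> inv\<^bsub>G\<^esub> t) ` carrier G"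

definition centr :: "('a, 'm) monoid_scheme \<Rightarrow> 'a \<Rightarrow> 'a set" where
  "centr G h = {t \<in> carrier G. t \<otimes>\<^bsub>G\<^esub> h = h \<otimes>\<^bsub>G\<^esub> t}"

text \<open>In the usual notation, the partial augmentation \<open>\<epsilon>\<^sub>h(u)\<close>.\<close>

definition class_sum :: "('a, 'm) monoid_scheme \<Rightarrow> ('a \<Rightarrow> 'r::comm_ring_1) \<Rightarrow> 'a \<Rightarrow> 'r" where
  "class_sum G u h = (\<Sum>x\<in>conj_class G h. u x)"

text \<open>This is the map of group rings induced by \<phi>, a ring homomorphism whenever \<phi> is
  a homomorphism.\<close>

definition push :: "('a, 'm) monoid_scheme \<Rightarrow> ('a \<Rightarrow> 'b) \<Rightarrow> ('a \<Rightarrow> 'r::comm_ring_1) \<Rightarrow> 'b \<Rightarrow> 'r" where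
  "push G \<phi> u = (\<lambda>y. \<Sum>x\<in>{x\<in>carrier G. \<phi> x = y}. u x)"

text \<open>A power equal to 1 supplies an inverse, so being a unit is already contained in the
  torsion condition.\<close>

definition tors1 :: "('a, 'm) monoid_scheme \<Rightarrow> ('a \<Rightarrow> int) \<Rightarrow> bool" where
  "tors1 G u \<longleftrightarrow> grp_supp G u \<and> (\<exists>n>0. grp_pow G u n = grp_basis \<one>\<^bsub>G\<^esub>) \<and> (\<Sum>x\<in>carrier G. u x) = 1"

text \<open>In other words, class functions cannot distinguish \<open>u\<close> from the group
  element \<open>g\<close>.\<close>

definition aug_at :: "('a, 'm) monoid_scheme \<Rightarrow> ('a \<Rightarrow> int) \<Rightarrow> 'a \<Rightarrow> bool" where
  "aug_at G u g \<longleftrightarrow> g \<in> carrier G \<and>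
     (\<forall>h\<in>carrier G. class_sum G u h = (if h \<in> conj_class G g then 1 else 0))"

definition trivial_augs :: "('a, 'm) monoid_scheme \<Rightarrow> bool" where
  "trivial_augs G \<longleftrightarrow> (\<forall>u. tors1 G u \<longrightarrow> (\<exists>g. aug_at G u g))"

section \<open>The convolution algebra of a finite group\<close>

locale fin_group = group G for G (structure) +
  assumes fin [simp]: "finite (carrier G)"
begin

lemma inv_cancel [simp]:
  "x \<in> carrier G \<Longrightarrow> a \<in> carrier G \<Longrightarrow> inv x \<otimes> (x \<otimes> a) = a"
  "x \<in> carrier G \<Longrightarrow> a \<in> carrier G \<Longrightarrow> x \<otimes> (inv x \<otimes> a) = a"
  by (simp_all add: m_assoc[symmetric])

text \<open>Pairing a product with a test function removes the fibres of the multiplication from the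
  formula. Convolution identities are proved in this form; the test function
  \<open>grp_basis h\<close> recovers a single coefficient.\<close>

lemma sum_mult_eval:
  "(\<Sum>h\<in>carrier G. grp_mult G a b h * f h) = (\<Sum>x\<in>carrier G. \<Sum>y\<in>carrier G. a x * b y * f (x \<otimes> y))"
proof -
  have "(\<Sum>h\<in>carrier G. grp_mult G a b h * f h)
      = (\<Sum>h\<in>carrier G. \<Sum>p\<in>{p\<in>carrier G \<times> carrier G. fst p \<otimes> snd p = h}. a (fst p) * b (snd p) * f (fst p \<otimes> snd p))"
    unfolding grp_mult_def sum_distrib_right by (intro sum.cong) auto
  also have "\<dots> = (\<Sum>p\<in>carrier G \<times> carrier G. a (fst p) * b (snd p) * f (fst p \<otimes> snd p))"
    by (rule sum.group) auto
  finally show ?thesis by (simp add: sum.cartesian_product case_prod_beta)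
qed

lemma supp_mult [simp]: "grp_supp G (grp_mult G a b)"
  unfolding grp_supp_def grp_mult_def by (auto intro!: sum.neutral)

lemma supp_basis [simp]: "g \<in> carrier G \<Longrightarrow> grp_supp G (grp_basis g)"
  by (auto simp: grp_supp_def grp_basis_def)

lemma supp_pow [simp]: "grp_supp G (grp_pow G a n)"
  by (cases n) auto

lemma supp_ext: "grp_supp G a \<Longrightarrow> grp_supp G b \<Longrightarrow> (\<And>h. h \<in> carrier G \<Longrightarrow> a h = b h) \<Longrightarrow> a = b"
  unfolding grp_supp_def by (rule ext) metis

lemma sum_basis: "g \<in> carrier G \<Longrightarrow> (\<Sum>h\<in>carrier G. f h * grp_basis g h) = (f g :: 'r::comm_ring_1)"
  "g \<in> carrier G \<Longrightarrow> (\<Sum>h\<in>carrier G. grp_basis g h * f h) = (f g :: 'r::comm_ring_1)"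
proof -
  assume g: "g \<in> carrier G"
  have "f h * grp_basis g h = (if h = g then f h else 0)" "grp_basis g h * f h = (if h = g then f h else 0)" for h
    by (auto simp: grp_basis_def)
  then show "(\<Sum>h\<in>carrier G. f h * grp_basis g h) = f g" "(\<Sum>h\<in>carrier G. grp_basis g h * f h) = f g"
    using g by simp_all
qed

lemma mult_eval:
  assumes "h \<in> carrier G"
  shows "grp_mult G a b h = (\<Sum>x\<in>carrier G. a x * b (inv x \<otimes> h))"
proof -
  have eq: "x \<otimes> y = h \<longleftrightarrow> y = inv x \<otimes> h" if "x \<in> carrier G" "y \<in> carrier G" for x y
    using assms that by (metis inv_closed inv_solve_left)
  have "grp_mult G a b h = (\<Sum>x\<in>carrier G. \<Sum>y\<in>carrier G. a x * b y * grp_basis h (x \<otimes> y))"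
    using sum_mult_eval[of a b "grp_basis h"] sum_basis(1)[OF assms, of "grp_mult G a b"] by simp
  also have "\<dots> = (\<Sum>x\<in>carrier G. \<Sum>y\<in>carrier G. (a x * b y) * grp_basis (inv x \<otimes> h) y)"
    by (intro sum.cong refl) (simp add: grp_basis_def eq)
  also have "\<dots> = (\<Sum>x\<in>carrier G. a x * b (inv x \<otimes> h))"
    using assms by (intro sum.cong refl) (simp add: sum_basis)
  finally show ?thesis .
qed

lemma sum_translate_right:
  "g \<in> carrier G \<Longrightarrow> (\<Sum>x\<in>carrier G. f (x \<otimes> g)) = (\<Sum>x\<in>carrier G. f x)"
  by (rule sum.reindex_bij_witness[where i="\<lambda>x. x \<otimes> inv g" and j="\<lambda>x. x \<otimes> g"]) (auto simp: m_assoc)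

lemma sum_translate_left:
  "g \<in> carrier G \<Longrightarrow> (\<Sum>x\<in>carrier G. f (g \<otimes> x)) = (\<Sum>x\<in>carrier G. f x)"
  by (rule sum.reindex_bij_witness[where i="\<lambda>x. inv g \<otimes> x" and j="\<lambda>x. g \<otimes> x"]) (auto simp: m_assoc[symmetric])

lemma sum_inv: "(\<Sum>x\<in>carrier G. f (inv x)) = (\<Sum>x\<in>carrier G. f x)"
  by (rule sum.reindex_bij_witness[where i="\<lambda>x. inv x" and j="\<lambda>x. inv x"]) auto

lemma mult_assoc: "grp_mult G (grp_mult G a b) c = grp_mult G a (grp_mult G b c)"
proof (rule supp_ext)
  fix h assume h: "h \<in> carrier G"
  have "grp_mult G (grp_mult G a b) c h = (\<Sum>z\<in>carrier G. grp_mult G a b z * c (inv z \<otimes> h))"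
    by (rule mult_eval[OF h])
  also have "\<dots> = (\<Sum>x\<in>carrier G. \<Sum>y\<in>carrier G. a x * b y * c (inv (x \<otimes> y) \<otimes> h))"
    by (rule sum_mult_eval)
  also have "\<dots> = (\<Sum>x\<in>carrier G. a x * (\<Sum>y\<in>carrier G. b y * c (inv y \<otimes> (inv x \<otimes> h))))"
    using h by (simp add: sum_distrib_left mult.assoc inv_mult_group m_assoc)
  also have "\<dots> = grp_mult G a (grp_mult G b c) h"
    using h by (simp add: mult_eval)
  finally show "grp_mult G (grp_mult G a b) c h = grp_mult G a (grp_mult G b c) h" .
qed auto

lemma one_mult [simp]: "grp_supp G a \<Longrightarrow> grp_mult G (grp_basis \<one>) a = a"
  by (rule supp_ext) (auto simp: mult_eval sum_basis)

lemma mult_one [simp]: "grp_supp G a \<Longrightarrow> grp_mult G a (grp_basis \<one>) = a"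
proof (rule supp_ext, simp, assumption)
  fix h assume h: "h \<in> carrier G"
  have "grp_mult G a (grp_basis \<one>) h = (\<Sum>x\<in>carrier G. a x * grp_basis h x)"
    unfolding mult_eval[OF h] using h
    by (intro sum.cong refl) (auto simp: grp_basis_def, metis inv_closed inv_inv inv_equality)
  then show "grp_mult G a (grp_basis \<one>) h = a h" using h by (simp add: sum_basis)
qed

lemma mult_add_left: "grp_mult G (a + b) c = grp_mult G a c + grp_mult G b c"
  by (rule ext) (simp add: grp_mult_def sum.distrib algebra_simps)

lemma mult_add_right: "grp_mult G c (a + b) = grp_mult G c a + grp_mult G c b"
  by (rule ext) (simp add: grp_mult_def sum.distrib algebra_simps)

lemma mult_diff_left: "grp_mult G (a - b) c = grp_mult G a c - grp_mult G b c"
  by (rule ext) (simp add: grp_mult_def sum_subtractf algebra_simps)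

lemma mult_diff_right: "grp_mult G c (a - b) = grp_mult G c a - grp_mult G c b"
  by (rule ext) (simp add: grp_mult_def sum_subtractf algebra_simps)

lemma mult_zero [simp]: "grp_mult G 0 c = 0" "grp_mult G c 0 = 0"
  by (auto simp: grp_mult_def fun_eq_iff)

lemma mult_scale: "grp_mult G (\<lambda>h. k * a h) b = (\<lambda>h. k * grp_mult G a b h)"
  "grp_mult G a (\<lambda>h. k * b h) = (\<lambda>h. k * grp_mult G a b h)"
  by (auto simp: grp_mult_def fun_eq_iff sum_distrib_left mult_ac)

lemma supp_closed [simp]:
  "grp_supp G 0" "grp_supp G a \<Longrightarrow> grp_supp G b \<Longrightarrow> grp_supp G (a + b)"
  "grp_supp G a \<Longrightarrow> grp_supp G b \<Longrightarrow> grp_supp G (a - b)"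
  "grp_supp G a \<Longrightarrow> grp_supp G (\<lambda>h. k * a h)"
  by (auto simp: grp_supp_def)

lemma pow_add: "grp_pow G a (m + n) = grp_mult G (grp_pow G a m) (grp_pow G a n)"
  by (induction n) (simp_all add: mult_assoc)

lemma pow_Suc_left: "grp_supp G a \<Longrightarrow> grp_pow G a (Suc n) = grp_mult G a (grp_pow G a n)"
  using pow_add[of a 1 n] by simp

lemma pow_mult: "grp_pow G a (m * n) = grp_pow G (grp_pow G a m) n"
  by (induction n) (simp_all add: pow_add add.commute[of m])

lemma basis_one_pow: "grp_pow G (grp_basis \<one>) n = grp_basis \<one>"
  by (induction n) simp_all

lemma basis_mult:
  assumes "g \<in> carrier G" "h \<in> carrier G"
  shows "grp_mult G (grp_basis g) (grp_basis h) = grp_basis (g \<otimes> h)"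
proof (rule supp_ext)
  fix k assume k: "k \<in> carrier G"
  then have "grp_mult G (grp_basis g) (grp_basis h) k = grp_basis h (inv g \<otimes> k)"
    using assms by (simp add: mult_eval sum_basis)
  also have "\<dots> = grp_basis (g \<otimes> h) k"
    using assms k by (auto simp: grp_basis_def m_assoc[symmetric])
  finally show "grp_mult G (grp_basis g) (grp_basis h) k = grp_basis (g \<otimes> h) k" .
qed (use assms in auto)

lemma basis_pow: "g \<in> carrier G \<Longrightarrow> grp_pow G (grp_basis g) n = grp_basis (g [^] n)"
  by (induction n) (simp_all add: basis_mult)

lemma sum_mult: "(\<Sum>h\<in>carrier G. grp_mult G a b h) = (\<Sum>h\<in>carrier G. a h) * (\<Sum>h\<in>carrier G. b h)"
  using sum_mult_eval[of a b "\<lambda>_. 1"] by (simp add: sum_product)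

lemma sum_pow: "(\<Sum>h\<in>carrier G. grp_pow G a n h) = (\<Sum>h\<in>carrier G. a h) ^ n"
proof (induction n)
  case 0
  then show ?case using sum_basis(1)[OF one_closed, of "\<lambda>_. 1"] by simp
qed (simp add: sum_mult)

lemma tors1_pow: assumes "tors1 G u" shows "tors1 G (grp_pow G u k)"
proof -
  obtain n where n: "n > 0" "grp_pow G u n = grp_basis \<one>" using assms by (auto simp: tors1_def)
  have "grp_pow G (grp_pow G u k) n = grp_basis \<one>"
    by (simp only: pow_mult[symmetric] mult.commute[of k]) (simp only: pow_mult n basis_one_pow)
  then show ?thesis using n assms by (auto simp: tors1_def sum_pow)
qed

section \<open>Conjugacy classes\<close>

lemma conj_classI: "t \<in> carrier G \<Longrightarrow> t \<otimes> h \<otimes> inv t \<in> conj_class G h"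
  by (auto simp: conj_class_def)

lemma conj_class_closed: "h \<in> carrier G \<Longrightarrow> x \<in> conj_class G h \<Longrightarrow> x \<in> carrier G"
  by (auto simp: conj_class_def)

lemma conj_class_refl: "h \<in> carrier G \<Longrightarrow> h \<in> conj_class G h"
  using conj_classI[of \<one> h] by simp

lemma conj_class_sym: "h \<in> carrier G \<Longrightarrow> x \<in> conj_class G h \<Longrightarrow> h \<in> conj_class G x"
proof -
  assume h: "h \<in> carrier G" and "x \<in> conj_class G h"
  then obtain t where t: "t \<in> carrier G" "x = t \<otimes> h \<otimes> inv t" by (auto simp: conj_class_def)
  then have "inv t \<otimes> x \<otimes> inv (inv t) = h"
    using h by (simp add: m_assoc)
  then show ?thesis using conj_classI[of "inv t" x] t by simp
qed

lemma conj_class_trans: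
  "h \<in> carrier G \<Longrightarrow> x \<in> conj_class G h \<Longrightarrow> y \<in> conj_class G x \<Longrightarrow> y \<in> conj_class G h"
proof -
  assume h: "h \<in> carrier G" and "x \<in> conj_class G h" "y \<in> conj_class G x"
  then obtain t s where t: "t \<in> carrier G" "x = t \<otimes> h \<otimes> inv t" and s: "s \<in> carrier G" "y = s \<otimes> x \<otimes> inv s"
    by (auto simp: conj_class_def)
  then have "y = (s \<otimes> t) \<otimes> h \<otimes> inv (s \<otimes> t)" using h by (simp add: m_assoc inv_mult_group)
  then show ?thesis using conj_classI t s by simp
qed

lemma conj_class_eq:
  assumes "h \<in> carrier G" "x \<in> conj_class G h"
  shows "conj_class G x = conj_class G h"
proof (intro Set.set_eqI iffI)
  fix y assume "y \<in> conj_class G x"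
  then show "y \<in> conj_class G h" using conj_class_trans assms by blast
next
  fix y assume "y \<in> conj_class G h"
  then show "y \<in> conj_class G x"
    using conj_class_trans[of x h y] conj_class_sym conj_class_closed assms by blast
qed

lemma finite_conj_class [simp]: "finite (conj_class G h)"
  by (simp add: conj_class_def)

lemma conj_class_central:
  assumes "h \<in> carrier G" "\<And>t. t \<in> carrier G \<Longrightarrow> t \<otimes> h = h \<otimes> t"
  shows "conj_class G h = {h}"
proof -
  have "t \<otimes> h \<otimes> inv t = h" if "t \<in> carrier G" for t using assms that by (simp add: m_assoc)
  then show ?thesis unfolding conj_class_def by force
qed

lemma conj_eq_iff:
  assumes "s \<in> carrier G" "t \<in> carrier G" "h \<in> carrier G"
  shows "s \<otimes> h \<otimes> inv s = t \<otimes> h \<otimes> inv t \<longleftrightarrow> inv t \<otimes> s \<in> centr G h"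
proof -
  have "inv t \<otimes> s \<otimes> h = h \<otimes> (inv t \<otimes> s) \<longleftrightarrow> s \<otimes> h = t \<otimes> (h \<otimes> (inv t \<otimes> s))"
    using assms by (metis inv_solve_left m_assoc m_closed inv_closed)
  also have "\<dots> \<longleftrightarrow> s \<otimes> h = (t \<otimes> h \<otimes> inv t) \<otimes> s" using assms by (simp add: m_assoc)
  also have "\<dots> \<longleftrightarrow> s \<otimes> h \<otimes> inv s = t \<otimes> h \<otimes> inv t"
    using assms by (metis inv_solve_right m_closed inv_closed)
  finally show ?thesis using assms by (auto simp: centr_def)
qed

text \<open>Orbit and stabiliser in weighted form: the fibres of \<open>t\<close> \<mapsto>
  \<open>t \<otimes> h \<otimes> inv t\<close> are the left cosets of the centraliser.\<close>

lemma sum_conjugates: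
  fixes f :: "'a \<Rightarrow> 'r::comm_ring_1"
  assumes h: "h \<in> carrier G"
  shows "(\<Sum>t\<in>carrier G. f (t \<otimes> h \<otimes> inv t)) = of_nat (card (centr G h)) * (\<Sum>x\<in>conj_class G h. f x)"
proof -
  have fib: "card {t \<in> carrier G. t \<otimes> h \<otimes> inv t = x} = card (centr G h)" if x: "x \<in> conj_class G h" for x
  proof -
    obtain t where t: "t \<in> carrier G" "x = t \<otimes> h \<otimes> inv t" using x by (auto simp: conj_class_def)
    have "bij_betw (\<lambda>s. t \<otimes> s) (centr G h) {s \<in> carrier G. s \<otimes> h \<otimes> inv s = x}"
    proof (rule bij_betw_byWitness[where f'="\<lambda>s. inv t \<otimes> s"])
      show "(\<lambda>s. t \<otimes> s) ` centr G h \<subseteq> {s \<in> carrier G. s \<otimes> h \<otimes> inv s = x}"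
      proof clarify
        fix s assume s: "s \<in> centr G h"
        then have sc: "s \<in> carrier G" by (simp add: centr_def)
        have "inv t \<otimes> (t \<otimes> s) \<in> centr G h" using s sc t by (simp add: m_assoc[symmetric])
        then show "t \<otimes> s \<in> carrier G \<and> t \<otimes> s \<otimes> h \<otimes> inv (t \<otimes> s) = x"
          using conj_eq_iff[of "t \<otimes> s" t h] sc t h by simp
      qed
      show "(\<lambda>s. inv t \<otimes> s) ` {s \<in> carrier G. s \<otimes> h \<otimes> inv s = x} \<subseteq> centr G h"
        using conj_eq_iff t h by auto
    qed (use t in \<open>auto simp: centr_def m_assoc[symmetric]\<close>)
    then show ?thesis by (simp add: bij_betw_same_card)
  qed
  have "(\<Sum>t\<in>carrier G. f (t \<otimes> h \<otimes> inv t))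
      = (\<Sum>x\<in>conj_class G h. \<Sum>t\<in>{t\<in>carrier G. t \<otimes> h \<otimes> inv t = x}. f (t \<otimes> h \<otimes> inv t))"
    by (rule sum.group[symmetric]) (auto simp: conj_class_def)
  also have "\<dots> = (\<Sum>x\<in>conj_class G h. of_nat (card (centr G h)) * f x)"
  proof (rule sum.cong[OF refl])
    fix x assume x: "x \<in> conj_class G h"
    have "(\<Sum>t\<in>{t\<in>carrier G. t \<otimes> h \<otimes> inv t = x}. f (t \<otimes> h \<otimes> inv t)) = (\<Sum>t\<in>{t\<in>carrier G. t \<otimes> h \<otimes> inv t = x}. f x)"
      by (intro sum.cong) auto
    then show "(\<Sum>t\<in>{t\<in>carrier G. t \<otimes> h \<otimes> inv t = x}. f (t \<otimes> h \<otimes> inv t)) = of_nat (card (centr G h)) * f x"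
      using fib[OF x] by simp
  qed
  finally show ?thesis by (simp add: sum_distrib_left)
qed

lemma card_class: "h \<in> carrier G \<Longrightarrow> card (conj_class G h) * card (centr G h) = card (carrier G)"
proof -
  assume h: "h \<in> carrier G"
  have "int (card (conj_class G h) * card (centr G h)) = int (card (carrier G))"
    using sum_conjugates[OF h, of "\<lambda>_. 1 :: int"] by simp
  then show ?thesis by (simp only: of_nat_eq_iff)
qed

section \<open>The theorem of Berman and Higman\<close>

text \<open>Let \<open>s\<close> be the sign of \<open>u z\<close>. In the regular representation
  \<open>s * u * inv z\<close> has finite order, and all its diagonal entries equal
  \<open>s * u z\<close>, which is at least 1. Its trace thus reaches the bound of
  \<open>finite_order_trace\<close>, and the matrix is the identity.\<close>

lemma berman_higman:
  assumes u: "tors1 G u" and z: "z \<in> carrier G" "\<And>t. t \<in> carrier G \<Longrightarrow> t \<otimes> z = z \<otimes> t" and nz: "u z \<noteq> 0"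
  shows "u = grp_basis z"
proof -
  obtain n where n: "n > 0" "grp_pow G u n = grp_basis \<one>" and supp: "grp_supp G u"
    and aug: "(\<Sum>x\<in>carrier G. u x) = 1" using u by (auto simp: tors1_def)
  define s :: int where "s = sgn (u z)"
  have s: "s * u z \<ge> 1" "s * s = 1" using nz by (auto simp: s_def sgn_if)
  \<comment> \<open>A common exponent for \<open>u\<close>, for \<open>z\<close> and, being even,
    for the sign \<open>s\<close>.\<close>
  define N where "N = 2 * n * card (carrier G)"
  have "card (carrier G) > 0" using one_closed by (auto simp: card_gt_0_iff)
  then have N: "N > 0" using n by (simp add: N_def)
  have uN: "grp_pow G u N = grp_basis \<one>"
  proof -
    have "grp_pow G u (n * (2 * card (carrier G))) = grp_basis \<one>"
      by (simp only: pow_mult n basis_one_pow)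
    then show ?thesis by (simp add: N_def mult_ac)
  qed
  have zN: "z [^] N = \<one>"
  proof -
    have "z [^] (card (carrier G) * (2 * n)) = \<one>"
      using pow_order_eq_1[OF z(1)] z by (simp add: order_def nat_pow_pow[symmetric])
    then show ?thesis by (simp add: N_def mult_ac)
  qed
  have sN: "s ^ N = 1" using s by (simp add: N_def power_mult power2_eq_square)
  have zj: "z [^] (j::nat) \<in> carrier G" for j using z by simp
  have zc: "t \<otimes> z [^] (j::nat) = z [^] j \<otimes> t" if "t \<in> carrier G" for t j
  proof (induction j)
    case (Suc j)
    have "t \<otimes> (z [^] j \<otimes> z) = (z [^] j \<otimes> t) \<otimes> z"
      using that z(1) by (simp add: m_assoc[symmetric] Suc)
    also have "\<dots> = (z [^] j \<otimes> z) \<otimes> t" using that z(1) by (simp add: m_assoc z(2)[OF that])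
    finally show ?case by simp
  qed (use that in simp)
  \<comment> \<open>The regular representation of the \<open>j\<close>-th power of
    \<open>s * u * inv z\<close>: since \<open>z\<close> is central, the entry at
    \<open>(x, y)\<close> is the coefficient of this power at
    \<open>x \<otimes> inv y\<close>.\<close>
  define M where "M = (\<lambda>j x y. of_int (s ^ j * grp_pow G u j (x \<otimes> inv y \<otimes> z [^] j)) :: complex)"
  have mult: "(\<Sum>w\<in>carrier G. M j x w * M k w y) = M (j + k) x y"
    if x: "x \<in> carrier G" and y: "y \<in> carrier G" for j k x y
  proof -
    \<comment> \<open>The substitution \<open>v = x \<otimes> inv w \<otimes> z [^] j\<close>,
      carried out in three translations, turns the convolution into a matrix product over the
      intermediate index \<open>w\<close>.\<close>
    define F where "F = (\<lambda>v. grp_pow G u j v * grp_pow G u k (inv v \<otimes> (x \<otimes> inv y \<otimes> z [^] (j + k))))"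
    have "grp_pow G u (j + k) (x \<otimes> inv y \<otimes> z [^] (j + k)) = (\<Sum>v\<in>carrier G. F v)"
      using x y z by (simp add: F_def pow_add mult_eval)
    also have "\<dots> = (\<Sum>v\<in>carrier G. F (v \<otimes> z [^] j))" using sum_translate_right[OF zj] by metis
    also have "\<dots> = (\<Sum>v\<in>carrier G. F (x \<otimes> v \<otimes> z [^] j))"
      using sum_translate_left[OF x, of "\<lambda>v. F (v \<otimes> z [^] j)"] by simp
    also have "\<dots> = (\<Sum>w\<in>carrier G. F (x \<otimes> inv w \<otimes> z [^] j))"
      using sum_inv[of "\<lambda>v. F (x \<otimes> v \<otimes> z [^] j)"] by simp
    also have "\<dots> = (\<Sum>w\<in>carrier G. grp_pow G u j (x \<otimes> inv w \<otimes> z [^] j) * grp_pow G u k (w \<otimes> inv y \<otimes> z [^] k))"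
    proof (intro sum.cong refl)
      fix w assume w: "w \<in> carrier G"
      have "inv (x \<otimes> inv w \<otimes> z [^] j) \<otimes> (x \<otimes> inv y \<otimes> z [^] (j + k))
          = inv (z [^] j) \<otimes> (w \<otimes> (inv x \<otimes> x) \<otimes> inv y \<otimes> z [^] j \<otimes> z [^] k)"
        using w x y z zj by (simp add: inv_mult_group m_assoc nat_pow_mult[symmetric])
      also have "\<dots> = inv (z [^] j) \<otimes> ((w \<otimes> inv y) \<otimes> z [^] j \<otimes> z [^] k)" using w x y by simp
      also have "(w \<otimes> inv y) \<otimes> z [^] j = z [^] j \<otimes> (w \<otimes> inv y)" using w y zc by simp
      also have "inv (z [^] j) \<otimes> (z [^] j \<otimes> (w \<otimes> inv y) \<otimes> z [^] k) = w \<otimes> inv y \<otimes> z [^] k"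
        using w y z by (simp add: m_assoc[symmetric])
      finally show "F (x \<otimes> inv w \<otimes> z [^] j) = grp_pow G u j (x \<otimes> inv w \<otimes> z [^] j) * grp_pow G u k (w \<otimes> inv y \<otimes> z [^] k)"
        by (simp add: F_def)
    qed
    finally show ?thesis
      by (simp add: M_def power_add sum_distrib_left mult_ac flip: of_int_mult of_int_sum)
  qed
  have eq1: "x \<otimes> inv y = \<one> \<longleftrightarrow> x = y" if "x \<in> carrier G" "y \<in> carrier G" for x y
    using that by (metis inv_closed inv_equality inv_inv r_inv)
  have M0: "M 0 x y = (if x = y then 1 else 0)" if "x \<in> carrier G" "y \<in> carrier G" for x y
    using that by (simp add: M_def grp_basis_def eq1)
  have MN: "M N x y = (if x = y then 1 else 0)" if "x \<in> carrier G" "y \<in> carrier G" for x y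
    using that by (simp add: M_def grp_basis_def eq1 uN zN sN flip: of_int_power)
  have M1: "M 1 x y = of_int (s * u (x \<otimes> inv y \<otimes> z))" for x y
    using supp z by (simp add: M_def)
  have "Re (\<Sum>x\<in>carrier G. M 1 x x) = card (carrier G) * real_of_int (s * u z)"
    using z by (simp add: M1 del: One_nat_def)
  also have "\<dots> \<ge> card (carrier G)"
    using mult_left_mono[of 1 "real_of_int (s * u z)" "card (carrier G)"] s(1)[folded of_int_le_iff[where 'a=real]] by simp
  finally have delta: "M 1 x y = (if x = y then 1 else 0)" if "x \<in> carrier G" "y \<in> carrier G" for x y
    using finite_order_trace(2)[OF fin N mult M0 MN] that by blast
  have val: "s * u h = (if h = z then 1 else 0)" if h: "h \<in> carrier G" for h
  proof -
    have "M 1 h z = of_int (s * u h)" using h z(1) by (simp add: M1 m_assoc del: One_nat_def)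
    then have "complex_of_int (s * u h) = of_int (if h = z then 1 else 0)" using delta[OF h z(1)] by auto
    then show ?thesis by (simp only: of_int_eq_iff)
  qed
  \<comment> \<open>At this point \<open>u\<close> is \<open>s\<close> times the basis element at
    \<open>z\<close>; the augmentation 1 excludes the negative sign.\<close>
  have "s = (\<Sum>h\<in>carrier G. s * u h)" using aug by (simp add: sum_distrib_left[symmetric])
  also have "\<dots> = 1" using val z by simp
  finally have "s = 1" .
  then show ?thesis using val supp z by (intro supp_ext) (auto simp: grp_basis_def grp_supp_def)
qed

end

section \<open>Functoriality\<close>

lemma sum_push:
  assumes "finite (carrier G)" "finite (carrier H)" "\<phi> \<in> carrier G \<rightarrow> carrier H"
  shows "(\<Sum>y\<in>carrier H. push G \<phi> u y * f y) = (\<Sum>x\<in>carrier G. u x * f (\<phi> x))"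
proof -
  have "(\<Sum>y\<in>carrier H. push G \<phi> u y * f y) = (\<Sum>y\<in>carrier H. \<Sum>x\<in>{x\<in>carrier G. \<phi> x = y}. u x * f (\<phi> x))"
    unfolding push_def sum_distrib_right by (intro sum.cong) auto
  also have "\<dots> = (\<Sum>x\<in>carrier G. u x * f (\<phi> x))"
    using assms by (intro sum.group) auto
  finally show ?thesis .
qed

lemma supp_push: "\<phi> \<in> carrier G \<rightarrow> carrier H \<Longrightarrow> grp_supp H (push G \<phi> u)"
  unfolding grp_supp_def push_def by (auto intro!: sum.neutral)

locale fin_hom = G: fin_group G + H: fin_group H for G (structure) and H (structure) +
  fixes \<phi>
  assumes hom: "\<phi> \<in> hom G H"
begin

lemma \<phi>_closed [simp]: "x \<in> carrier G \<Longrightarrow> \<phi> x \<in> carrier H"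
  using hom by (auto simp: hom_def)

lemma \<phi>_mult [simp]: "x \<in> carrier G \<Longrightarrow> y \<in> carrier G \<Longrightarrow> \<phi> (x \<otimes>\<^bsub>G\<^esub> y) = \<phi> x \<otimes>\<^bsub>H\<^esub> \<phi> y"
  using hom by (auto simp: hom_def)

lemma \<phi>_one [simp]: "\<phi> \<one>\<^bsub>G\<^esub> = \<one>\<^bsub>H\<^esub>"
  using hom_one hom G.is_group H.is_group by blast

lemma \<phi>_inv [simp]: "x \<in> carrier G \<Longrightarrow> \<phi> (inv\<^bsub>G\<^esub> x) = inv\<^bsub>H\<^esub> \<phi> x"
  using hom G.is_group H.is_group by (metis group_hom.hom_inv group_hom.intro group_hom_axioms.intro)

lemma sum_push': "(\<Sum>y\<in>carrier H. push G \<phi> u y * f y) = (\<Sum>x\<in>carrier G. u x * f (\<phi> x))"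
  by (rule sum_push) auto

lemma push_eval: "y \<in> carrier H \<Longrightarrow> push G \<phi> u y = (\<Sum>x\<in>carrier G. u x * grp_basis y (\<phi> x))"
  using sum_push'[of u "grp_basis y"] H.sum_basis(1)[of y "push G \<phi> u"] by simp

lemma push_supp [simp]: "grp_supp H (push G \<phi> u)"
  by (rule supp_push) auto

lemma push_mult: "push G \<phi> (grp_mult G a b) = grp_mult H (push G \<phi> a) (push G \<phi> b)"
proof (rule H.supp_ext)
  fix y assume y: "y \<in> carrier H"
  have "push G \<phi> (grp_mult G a b) y = (\<Sum>x\<in>carrier G. grp_mult G a b x * grp_basis y (\<phi> x))"
    using y by (rule push_eval)
  also have "\<dots> = (\<Sum>x\<in>carrier G. \<Sum>z\<in>carrier G. a x * b z * grp_basis y (\<phi> x \<otimes>\<^bsub>H\<^esub> \<phi> z))"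
    unfolding G.sum_mult_eval by (intro sum.cong) auto
  also have "\<dots> = (\<Sum>x\<in>carrier G. a x * (\<Sum>z\<in>carrier G. b z * grp_basis y (\<phi> x \<otimes>\<^bsub>H\<^esub> \<phi> z)))"
    by (simp add: sum_distrib_left mult.assoc)
  also have "\<dots> = (\<Sum>x\<in>carrier G. a x * (\<Sum>q\<in>carrier H. push G \<phi> b q * grp_basis y (\<phi> x \<otimes>\<^bsub>H\<^esub> q)))"
    by (simp add: sum_push'[of b "\<lambda>q. grp_basis y (\<phi> _ \<otimes>\<^bsub>H\<^esub> q)"])
  also have "\<dots> = (\<Sum>p\<in>carrier H. push G \<phi> a p * (\<Sum>q\<in>carrier H. push G \<phi> b q * grp_basis y (p \<otimes>\<^bsub>H\<^esub> q)))"
    by (rule sum_push'[symmetric])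
  also have "\<dots> = (\<Sum>h\<in>carrier H. grp_mult H (push G \<phi> a) (push G \<phi> b) h * grp_basis y h)"
    unfolding H.sum_mult_eval by (simp add: sum_distrib_left mult.assoc)
  also have "\<dots> = grp_mult H (push G \<phi> a) (push G \<phi> b) y"
    using y by (rule H.sum_basis)
  finally show "push G \<phi> (grp_mult G a b) y = grp_mult H (push G \<phi> a) (push G \<phi> b) y" .
qed auto

lemma push_basis: "g \<in> carrier G \<Longrightarrow> push G \<phi> (grp_basis g) = grp_basis (\<phi> g)"
proof (rule H.supp_ext)
  fix y assume "g \<in> carrier G" "y \<in> carrier H"
  then show "push G \<phi> (grp_basis g) y = grp_basis (\<phi> g) y"
    by (simp add: push_eval G.sum_basis(2)[of g "\<lambda>x. grp_basis y (\<phi> x)"]) (simp add: grp_basis_def)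
qed auto

lemma push_pow: "push G \<phi> (grp_pow G u n) = grp_pow H (push G \<phi> u) n"
  by (induction n) (simp_all add: push_basis push_mult)

lemma sum_push_aug: "(\<Sum>y\<in>carrier H. push G \<phi> u y) = (\<Sum>x\<in>carrier G. u x)"
  using sum_push'[of u "\<lambda>_. 1"] by simp

lemma tors1_push: assumes "tors1 G u" shows "tors1 H (push G \<phi> u)"
proof -
  obtain n where n: "n > 0" "grp_pow G u n = grp_basis \<one>\<^bsub>G\<^esub>" using assms by (auto simp: tors1_def)
  have "grp_pow H (push G \<phi> u) n = grp_basis \<one>\<^bsub>H\<^esub>"
    unfolding push_pow[symmetric] n(2) by (simp add: push_basis)
  then show ?thesis using assms n(1) by (auto simp: tors1_def sum_push_aug)
qed

lemma \<phi>_conj: "h \<in> carrier G \<Longrightarrow> x \<in> conj_class G h \<Longrightarrow> \<phi> x \<in> conj_class H (\<phi> h)"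
  by (auto simp: conj_class_def)

lemma class_sum_push:
  "y \<in> carrier H \<Longrightarrow> class_sum H (push G \<phi> u) y = (\<Sum>x\<in>{x\<in>carrier G. \<phi> x \<in> conj_class H y}. u x)"
proof -
  assume y: "y \<in> carrier H"
  have sub: "conj_class H y \<subseteq> carrier H" using H.conj_class_closed[OF y] by blast
  have "class_sum H (push G \<phi> u) y = (\<Sum>z\<in>carrier H. push G \<phi> u z * of_bool (z \<in> conj_class H y))"
    unfolding class_sum_def using sub
    by (subst sum.mono_neutral_cong_right[of "carrier H" "conj_class H y" _ "push G \<phi> u"]) auto
  also have "\<dots> = (\<Sum>x\<in>carrier G. u x * of_bool (\<phi> x \<in> conj_class H y))" by (rule sum_push')
  also have "\<dots> = (\<Sum>x\<in>{x\<in>carrier G. \<phi> x \<in> conj_class H y}. u x)"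
    by (intro sum.mono_neutral_cong_right) auto
  finally show ?thesis .
qed

text \<open>Central elements are taken care of by the theorem of Berman and Higman; the remaining
  partial augmentations are read off in the image.\<close>

lemma trivial_augs_lift:
  assumes H: "trivial_augs H"
    and sep: "\<And>x y. x \<in> carrier G \<Longrightarrow> y \<in> carrier G \<Longrightarrow> centr G x \<noteq> carrier G \<Longrightarrow> centr G y \<noteq> carrier G \<Longrightarrow>
      \<phi> y \<in> conj_class H (\<phi> x) \<Longrightarrow> y \<in> conj_class G x"
  shows "trivial_augs G"
  unfolding trivial_augs_def
proof (intro allI impI)
  fix u assume u: "tors1 G u"
  have central: "(t \<otimes>\<^bsub>G\<^esub> z = z \<otimes>\<^bsub>G\<^esub> t)" if "centr G z = carrier G" "t \<in> carrier G" for t z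
    using that by (auto simp: centr_def)
  show "\<exists>g. aug_at G u g"
  proof (cases "\<exists>z\<in>carrier G. centr G z = carrier G \<and> u z \<noteq> 0")
    case True
    then obtain z where z: "z \<in> carrier G" "centr G z = carrier G" "u z \<noteq> 0" by blast
    have uz: "u = grp_basis z" using G.berman_higman[OF u z(1) central[OF z(2)] z(3)] .
    have cz: "conj_class G z = {z}" using G.conj_class_central[OF z(1) central[OF z(2)]] .
    have "class_sum G u h = (if h \<in> conj_class G z then 1 else 0)" if h: "h \<in> carrier G" for h
    proof (cases "z \<in> conj_class G h")
      case True
      then have "h = z" using G.conj_class_sym[OF h True] cz by simp
      then show ?thesis by (simp add: class_sum_def uz cz grp_basis_def)
    next
      case False
      then have "h \<noteq> z" using G.conj_class_refl[OF h] by auto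
      then show ?thesis using False by (auto simp: class_sum_def uz cz grp_basis_def intro!: sum.neutral)
    qed
    then show ?thesis using z by (auto simp: aug_at_def)
  next
    case False
    then have zero: "u z = 0" if "z \<in> carrier G" "centr G z = carrier G" for z using that by blast
    obtain y where y: "aug_at H (push G \<phi> u) y" using H tors1_push[OF u] by (auto simp: trivial_augs_def)
    then have yc: "y \<in> carrier H" by (simp add: aug_at_def)
    have "(\<Sum>x\<in>{x\<in>carrier G. \<phi> x \<in> conj_class H y}. u x) = 1"
      using y class_sum_push[OF yc, of u] H.conj_class_refl[OF yc] yc by (auto simp: aug_at_def)
    \<comment> \<open>The coefficients over the class of \<open>y\<close> add up to 1, so one of
      them is nonzero. It does not belong to a central element, where \<open>u\<close> vanishes in
      the present case.\<close>
    then obtain g where g: "g \<in> carrier G" "\<phi> g \<in> conj_class H y" "u g \<noteq> 0"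
      by (metis (mono_tags, lifting) mem_Collect_eq sum.neutral zero_neq_one)
    have gn: "centr G g \<noteq> carrier G" using zero g by blast
    have yg: "conj_class H (\<phi> g) = conj_class H y" using H.conj_class_eq[OF yc g(2)] .
    have "class_sum G u h = (if h \<in> conj_class G g then 1 else 0)" if h: "h \<in> carrier G" for h
    proof (cases "centr G h = carrier G")
      case True
      have ch: "conj_class G h = {h}" using G.conj_class_central[OF h central[OF True]] .
      have "h \<notin> conj_class G g"
        using G.conj_class_sym[OF g(1), of h] ch gn True by (metis singletonD)
      then show ?thesis using zero[OF h True] by (simp add: class_sum_def ch)
    next
      case False
      \<comment> \<open>The preimage of the class of \<open>\<phi> h\<close> consists of the class
        of \<open>h\<close> and possibly central elements, and the latter contribute 0.\<close>
      have "class_sum G u h = (\<Sum>x\<in>{x\<in>carrier G. \<phi> x \<in> conj_class H (\<phi> h)}. u x)"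
        unfolding class_sum_def
      proof (rule sum.mono_neutral_left)
        show "conj_class G h \<subseteq> {x \<in> carrier G. \<phi> x \<in> conj_class H (\<phi> h)}"
          using G.conj_class_closed[OF h] \<phi>_conj[OF h] by blast
        show "\<forall>i\<in>{x \<in> carrier G. \<phi> x \<in> conj_class H (\<phi> h)} - conj_class G h. u i = 0"
          using sep[OF h _ False] zero by blast
      qed auto
      also have "\<dots> = class_sum H (push G \<phi> u) (\<phi> h)" using h by (simp add: class_sum_push)
      also have "\<dots> = (if \<phi> h \<in> conj_class H (\<phi> g) then 1 else 0)" using y h yg by (simp add: aug_at_def)
      also have "\<phi> h \<in> conj_class H (\<phi> g) \<longleftrightarrow> h \<in> conj_class G g"
        using sep[OF g(1) h gn False] \<phi>_conj[OF g(1)] by blast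
      finally show ?thesis .
    qed
    then show ?thesis using g by (auto simp: aug_at_def)
  qed
qed

end

text \<open>All elements are central, so Berman-Higman applies at any point of the support.\<close>

lemma (in fin_group) trivial_augs_abelian:
  assumes "\<And>x y. x \<in> carrier G \<Longrightarrow> y \<in> carrier G \<Longrightarrow> x \<otimes> y = y \<otimes> x"
  shows "trivial_augs G"
  unfolding trivial_augs_def
proof (intro allI impI)
  fix u assume u: "tors1 G u"
  then have "(\<Sum>x\<in>carrier G. u x) \<noteq> 0" by (simp add: tors1_def)
  then obtain z where z: "z \<in> carrier G" "u z \<noteq> 0" by (meson sum.neutral)
  have uz: "u = grp_basis z" using berman_higman[OF u z(1) _ z(2)] assms z by blast
  have "conj_class G h = {h}" if "h \<in> carrier G" for h
    using conj_class_central[OF that] assms that by blast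
  then show "\<exists>g. aug_at G u g"
    using z by (intro exI[of _ z]) (auto simp: aug_at_def class_sum_def uz grp_basis_def)
qed

section \<open>Power maps modulo a prime\<close>

text \<open>The orbits of \<sigma> have one or \<open>p\<close> elements and \<open>f\<close> is
  constant on them. The induction removes one orbit of length \<open>p\<close> at a time, which
  changes the sum by a multiple of \<open>p\<close>.\<close>

lemma sum_cyclic_cong:
  fixes f :: "'b \<Rightarrow> int" and p :: nat
  assumes p: "prime p"
  assumes "finite S" "\<And>x. x \<in> S \<Longrightarrow> \<sigma> x \<in> S" "\<And>x. x \<in> S \<Longrightarrow> (\<sigma> ^^ p) x = x"
    "\<And>x. x \<in> S \<Longrightarrow> f (\<sigma> x) = f x"
  shows "[(\<Sum>x\<in>S. f x) = (\<Sum>x\<in>{x\<in>S. \<sigma> x = x}. f x)] (mod int p)"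
  using assms(2-)
proof (induction "card S" arbitrary: S rule: less_induct)
  case less
  note S = less.prems
  show ?case
  proof (cases "\<exists>x\<in>S. \<sigma> x \<noteq> x")
    case False
    then have "{x\<in>S. \<sigma> x = x} = S" by auto
    then show ?thesis by simp
  next
    case True
    then obtain x where x: "x \<in> S" "\<sigma> x \<noteq> x" by blast
    have iter: "(\<sigma> ^^ i) y \<in> S" "f ((\<sigma> ^^ i) y) = f y" if "y \<in> S" for i y
      using S that by (induction i) auto
    have fixm: "(\<sigma> ^^ (d * k)) y = y" if "(\<sigma> ^^ d) y = y" for d k y
      using that by (induction k) (auto simp: funpow_add)
    have comp: "(\<sigma> ^^ a) ((\<sigma> ^^ b) y) = (\<sigma> ^^ (a + b)) y" for a b y by (simp add: funpow_add)
    have nofix: "(\<sigma> ^^ d) y \<noteq> y" if d: "0 < d" "d < p" and y: "y \<in> S" "\<sigma> y \<noteq> y" for d y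
    proof
      assume *: "(\<sigma> ^^ d) y = y"
      \<comment> \<open>If the iterate number \<open>d\<close> fixed \<open>y\<close>, so would the
        iterate number \<open>d * a\<close> for an inverse \<open>a\<close> of \<open>d\<close>
        modulo \<open>p\<close>; this iterate agrees with \<sigma> on \<open>y\<close>.\<close>
      have "coprime d p" using d p prime_imp_coprime[of p d] by (auto simp: coprime_commute dest: nat_dvd_not_less)
      then obtain a where "[d * a = 1] (mod p)" using cong_solve_coprime_nat by auto
      moreover have "p > 1" using p prime_gt_1_nat by blast
      ultimately have "(d * a) mod p = 1" by (simp add: cong_def)
      then have "d * a = p * (d * a div p) + 1" by (metis mult_div_mod_eq)
      then have "(\<sigma> ^^ (1 + p * (d * a div p))) y = y" using fixm[OF *, of a] by simp
      then have "\<sigma> ((\<sigma> ^^ (p * (d * a div p))) y) = y" by simp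
      then show False using fixm[of p y] S(3) y by simp
    qed
    define Orb where "Orb = (\<lambda>i. (\<sigma> ^^ i) x) ` {..<p}"
    have "p > 0" using p prime_gt_0_nat by blast
    have orb_moves: "\<sigma> ((\<sigma> ^^ i) x) \<noteq> (\<sigma> ^^ i) x" if "i < p" for i
    proof
      assume "\<sigma> ((\<sigma> ^^ i) x) = (\<sigma> ^^ i) x"
      then have "(\<sigma> ^^ (p - i)) (\<sigma> ((\<sigma> ^^ i) x)) = (\<sigma> ^^ (p - i)) ((\<sigma> ^^ i) x)" by simp
      moreover have "(\<sigma> ^^ (p - i)) ((\<sigma> ^^ i) x) = x" using that S(3) x by (simp add: comp)
      moreover have "(\<sigma> ^^ (p - i)) (\<sigma> ((\<sigma> ^^ i) x)) = \<sigma> ((\<sigma> ^^ (p - i)) ((\<sigma> ^^ i) x))"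
        by (simp add: funpow_swap1)
      ultimately show False using x by simp
    qed
    have inj: "inj_on (\<lambda>i. (\<sigma> ^^ i) x) {..<p}"
    proof (rule linorder_inj_onI')
      fix i j assume "i \<in> {..<p}" "j \<in> {..<p}" "i < j"
      then have "(\<sigma> ^^ (j - i)) ((\<sigma> ^^ i) x) \<noteq> (\<sigma> ^^ i) x"
        using nofix[of "j - i" "(\<sigma> ^^ i) x"] orb_moves[of i] iter x by auto
      moreover have "(\<sigma> ^^ (j - i)) ((\<sigma> ^^ i) x) = (\<sigma> ^^ j) x"
        using \<open>i < j\<close> by (simp add: comp)
      ultimately show "(\<sigma> ^^ i) x \<noteq> (\<sigma> ^^ j) x" by simp
    qed
    have orbS: "Orb \<subseteq> S" using iter x by (auto simp: Orb_def)
    have orb_closed: "\<sigma> y \<in> Orb" if y: "y \<in> Orb" for y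
    proof -
      obtain i where i: "i < p" "y = (\<sigma> ^^ i) x" using y by (auto simp: Orb_def)
      show ?thesis
      proof (cases "Suc i < p")
        case True
        then show ?thesis using i by (auto simp: Orb_def intro!: image_eqI[of _ _ "Suc i"])
      next
        case False
        then have "Suc i = p" using i by simp
        then have "\<sigma> y = x" using i S(3)[OF x(1)] by (metis funpow.simps(2) comp_apply)
        then show ?thesis using \<open>p > 0\<close> by (auto simp: Orb_def intro!: image_eqI[of _ _ 0])
      qed
    qed
    have orb_iter: "(\<sigma> ^^ i) y \<in> Orb" if "y \<in> Orb" for i y
      using that orb_closed by (induction i) auto
    have closed: "\<sigma> y \<in> S - Orb" if y: "y \<in> S - Orb" for y
    proof -
      have "\<sigma> y \<notin> Orb"
      proof
        assume "\<sigma> y \<in> Orb"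
        then have "(\<sigma> ^^ (p - 1)) (\<sigma> y) \<in> Orb" by (rule orb_iter)
        moreover have "(\<sigma> ^^ (p - 1)) (\<sigma> y) = (\<sigma> ^^ p) y"
          using \<open>p > 0\<close> by (metis Suc_diff_1 comp_apply funpow_Suc_right)
        ultimately show False using S(3) y by simp
      qed
      then show ?thesis using S y by simp
    qed
    have "card (S - Orb) < card S"
      using orbS x S(1) \<open>p > 0\<close> by (intro psubset_card_mono) (auto simp: Orb_def intro!: image_eqI[of _ _ 0])
    then have IH: "[(\<Sum>x\<in>S - Orb. f x) = (\<Sum>x\<in>{x\<in>S - Orb. \<sigma> x = x}. f x)] (mod int p)"
      using S closed by (intro less.hyps) auto
    have "(\<Sum>y\<in>Orb. f y) = int p * f x"
      unfolding Orb_def using inj iter x by (simp add: sum.reindex)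
    moreover have "(\<Sum>y\<in>S. f y) = (\<Sum>y\<in>S - Orb. f y) + (\<Sum>y\<in>Orb. f y)"
      using sum.subset_diff[OF orbS S(1)] .
    moreover have "{y\<in>S - Orb. \<sigma> y = y} = {y\<in>S. \<sigma> y = y}" using orb_moves by (auto simp: Orb_def)
    ultimately show ?thesis using IH by (simp add: cong_def)
  qed
qed

lemma int_power_prime_cong:
  fixes x :: int assumes p: "prime (p::nat)"
  shows "[x ^ p = x] (mod int p)"
proof -
  define a where "a = nat (x mod int p)"
  have p0: "p > 0" using p prime_gt_0_nat by blast
  have xa: "[x = int a] (mod int p)" using p0 by (simp add: a_def cong_def)
  have "[a ^ p = a] (mod p)"
  proof (cases "p dvd a")
    case True
    then have "p dvd a ^ p" using p0 dvd_trans[OF True dvd_power[of p a]] by simp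
    then show ?thesis using True by (simp add: cong_def)
  next
    case False
    then have "[a * a ^ (p - 1) = a * 1] (mod p)" using fermat_theorem[OF p] by (intro cong_scalar_left)
    then show ?thesis using p0 by (simp add: power_eq_if)
  qed
  then have "[int a ^ p = int a] (mod int p)" by (simp only: cong_int_iff flip: of_nat_power)
  then show ?thesis using cong_trans[OF cong_pow[OF xa] cong_trans[OF _ cong_sym[OF xa]]] by blast
qed

context fin_group
begin

fun lprod :: "'a list \<Rightarrow> 'a" where
  "lprod [] = \<one>"
| "lprod (x # xs) = x \<otimes> lprod xs"

lemma lprod_closed [simp]: "set xs \<subseteq> carrier G \<Longrightarrow> lprod xs \<in> carrier G"
  by (induction xs) auto

lemma lprod_snoc: "set xs \<subseteq> carrier G \<Longrightarrow> x \<in> carrier G \<Longrightarrow> lprod (xs @ [x]) = lprod xs \<otimes> x"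
  by (induction xs) (auto simp: m_assoc)

lemma lprod_replicate: "x \<in> carrier G \<Longrightarrow> lprod (replicate n x) = x [^] n"
proof (induction n)
  case (Suc n)
  then show ?case using nat_pow_Suc2[of x n] by simp
qed simp

text \<open>The expansion over words makes the symmetry of a power visible: the cyclic group of
  order \<open>n\<close> acts by rotating words.\<close>

lemma sum_pow_eval:
  assumes "grp_supp G u"
  shows "(\<Sum>h\<in>carrier G. grp_pow G u n h * f h)
    = (\<Sum>xs\<in>{xs. set xs \<subseteq> carrier G \<and> length xs = n}. prod_list (map u xs) * f (lprod xs))"
proof (induction n arbitrary: f)
  case 0
  have "{xs. set xs \<subseteq> carrier G \<and> length xs = 0} = {[]}" by auto
  then show ?case by (simp add: sum_basis)
next
  case (Suc n)
  let ?S = "\<lambda>n. {xs. set xs \<subseteq> carrier G \<and> length xs = n}"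
  have "(\<Sum>h\<in>carrier G. grp_pow G u (Suc n) h * f h)
      = (\<Sum>x\<in>carrier G. u x * (\<Sum>y\<in>carrier G. grp_pow G u n y * f (x \<otimes> y)))"
    unfolding pow_Suc_left[OF assms] sum_mult_eval by (simp add: sum_distrib_left mult.assoc)
  also have "\<dots> = (\<Sum>x\<in>carrier G. \<Sum>xs\<in>?S n. prod_list (map u (x # xs)) * f (lprod (x # xs)))"
    unfolding Suc by (simp add: sum_distrib_left mult.assoc)
  also have "\<dots> = (\<Sum>(x, xs)\<in>carrier G \<times> ?S n. prod_list (map u (x # xs)) * f (lprod (x # xs)))"
    by (rule sum.cartesian_product)
  also have "\<dots> = (\<Sum>xs\<in>?S (Suc n). prod_list (map u xs) * f (lprod xs))"
    by (rule sum.reindex_bij_witness[where i="\<lambda>xs. (hd xs, tl xs)" and j="\<lambda>(x, xs). x # xs"])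
       (auto simp: length_Suc_conv)
  finally show ?case .
qed

lemma class_sum_eval:
  "h \<in> carrier G \<Longrightarrow> class_sum G u h = (\<Sum>x\<in>carrier G. u x * of_bool (x \<in> conj_class G h))"
  unfolding class_sum_def using conj_class_closed
  by (intro sum.mono_neutral_cong_left) auto

text \<open>Rotating a word of length \<open>p\<close> preserves its weight and the conjugacy class
  of its product. Modulo \<open>p\<close> only the constant words survive; they contribute the
  coefficients \<open>u x ^ p\<close>, which Fermat's theorem replaces by
  \<open>u x\<close>.\<close>

lemma class_sum_pow_cong:
  assumes p: "prime p" and u: "grp_supp G u" and h: "h \<in> carrier G"
  shows "[class_sum G (grp_pow G u p) h = (\<Sum>x\<in>{x\<in>carrier G. x [^] p \<in> conj_class G h}. u x)] (mod int p)"
proof -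
  define S where "S = {xs. set xs \<subseteq> carrier G \<and> length xs = p}"
  define f where "f = (\<lambda>xs. prod_list (map u xs) * of_bool (lprod xs \<in> conj_class G h))"
  have p0: "p > 0" using p prime_gt_0_nat by blast
  have finS: "finite S" unfolding S_def using finite_lists_length_eq[OF fin] by simp
  have inv_f: "f (rotate1 xs) = f xs" if "xs \<in> S" for xs
  proof (cases xs)
    case (Cons x ys)
    have xy: "x \<in> carrier G" "set ys \<subseteq> carrier G" using that Cons by (auto simp: S_def)
    \<comment> \<open>Moving the first letter to the end conjugates the product by that
      letter.\<close>
    have r: "inv x \<otimes> lprod xs \<otimes> inv (inv x) = lprod (rotate1 xs)" "x \<otimes> lprod (rotate1 xs) \<otimes> inv x = lprod xs"
      using xy by (simp_all add: Cons lprod_snoc m_assoc)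
    have "lprod (rotate1 xs) \<in> conj_class G (lprod xs)" "lprod xs \<in> conj_class G (lprod (rotate1 xs))"
      using conj_classI[of "inv x" "lprod xs"] conj_classI[of x "lprod (rotate1 xs)"] xy(1)
      unfolding r by simp_all
    then have "lprod (rotate1 xs) \<in> conj_class G h \<longleftrightarrow> lprod xs \<in> conj_class G h"
      using conj_class_trans[OF h] by blast
    then show ?thesis by (simp add: f_def Cons mult.commute)
  qed simp
  have "class_sum G (grp_pow G u p) h = (\<Sum>xs\<in>S. f xs)"
    using h by (simp add: class_sum_eval sum_pow_eval[OF u] S_def f_def)
  also have "[(\<Sum>xs\<in>S. f xs) = (\<Sum>xs\<in>{xs\<in>S. rotate1 xs = xs}. f xs)] (mod int p)"
  proof (rule sum_cyclic_cong[OF p finS])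
    fix xs assume xs: "xs \<in> S"
    show "rotate1 xs \<in> S" using xs by (auto simp: S_def)
    show "(rotate1 ^^ p) xs = xs" using xs unfolding rotate_def[symmetric] by (simp add: S_def)
    show "f (rotate1 xs) = f xs" using inv_f xs .
  qed
  also have "{xs\<in>S. rotate1 xs = xs} = (\<lambda>x. replicate p x) ` carrier G"
  proof (intro Set.set_eqI iffI)
    fix xs assume "xs \<in> {xs\<in>S. rotate1 xs = xs}"
    then have xs: "set xs \<subseteq> carrier G" "length xs = p" "rotate1 xs = xs" by (auto simp: S_def)
    have nth0: "xs ! i = xs ! 0" if "i < p" for i
      using that
    proof (induction i)
      case (Suc i)
      have "xs ! i = rotate1 xs ! i" using xs by simp
      also have "\<dots> = xs ! Suc i" using Suc.prems xs(2) by (simp add: nth_rotate1)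
      finally show ?case using Suc by simp
    qed simp
    have "xs = replicate p (xs ! 0)"
    proof (rule nth_equalityI)
      fix i assume "i < length xs"
      then show "xs ! i = replicate p (xs ! 0) ! i" using nth0[of i] xs(2) by simp
    qed (simp add: xs(2))
    moreover have "xs ! 0 \<in> carrier G" using xs(1,2) p0 nth_mem[of 0 xs] by auto
    ultimately show "xs \<in> (\<lambda>x. replicate p x) ` carrier G" by blast
  qed (auto simp: S_def)
  also have "(\<Sum>xs\<in>(\<lambda>x. replicate p x) ` carrier G. f xs) = (\<Sum>x\<in>carrier G. u x ^ p * of_bool (x [^] p \<in> conj_class G h))"
  proof -
    have "inj_on (\<lambda>x. replicate p x) (carrier G)" using p0 by (intro inj_onI) simp
    then have "(\<Sum>xs\<in>(\<lambda>x. replicate p x) ` carrier G. f xs) = (\<Sum>x\<in>carrier G. f (replicate p x))"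
      by (simp only: sum.reindex comp_def)
    also have "\<dots> = (\<Sum>x\<in>carrier G. u x ^ p * of_bool (x [^] p \<in> conj_class G h))"
      by (intro sum.cong refl) (simp add: f_def lprod_replicate)
    finally show ?thesis .
  qed
  also have "[\<dots> = (\<Sum>x\<in>carrier G. u x * of_bool (x [^] p \<in> conj_class G h))] (mod int p)"
    by (rule cong_sum, rule cong_scalar_right, rule int_power_prime_cong[OF p])
  also have "(\<Sum>x\<in>carrier G. u x * of_bool (x [^] p \<in> conj_class G h)) = (\<Sum>x\<in>{x\<in>carrier G. x [^] p \<in> conj_class G h}. u x)"
    by (intro sum.mono_neutral_cong_right) auto
  finally show ?thesis .
qed

end

section \<open>Partial augmentations of powers\<close>

context fin_group
begin

text \<open>Grouping the sum by conjugacy classes leaves only partial augmentations, and just one of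
  them is nonzero.\<close>

lemma aug_at_sum:
  assumes v: "aug_at G v g"
    and f: "\<And>x t. x \<in> carrier G \<Longrightarrow> t \<in> carrier G \<Longrightarrow> f (t \<otimes> x \<otimes> inv t) = f x"
  shows "(\<Sum>x\<in>carrier G. of_int (v x) * f x) = (f g :: 'r::comm_ring_1)"
proof -
  have g: "g \<in> carrier G" using v by (simp add: aug_at_def)
  have fc: "f y = f x" if "x \<in> carrier G" "y \<in> conj_class G x" for x y
    using that f by (auto simp: conj_class_def)
  have "(\<Sum>x\<in>carrier G. of_int (v x) * f x)
      = (\<Sum>C\<in>conj_class G ` carrier G. \<Sum>x\<in>{x\<in>carrier G. conj_class G x = C}. of_int (v x) * f x)"
    by (rule sum.group[symmetric]) auto
  also have "\<dots> = (\<Sum>C\<in>conj_class G ` carrier G. if C = conj_class G g then f g else 0)"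
  proof (rule sum.cong[OF refl])
    fix C assume "C \<in> conj_class G ` carrier G"
    then obtain h where h: "h \<in> carrier G" "C = conj_class G h" by blast
    have "{x\<in>carrier G. conj_class G x = C} = conj_class G h"
    proof (intro Set.set_eqI iffI)
      fix x assume "x \<in> {x\<in>carrier G. conj_class G x = C}"
      then show "x \<in> conj_class G h" using h conj_class_refl[of x] by simp
    next
      fix x assume "x \<in> conj_class G h"
      then show "x \<in> {x\<in>carrier G. conj_class G x = C}"
        using h conj_class_closed[of h x] conj_class_eq[of h x] by simp
    qed
    then have "(\<Sum>x\<in>{x\<in>carrier G. conj_class G x = C}. of_int (v x) * f x) = (\<Sum>x\<in>conj_class G h. of_int (v x) * f h)"
      using fc h by (intro sum.cong) auto
    also have "\<dots> = of_int (class_sum G v h) * f h" by (simp add: class_sum_def sum_distrib_right)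
    also have "\<dots> = (if C = conj_class G g then f g else 0)"
    proof (cases "h \<in> conj_class G g")
      case True
      then show ?thesis using v h fc[OF g True] conj_class_eq[OF g True] by (simp add: aug_at_def)
    next
      case False
      then have "C \<noteq> conj_class G g" using conj_class_refl[of h] h by auto
      then show ?thesis using v h False by (simp add: aug_at_def)
    qed
    finally show "(\<Sum>x\<in>{x\<in>carrier G. conj_class G x = C}. of_int (v x) * f x) = (if C = conj_class G g then f g else 0)" .
  qed
  also have "\<dots> = f g" using g by simp
  finally show ?thesis .
qed

lemma aug_at_cong:
  assumes "aug_at G v g" "h \<in> conj_class G g"
  shows "aug_at G v h"
proof -
  have g: "g \<in> carrier G" using assms by (simp add: aug_at_def)
  have "h \<in> carrier G" "conj_class G h = conj_class G g"
    using conj_class_closed[OF g assms(2)] conj_class_eq[OF g assms(2)] by simp_all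
  then show ?thesis using assms(1) by (simp add: aug_at_def)
qed

lemma nat_pow_conj:
  assumes "x \<in> carrier G" "t \<in> carrier G"
  shows "(t \<otimes> x \<otimes> inv t) [^] (n::nat) = t \<otimes> x [^] n \<otimes> inv t"
proof (induction n)
  case (Suc n)
  then show ?case using assms by (simp add: m_assoc)
qed (use assms in simp)

text \<open>By assumption the \<open>p\<close>-th power is concentrated at the class of some
  \<open>g'\<close>. The congruence modulo \<open>p\<close> shows that its partial augmentation at
  \<open>g [^] p\<close> is 1 modulo \<open>p\<close>, hence nonzero, which identifies the
  class.\<close>

lemma aug_at_prime_pow:
  assumes G: "trivial_augs G" and v: "tors1 G v" "aug_at G v g" and p: "prime p"
  shows "aug_at G (grp_pow G v p) (g [^] p)"
proof -
  have g: "g \<in> carrier G" using v by (simp add: aug_at_def)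
  obtain g' where g': "aug_at G (grp_pow G v p) g'"
    using G tors1_pow[OF v(1), of p] by (auto simp: trivial_augs_def)
  define f :: "'a \<Rightarrow> int" where "f = (\<lambda>x. of_bool (x [^] p \<in> conj_class G (g [^] p)))"
  have "(\<Sum>x\<in>{x\<in>carrier G. x [^] p \<in> conj_class G (g [^] p)}. v x) = (\<Sum>x\<in>carrier G. of_int (v x) * f x)"
    unfolding f_def by (intro sum.mono_neutral_cong_left) auto
  also have "\<dots> = f g"
  proof (rule aug_at_sum[OF v(2)])
    fix x t assume xt: "x \<in> carrier G" "t \<in> carrier G"
    have gp: "g [^] p \<in> carrier G" using g by simp
    have "t \<otimes> x [^] p \<otimes> inv t \<in> conj_class G (x [^] p)" using xt by (intro conj_classI)
    moreover from this have "x [^] p \<in> conj_class G (t \<otimes> x [^] p \<otimes> inv t)"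
      using xt by (simp add: conj_class_sym[of "x [^] p"])
    ultimately have "t \<otimes> x [^] p \<otimes> inv t \<in> conj_class G (g [^] p) \<longleftrightarrow> x [^] p \<in> conj_class G (g [^] p)"
      using conj_class_trans[OF gp] by blast
    then show "f (t \<otimes> x \<otimes> inv t) = f x" using xt by (simp add: f_def nat_pow_conj)
  qed
  also have "f g = 1" using g by (simp add: f_def conj_class_refl)
  finally have "[class_sum G (grp_pow G v p) (g [^] p) = 1] (mod int p)"
    using class_sum_pow_cong[OF p _ nat_pow_closed[OF g, of p], of v] v(1) by (simp add: tors1_def)
  then have "class_sum G (grp_pow G v p) (g [^] p) \<noteq> 0"
    using p prime_gt_1_nat[OF p] by (auto simp: cong_def)
  then have "g [^] p \<in> conj_class G g'" using g' g by (auto simp: aug_at_def split: if_splits)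
  then show ?thesis using aug_at_cong g' by blast
qed

lemma aug_at_pow:
  assumes G: "trivial_augs G" and v: "tors1 G v" "aug_at G v g" and k: "k > 0"
  shows "aug_at G (grp_pow G v k) (g [^] k)"
  using k
proof (induction k rule: less_induct)
  case (less k)
  have g: "g \<in> carrier G" using v by (simp add: aug_at_def)
  show ?case
  proof (cases "k = 1")
    case True
    then show ?thesis using v g by (simp add: tors1_def)
  next
    case False
    then obtain p where p: "prime p" "p dvd k" using prime_factor_nat by blast
    then obtain m where m: "k = m * p" by (auto simp: dvd_def mult.commute)
    have "m > 0" "m < k" using m less.prems prime_gt_1_nat[OF p(1)] by auto
    then have "aug_at G (grp_pow G v m) (g [^] m)" using less.IH by blast
    then have "aug_at G (grp_pow G (grp_pow G v m) p) ((g [^] m) [^] p)"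
      by (intro aug_at_prime_pow[OF G tors1_pow[OF v(1)] _ p(1)])
    then show ?thesis using g by (simp add: m pow_mult nat_pow_pow)
  qed
qed

end

section \<open>Direct products with a group of order two\<close>

context fin_hom
begin

text \<open>Both specialisations of the central involution to \<open>1\<close> and \<open>- 1\<close> have trivial partial
  augmentations, and half their sum is integral only if these sit at the same class.\<close>

lemma trivial_augs_sign_extension:
  fixes l :: "_ \<Rightarrow> int"
  assumes H: "trivial_augs H"
    and l_mult: "\<And>x y. x \<in> carrier G \<Longrightarrow> y \<in> carrier G \<Longrightarrow> l (x \<otimes>\<^bsub>G\<^esub> y) = l x * l y"
    and l_sign: "\<And>x. x \<in> carrier G \<Longrightarrow> l x = 1 \<or> l x = - 1"
    and ex: "\<And>y e. y \<in> carrier H \<Longrightarrow> e = 1 \<or> e = - 1 \<Longrightarrow> \<exists>x\<in>carrier G. \<phi> x = y \<and> l x = e"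
    and inj: "\<And>x y. x \<in> carrier G \<Longrightarrow> y \<in> carrier G \<Longrightarrow> \<phi> x = \<phi> y \<Longrightarrow> l x = l y \<Longrightarrow> x = y"
  shows "trivial_augs G"
  unfolding trivial_augs_def
proof (intro allI impI)
  fix u assume u: "tors1 G u"
  obtain n where n: "n > 0" "grp_pow G u n = grp_basis \<one>\<^bsub>G\<^esub>" and supp: "grp_supp G u"
    and aug: "(\<Sum>x\<in>carrier G. u x) = 1" using u by (auto simp: tors1_def)
  have l2: "l x * l x = 1" if "x \<in> carrier G" for x using l_sign[OF that] by auto
  have l1: "l \<one>\<^bsub>G\<^esub> = 1" using l_mult[of "\<one>\<^bsub>G\<^esub>" "\<one>\<^bsub>G\<^esub>"] l2[of "\<one>\<^bsub>G\<^esub>"] by simp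
  have l_conj: "l (t \<otimes>\<^bsub>G\<^esub> x \<otimes>\<^bsub>G\<^esub> inv\<^bsub>G\<^esub> t) = l x" if "t \<in> carrier G" "x \<in> carrier G" for t x
  proof -
    have "l t * l (inv\<^bsub>G\<^esub> t) = 1" using l_mult[of t "inv\<^bsub>G\<^esub> t"] l1 that by simp
    then show ?thesis using that by (simp add: l_mult mult.commute mult.left_commute)
  qed
  \<comment> \<open>The value of \<open>u\<close> under the ring homomorphism to the integers given
    by the character \<open>l\<close>. It is a unit, hence a sign, and rescales the twisted element
    \<open>v\<close> below to augmentation 1.\<close>
  define s where "s = (\<Sum>x\<in>carrier G. l x * u x)"
  \<comment> \<open>Multiplying coefficients by the character \<open>l\<close> is a ring
    automorphism, so it commutes with powers.\<close>
  have tw_pow: "grp_pow G (\<lambda>x. e * (l x * u x)) k = (\<lambda>x. e ^ k * (l x * grp_pow G u k x))" for e k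
  proof (induction k)
    case 0
    show ?case by (auto simp: grp_basis_def l1)
  next
    case (Suc k)
    have tw: "grp_mult G (\<lambda>x. l x * grp_pow G u k x) (\<lambda>x. l x * u x) = (\<lambda>h. l h * grp_mult G (grp_pow G u k) u h)"
      by (rule ext) (auto simp: grp_mult_def sum_distrib_left l_mult intro!: sum.cong)
    show ?case by (simp only: grp_pow.simps Suc G.mult_scale tw) (simp add: fun_eq_iff mult_ac)
  qed
  have "s ^ n = (\<Sum>x\<in>carrier G. grp_pow G (\<lambda>x. 1 * (l x * u x)) n x)"
    unfolding G.sum_pow s_def by simp
  also have "\<dots> = (\<Sum>x\<in>carrier G. l x * grp_basis \<one>\<^bsub>G\<^esub> x)" unfolding tw_pow n(2) by simp
  also have "\<dots> = 1" using G.sum_basis(1)[of "\<one>\<^bsub>G\<^esub>" l] l1 by simp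
  finally have "s ^ n = 1" .
  then have "s dvd 1" using n(1) dvd_power[of n s] by simp
  then have "\<bar>s\<bar> = 1" by simp
  then have s: "s = 1 \<or> s = - 1" by linarith
  then have s2: "s * s = 1" by auto
  define v where "v = (\<lambda>x. s * (l x * u x))"
  have v: "tors1 G v"
  proof -
    have "grp_pow G v (n * 2) = grp_basis \<one>\<^bsub>G\<^esub>"
    proof -
      have "grp_pow G u (n * 2) = grp_basis \<one>\<^bsub>G\<^esub>" by (simp only: G.pow_mult n(2) G.basis_one_pow)
      then show ?thesis unfolding v_def tw_pow using s l1
        by (auto simp: grp_basis_def power_mult power2_eq_square power_mult_distrib[symmetric])
    qed
    moreover have "(\<Sum>x\<in>carrier G. v x) = 1" by (simp add: v_def sum_distrib_left[symmetric] s_def[symmetric] s2)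
    ultimately show ?thesis using supp n(1) by (auto simp: tors1_def v_def grp_supp_def intro!: exI[of _ "n * 2"])
  qed
  obtain r1 where r1: "aug_at H (push G \<phi> u) r1" using H tors1_push[OF u] by (auto simp: trivial_augs_def)
  obtain r2 where r2: "aug_at H (push G \<phi> v) r2" using H tors1_push[OF v] by (auto simp: trivial_augs_def)
  have r: "r1 \<in> carrier H" "r2 \<in> carrier H" using r1 r2 by (auto simp: aug_at_def)
  have cls: "conj_class G g = {x\<in>carrier G. \<phi> x \<in> conj_class H (\<phi> g) \<and> l x = l g}" if g: "g \<in> carrier G" for g
  proof (intro Set.set_eqI iffI)
    fix x assume "x \<in> conj_class G g"
    then show "x \<in> {x\<in>carrier G. \<phi> x \<in> conj_class H (\<phi> g) \<and> l x = l g}"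
      using \<phi>_conj[OF g] G.conj_class_closed[OF g] l_conj g by (auto simp: conj_class_def)
  next
    fix x assume "x \<in> {x\<in>carrier G. \<phi> x \<in> conj_class H (\<phi> g) \<and> l x = l g}"
    then obtain q where x: "x \<in> carrier G" "l x = l g" and q: "q \<in> carrier H" "\<phi> x = q \<otimes>\<^bsub>H\<^esub> \<phi> g \<otimes>\<^bsub>H\<^esub> inv\<^bsub>H\<^esub> q"
      by (auto simp: conj_class_def)
    obtain t where t: "t \<in> carrier G" "\<phi> t = q" using ex[OF q(1), of 1] by blast
    have "x = t \<otimes>\<^bsub>G\<^esub> g \<otimes>\<^bsub>G\<^esub> inv\<^bsub>G\<^esub> t" using x q t g by (intro inj) (auto simp: l_conj)
    then show "x \<in> conj_class G g" using t by (auto simp: conj_class_def)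
  qed
  \<comment> \<open>The class of \<open>g\<close> is the part of the preimage of the class of
    \<open>\<phi> g\<close> on which \<open>l\<close> equals \<open>l g\<close>. Adding the twisted
    copy of \<open>u\<close> with sign \<open>l g\<close> doubles this part and cancels the other
    one.\<close>
  have twice: "2 * class_sum G u g = (if \<phi> g \<in> conj_class H r1 then 1 else 0) + l g * s * (if \<phi> g \<in> conj_class H r2 then 1 else 0)"
    if g: "g \<in> carrier G" for g
  proof -
    let ?X = "{x\<in>carrier G. \<phi> x \<in> conj_class H (\<phi> g)}"
    have "2 * class_sum G u g = (\<Sum>x\<in>{x\<in>carrier G. \<phi> x \<in> conj_class H (\<phi> g) \<and> l x = l g}. 2 * u x)"
      unfolding class_sum_def cls[OF g] by (simp add: sum_distrib_left)
    also have "\<dots> = (\<Sum>x\<in>?X. u x + l g * s * v x)"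
    proof (rule sum.mono_neutral_cong_left)
      show "\<forall>i\<in>?X - {x \<in> carrier G. \<phi> x \<in> conj_class H (\<phi> g) \<and> l x = l g}. u i + l g * s * v i = 0"
      proof
        fix i assume "i \<in> ?X - {x \<in> carrier G. \<phi> x \<in> conj_class H (\<phi> g) \<and> l x = l g}"
        then have "l i = - l g" using l_sign[of i] l_sign[OF g] by auto
        then have "l g * s * v i = - (s * s) * (l g * l g) * u i" by (simp add: v_def)
        then show "u i + l g * s * v i = 0" using s2 l2[OF g] by simp
      qed
      fix x assume "x \<in> {x \<in> carrier G. \<phi> x \<in> conj_class H (\<phi> g) \<and> l x = l g}"
      then have "l g * s * v x = (s * s) * (l g * l g) * u x" by (simp add: v_def)
      then show "2 * u x = u x + l g * s * v x" using s2 l2[OF g] by simp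
    qed auto
    also have "\<dots> = class_sum H (push G \<phi> u) (\<phi> g) + l g * s * class_sum H (push G \<phi> v) (\<phi> g)"
      using g by (simp add: class_sum_push sum.distrib sum_distrib_left)
    finally show ?thesis using r1 r2 g by (simp add: aug_at_def)
  qed
  \<comment> \<open>Of the two lifts of \<open>r1\<close> the one with sign \<open>s\<close> is the
    candidate. If \<open>r1\<close> and \<open>r2\<close> were not conjugate, twice its partial
    augmentation would be 1.\<close>
  obtain g where g: "g \<in> carrier G" "\<phi> g = r1" "l g = s" using ex[OF r(1) s] by blast
  have "r1 \<in> conj_class H r2"
  proof (rule ccontr)
    assume "r1 \<notin> conj_class H r2"
    then have "2 * class_sum G u g = 1" using twice[OF g(1)] g H.conj_class_refl[OF r(1)] by simp
    then show False by presburger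
  qed
  then have r12: "conj_class H r2 = conj_class H r1" using H.conj_class_eq[OF r(2)] by metis
  have "class_sum G u h = (if h \<in> conj_class G g then 1 else 0)" if h: "h \<in> carrier G" for h
  proof -
    have "h \<in> conj_class G g \<longleftrightarrow> \<phi> h \<in> conj_class H r1 \<and> l h = s" using cls[OF g(1)] g h by auto
    moreover have "2 * class_sum G u h = (if \<phi> h \<in> conj_class H r1 then 1 + l h * s else 0)"
      using twice[OF h] r12 by simp
    moreover have "l h * s = (if l h = s then 1 else - 1)" using l_sign[OF h] s by auto
    ultimately show ?thesis by (auto split: if_splits)
  qed
  then show "\<exists>g. aug_at G u g" using g by (auto simp: aug_at_def)
qed

end

section \<open>Generalised dihedral groups\<close>

text \<open>The squares of elements of \<open>A\<close> form a normal subgroup \<open>N\<close> with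
  abelian quotient, so it remains to separate noncentral elements within a coset of
  \<open>N\<close>. Outside \<open>A\<close> such a coset is a single orbit under conjugation by
  \<open>A\<close>. Inside \<open>A\<close> the bound on the number of squares leaves only
  \<open>x\<close> and \<open>inv x\<close>, which are conjugate.\<close>

lemma (in fin_group) trivial_augs_dihedral:
  assumes A: "subgroup A G"
    and comm: "\<And>a b. a \<in> A \<Longrightarrow> b \<in> A \<Longrightarrow> a \<otimes> b = b \<otimes> a"
    and invert: "\<And>s a. s \<in> carrier G - A \<Longrightarrow> a \<in> A \<Longrightarrow> s \<otimes> a \<otimes> inv s = inv a"
    and index: "\<And>s t. s \<in> carrier G - A \<Longrightarrow> t \<in> carrier G - A \<Longrightarrow> s \<otimes> t \<in> A"
    and squares: "card ((\<lambda>a. a \<otimes> a) ` A) \<le> 3"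
  shows "trivial_augs G"
proof -
  define N where "N = (\<lambda>a. a \<otimes> a) ` A"
  have Ac: "a \<in> carrier G" if "a \<in> A" for a using subgroup.mem_carrier[OF A that] .
  have Am: "a \<otimes> b \<in> A" if "a \<in> A" "b \<in> A" for a b using subgroup.m_closed[OF A that] .
  have Ai: "inv a \<in> A" if "a \<in> A" for a using subgroup.m_inv_closed[OF A that] .
  have A1: "\<one> \<in> A" using subgroup.one_closed[OF A] .
  have NA: "n \<in> A" if "n \<in> N" for n using that Am by (auto simp: N_def)
  have invert': "s \<otimes> a = inv a \<otimes> s" if "s \<in> carrier G - A" "a \<in> A" for s a
  proof -
    have "s \<otimes> a = s \<otimes> a \<otimes> inv s \<otimes> s" using that Ac by (simp add: m_assoc)
    then show ?thesis using invert[OF that] by simp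
  qed
  have sq: "(a \<otimes> b) \<otimes> (a \<otimes> b) = (a \<otimes> a) \<otimes> (b \<otimes> b)" if "a \<in> A" "b \<in> A" for a b
  proof -
    have "(a \<otimes> b) \<otimes> (a \<otimes> b) = a \<otimes> (b \<otimes> a) \<otimes> b" using that Ac by (simp add: m_assoc)
    also have "b \<otimes> a = a \<otimes> b" using comm that by blast
    finally show ?thesis using that Ac by (simp add: m_assoc)
  qed
  have sub: "subgroup N G"
  proof (rule subgroupI)
    show "N \<subseteq> carrier G" using NA Ac by blast
    show "N \<noteq> {}" using A1 by (auto simp: N_def)
    show "inv n \<in> N" if "n \<in> N" for n
      using that Ai Ac by (auto simp: N_def inv_mult_group)
    show "m \<otimes> n \<in> N" if mn: "m \<in> N" "n \<in> N" for m n
    proof -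
      obtain a b where ab: "a \<in> A" "b \<in> A" "m = a \<otimes> a" "n = b \<otimes> b" using mn unfolding N_def by blast
      then have "m \<otimes> n = (a \<otimes> b) \<otimes> (a \<otimes> b)" using sq by simp
      then show ?thesis using Am ab unfolding N_def by blast
    qed
  qed
  have normal: "N \<lhd> G"
  proof (rule normal_invI[OF sub])
    fix x n assume x: "x \<in> carrier G" and n: "n \<in> N"
    show "x \<otimes> n \<otimes> inv x \<in> N"
    proof (cases "x \<in> A")
      case True
      then have "x \<otimes> n \<otimes> inv x = n" using comm[OF True NA[OF n]] Ac NA[OF n] by (simp add: m_assoc)
      then show ?thesis using n by simp
    next
      case False
      then show ?thesis using invert[of x n] x NA[OF n] subgroup.m_inv_closed[OF sub n] by simp
    qed
  qed
  interpret N: normal N G by (rule normal)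
  have fgM: "fin_group (G Mod N)"
    using N.factorgroup_is_group by (auto simp: fin_group_def fin_group_axioms_def FactGroup_def RCOSETS_def)
  interpret Q: fin_group "G Mod N" by (rule fgM)
  interpret h: fin_hom G "G Mod N" "\<lambda>x. N #> x"
    by unfold_locales (rule N.r_coset_hom_Mod)
  have coset_eq: "N #> (n \<otimes> x) = N #> x" if "n \<in> N" "x \<in> carrier G" for n x
    using that coset_mult_assoc[OF N.subset _ that(2), of n] coset_join2[OF _ sub that(1)] NA[OF that(1)] Ac by simp
  \<comment> \<open>Commutators lie in \<open>N\<close>: an element outside \<open>A\<close> inverts
    \<open>A\<close>, so its commutator with an element of \<open>A\<close> is a square. Two
    elements outside \<open>A\<close> have their product in \<open>A\<close>, and exchanging the
    factors inverts it.\<close>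
  have swap: "\<exists>n\<in>N. x \<otimes> y = n \<otimes> (y \<otimes> x)" if xy: "x \<in> carrier G" "y \<in> carrier G" for x y
  proof (cases "x \<in> A")
    case xA: True
    show ?thesis
    proof (cases "y \<in> A")
      case True
      then have "x \<otimes> y = (\<one> \<otimes> \<one>) \<otimes> (y \<otimes> x)" using comm xA xy by simp
      then show ?thesis using A1 unfolding N_def by blast
    next
      case False
      then have "y \<otimes> x = inv x \<otimes> y" using invert' xA xy by simp
      then have "x \<otimes> y = (x \<otimes> x) \<otimes> (y \<otimes> x)" using xy by (simp add: m_assoc)
      then show ?thesis using xA unfolding N_def by blast
    qed
  next
    case xA: False
    show ?thesis
    proof (cases "y \<in> A")
      case True
      then have "x \<otimes> y = inv y \<otimes> x" using invert' xA xy by simp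
      then have "x \<otimes> y = (inv y \<otimes> inv y) \<otimes> (y \<otimes> x)" using xy by (simp add: m_assoc)
      then show ?thesis using Ai[OF True] unfolding N_def by blast
    next
      case False
      have xyA: "x \<otimes> y \<in> A" using index xA False xy by blast
      have "inv x \<notin> A" using Ai[of "inv x"] xA xy by auto
      then have "inv x \<otimes> (x \<otimes> y) = inv (x \<otimes> y) \<otimes> inv x" using invert' xyA xy by simp
      then have "y = inv (x \<otimes> y) \<otimes> inv x" using xy by simp
      then have "y \<otimes> x = inv (x \<otimes> y)" using xy by (metis inv_closed inv_solve_right m_closed inv_inv)
      then have "x \<otimes> y = ((x \<otimes> y) \<otimes> (x \<otimes> y)) \<otimes> (y \<otimes> x)" using xy by (simp add: m_assoc[of "x \<otimes> y"])
      then show ?thesis using xyA unfolding N_def by blast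
    qed
  qed
  have Qcomm: "X \<otimes>\<^bsub>G Mod N\<^esub> Y = Y \<otimes>\<^bsub>G Mod N\<^esub> X" if XY: "X \<in> carrier (G Mod N)" "Y \<in> carrier (G Mod N)" for X Y
  proof -
    obtain x y where xy: "x \<in> carrier G" "y \<in> carrier G" "X = N #> x" "Y = N #> y"
      using XY by (auto simp: FactGroup_def RCOSETS_def)
    obtain n where n: "n \<in> N" "x \<otimes> y = n \<otimes> (y \<otimes> x)" using swap[OF xy(1,2)] by blast
    have "N #> (x \<otimes> y) = N #> (y \<otimes> x)" 
      unfolding n(2) by (rule coset_eq[OF n(1) m_closed[OF xy(2,1)]])
    then show ?thesis unfolding xy(3,4) h.\<phi>_mult[OF xy(1,2), symmetric] h.\<phi>_mult[OF xy(2,1), symmetric] .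
  qed
  show ?thesis
  proof (rule h.trivial_augs_lift)
    show "trivial_augs (G Mod N)" using Q.trivial_augs_abelian Qcomm by blast
    fix x y assume x: "x \<in> carrier G" and y: "y \<in> carrier G"
      and nx: "centr G x \<noteq> carrier G" and ny: "centr G y \<noteq> carrier G"
      and conj: "N #> y \<in> conj_class (G Mod N) (N #> x)"
    have "conj_class (G Mod N) (N #> x) = {N #> x}"
      using Q.conj_class_central[OF h.\<phi>_closed[OF x]] Qcomm h.\<phi>_closed[OF x] by blast
    then have "N #> y = N #> x" using conj by simp
    then have "y \<in> N #> x" using rcos_self[OF y sub] by simp
    then obtain n where n: "n \<in> N" "y = n \<otimes> x" by (auto simp: r_coset_def)
    then obtain a where a: "a \<in> A" "n = a \<otimes> a" by (auto simp: N_def)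
    show "y \<in> conj_class G x"
    proof (cases "x \<in> A")
      case False
      \<comment> \<open>Conjugating an element outside \<open>A\<close> by \<open>a\<close>
        multiplies it by the square of \<open>a\<close>.\<close>
      then have "x \<otimes> inv a = a \<otimes> x" using invert'[of x "inv a"] x Ai[OF a(1)] Ac[OF a(1)] by simp
      then have "a \<otimes> x \<otimes> inv a = y" using n a x Ac[OF a(1)] by (simp add: m_assoc)
      then show ?thesis using conj_classI[OF Ac[OF a(1)], of x] by simp
    next
      case xA: True
      then have yA: "y \<in> A" using n NA Am by blast
      have nonsq: "\<exists>t\<in>carrier G - A. t \<otimes> b \<otimes> inv t = inv b \<and> b \<otimes> b \<noteq> \<one>"
        if b: "b \<in> A" "centr G b \<noteq> carrier G" for b
      proof -
        obtain t where t: "t \<in> carrier G" "t \<otimes> b \<noteq> b \<otimes> t" using b by (auto simp: centr_def)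
        then have tA: "t \<in> carrier G - A" using comm b by auto
        have "b \<otimes> b \<noteq> \<one>"
        proof
          assume "b \<otimes> b = \<one>"
          then have "inv b = b" using Ac b by (metis inv_equality)
          then show False using invert'[OF tA b(1)] t by simp
        qed
        then show ?thesis using tA invert b by blast
      qed
      obtain t where t: "t \<in> carrier G" "t \<otimes> x \<otimes> inv t = inv x" and xx: "x \<otimes> x \<noteq> \<one>" using nonsq[OF xA nx] by auto
      have yy: "y \<otimes> y \<noteq> \<one>" using nonsq[OF yA ny] by auto
      \<comment> \<open>Otherwise \<open>n\<close>, the quotient of \<open>y\<close> by
        \<open>x\<close>, differs from 1 and from the inverse of \<open>q\<close>, the square of
        \<open>x\<close>. If \<open>q\<close> is an involution, the elements 1, \<open>q\<close>,
        \<open>n\<close> and \<open>n \<otimes> q\<close> are too many for \<open>N\<close>. If not,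
        \<open>N\<close> has order three and \<open>n = q\<close>, so the square of \<open>y\<close>
        is the cube of \<open>q\<close>, which is 1; but noncentral elements of \<open>A\<close> are
        not involutions.\<close>
      have "y = x \<or> y = inv x"
      proof (rule ccontr)
        assume neg: "\<not> (y = x \<or> y = inv x)"
        define q where "q = x \<otimes> x"
        have qN: "q \<in> N" using xA by (auto simp: q_def N_def)
        have qc: "q \<in> carrier G" and nc: "n \<in> carrier G" using qN n(1) NA Ac by blast+
        have q1: "q \<noteq> \<one>" using xx by (simp add: q_def)
        have iN: "inv q \<in> N" "n \<otimes> q \<in> N" "q \<otimes> q \<in> N" "\<one> \<in> N"
          using qN n(1) N.m_inv_closed N.m_closed N.one_closed by blast+
        have n1: "n \<noteq> \<one>" using neg n x by auto
        have nq: "n \<noteq> inv q"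
        proof
          assume "n = inv q"
          then have "y = inv x" using n x by (simp add: q_def inv_mult_group m_assoc)
          then show False using neg by simp
        qed
        have four: "False" if "{\<one>, q, b, c} \<subseteq> N" "card {\<one>, q, b, c} = 4" for b c
        proof -
          have "finite N" using N.subset fin finite_subset by blast
          then have "card {\<one>, q, b, c} \<le> card N" using that card_mono by blast
          then show False using that squares by (simp add: N_def)
        qed
        have nq1: "n \<otimes> q \<noteq> \<one>" using nq inv_equality qc nc by metis
        have nqq: "n \<otimes> q \<noteq> q" using n1 qc nc by simp
        have nqn: "n \<otimes> q \<noteq> n" using q1 qc nc by simp
        have qq: "q \<otimes> q \<noteq> q" using q1 qc by simp
        show False
        proof (cases "q = inv q")
          case True
          then have "card {\<one>, q, n, n \<otimes> q} = 4"
            using q1 n1 nq nq1 nqq nqn by auto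
          then show False using four[of n "n \<otimes> q"] iN qN n by simp
        next
          case False
          have qi: "inv q \<noteq> \<one>" using q1 qc by (metis inv_inv inv_one)
          have qq1: "q \<otimes> q \<noteq> \<one>" using False qc inv_equality by metis
          have "n = q"
          proof (rule ccontr)
            assume "n \<noteq> q"
            then have "card {\<one>, q, n, inv q} = 4" using q1 n1 nq False qi by auto
            then show False using four[of n "inv q"] iN qN n by simp
          qed
          moreover have "q \<otimes> q = inv q"
          proof (rule ccontr)
            assume "q \<otimes> q \<noteq> inv q"
            then have "card {\<one>, q, q \<otimes> q, inv q} = 4" using q1 False qi qq qq1 by auto
            then show False using four[of "q \<otimes> q" "inv q"] iN qN by simp
          qed
          ultimately have "(n \<otimes> n) \<otimes> (x \<otimes> x) = \<one>" using qc by (simp add: q_def[symmetric])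
          then show False using yy sq[OF NA[OF n(1)] xA] n by simp
        qed
      qed
      then show ?thesis using conj_classI[OF t(1), of x] t x by (auto simp: conj_class_refl)
    qed
  qed
qed

section \<open>Rational conjugacy\<close>

lemma sum_fun_eval: "(\<Sum>i\<in>I. F i) x = (\<Sum>i\<in>I. F i x)" for F :: "_ \<Rightarrow> _ \<Rightarrow> 'b::comm_monoid_add"
  by (induction I rule: infinite_finite_induct) auto

context fin_group
begin

abbreviation gmul :: "('a \<Rightarrow> 'r::comm_ring_1) \<Rightarrow> ('a \<Rightarrow> 'r) \<Rightarrow> 'a \<Rightarrow> 'r" (infixl "\<star>" 70) where
  "a \<star> b \<equiv> grp_mult G a b"

abbreviation gone :: "'a \<Rightarrow> 'r::comm_ring_1" where
  "gone \<equiv> grp_basis \<one>"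

lemma mult_sum_left: "(\<Sum>i\<in>I. F i) \<star> b = (\<Sum>i\<in>I. F i \<star> b)"
proof (induction I rule: infinite_finite_induct)
  case (insert i I)
  then show ?case by (simp only: sum.insert insert.hyps mult_add_left)
qed (simp_all only: sum.infinite sum.empty mult_zero simp_thms)

lemma mult_sum_right: "b \<star> (\<Sum>i\<in>I. F i) = (\<Sum>i\<in>I. b \<star> F i)"
proof (induction I rule: infinite_finite_induct)
  case (insert i I)
  then show ?case by (simp only: sum.insert insert.hyps mult_add_right)
qed (simp_all only: sum.infinite sum.empty mult_zero simp_thms)

lemma supp_sum: "(\<And>i. i \<in> I \<Longrightarrow> grp_supp G (F i)) \<Longrightarrow> grp_supp G (\<Sum>i\<in>I. F i)"
  by (induction I rule: infinite_finite_induct) simp_all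

lemma basis_mult_eval: "t \<in> carrier G \<Longrightarrow> k \<in> carrier G \<Longrightarrow> (grp_basis t \<star> q) k = q (inv t \<otimes> k)"
  by (simp add: mult_eval sum_basis)

lemma two_sided_eval:
  assumes "s \<in> carrier G"
  shows "(p \<star> (y \<star> q)) s = (\<Sum>t\<in>carrier G. y t * (p \<star> (grp_basis t \<star> q)) s)"
proof -
  have "(p \<star> (y \<star> q)) s = (\<Sum>x\<in>carrier G. \<Sum>t\<in>carrier G. y t * (p x * q (inv t \<otimes> (inv x \<otimes> s))))"
    using assms by (simp add: mult_eval sum_distrib_left mult_ac)
  also have "\<dots> = (\<Sum>t\<in>carrier G. y t * (\<Sum>x\<in>carrier G. p x * q (inv t \<otimes> (inv x \<otimes> s))))"
    by (subst sum.swap) (simp add: sum_distrib_left)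
  also have "\<dots> = (\<Sum>t\<in>carrier G. y t * (p \<star> (grp_basis t \<star> q)) s)"
    using assms by (intro sum.cong refl) (simp add: mult_eval[of s] basis_mult_eval)
  finally show ?thesis .
qed

text \<open>This is why partial augmentations decide conjugacy: the trace of the linear map
  \<open>y\<close> \<mapsto> \<open>p \<star> (y \<star> q)\<close> on the group algebra depends on
  \<open>q\<close> only through its class sums, since \<open>t\<close> conjugates each element of
  the group through its whole class.\<close>

lemma two_sided_trace:
  "(\<Sum>t\<in>carrier G. (p \<star> (grp_basis t \<star> q)) t)
    = (\<Sum>x\<in>carrier G. p x * (of_nat (card (centr G (inv x))) * class_sum G q (inv x)))"
proof -
  have "(\<Sum>t\<in>carrier G. (p \<star> (grp_basis t \<star> q)) t) = (\<Sum>t\<in>carrier G. \<Sum>x\<in>carrier G. p x * q (inv t \<otimes> inv x \<otimes> t))"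
    by (intro sum.cong refl) (simp add: mult_eval[of _ p] basis_mult_eval m_assoc)
  also have "\<dots> = (\<Sum>x\<in>carrier G. p x * (\<Sum>t\<in>carrier G. q (inv t \<otimes> inv x \<otimes> t)))"
    by (subst sum.swap) (simp add: sum_distrib_left)
  also have "\<dots> = (\<Sum>x\<in>carrier G. p x * (of_nat (card (centr G (inv x))) * class_sum G q (inv x)))"
  proof (intro sum.cong refl arg_cong2[where f="(*)"])
    fix x assume x: "x \<in> carrier G"
    have "(\<Sum>t\<in>carrier G. q (inv t \<otimes> inv x \<otimes> t)) = (\<Sum>t\<in>carrier G. q (t \<otimes> inv x \<otimes> inv t))"
      using sum_inv[of "\<lambda>t. q (t \<otimes> inv x \<otimes> inv t)"] by simp
    also have "\<dots> = of_nat (card (centr G (inv x))) * class_sum G q (inv x)"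
      using sum_conjugates[of "inv x" q] x by (simp add: class_sum_def)
    finally show "(\<Sum>t\<in>carrier G. q (inv t \<otimes> inv x \<otimes> t)) = of_nat (card (centr G (inv x))) * class_sum G q (inv x)" .
  qed
  finally show ?thesis .
qed

text \<open>The elements \<open>x \<otimes> y\<close> and \<open>y \<otimes> x\<close> are
  conjugate.\<close>

lemma class_sum_commute:
  assumes h: "h \<in> carrier G"
  shows "class_sum G (a \<star> b) h = class_sum G (b \<star> a) h"
proof -
  have swap: "x \<otimes> y \<in> conj_class G h \<longleftrightarrow> y \<otimes> x \<in> conj_class G h" if "x \<in> carrier G" "y \<in> carrier G" for x y
  proof -
    have "y \<otimes> (x \<otimes> y) \<otimes> inv y = y \<otimes> x" "x \<otimes> (y \<otimes> x) \<otimes> inv x = x \<otimes> y" using that by (simp_all add: m_assoc)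
    then have "y \<otimes> x \<in> conj_class G (x \<otimes> y)" "x \<otimes> y \<in> conj_class G (y \<otimes> x)"
      using conj_classI[of y "x \<otimes> y"] conj_classI[of x "y \<otimes> x"] that by simp_all
    then show ?thesis using conj_class_trans[OF h] by blast
  qed
  have "class_sum G (a \<star> b) h = (\<Sum>x\<in>carrier G. \<Sum>y\<in>carrier G. a x * b y * of_bool (x \<otimes> y \<in> conj_class G h))"
    using h by (simp add: class_sum_eval sum_mult_eval)
  also have "\<dots> = (\<Sum>y\<in>carrier G. \<Sum>x\<in>carrier G. a x * b y * of_bool (x \<otimes> y \<in> conj_class G h))" by (rule sum.swap)
  also have "\<dots> = (\<Sum>y\<in>carrier G. \<Sum>x\<in>carrier G. b y * a x * of_bool (y \<otimes> x \<in> conj_class G h))"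
    using swap by (intro sum.cong refl) (simp add: mult.commute)
  also have "\<dots> = class_sum G (b \<star> a) h" using h by (simp add: class_sum_eval sum_mult_eval)
  finally show ?thesis .
qed

lemma class_sum_linear:
  "class_sum G (a + b) h = class_sum G a h + class_sum G b h"
  "class_sum G (a - b) h = class_sum G a h - class_sum G b h"
  by (simp_all add: class_sum_def sum.distrib sum_subtractf)

text \<open>Right multiplication by \<open>e\<close> is an idempotent matrix in the basis of group
  elements, with all diagonal entries equal to \<open>e \<one>\<close>; the number \<open>r\<close>
  is its rank.\<close>

lemma idempotent_rank:
  fixes e :: "'a \<Rightarrow> 'k::field_char_0"
  assumes "grp_supp G e" "e \<star> e = e"
  obtains r :: nat where "of_nat (card (carrier G)) * e \<one> = of_nat r" "r = 0 \<Longrightarrow> e = 0"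
proof -
  have "(\<Sum>z\<in>carrier G. e (inv z \<otimes> x) * e (inv y \<otimes> z)) = e (inv y \<otimes> x)"
    if xy: "x \<in> carrier G" "y \<in> carrier G" for x y
  proof -
    have "e (inv y \<otimes> x) = (\<Sum>w\<in>carrier G. e w * e (inv w \<otimes> (inv y \<otimes> x)))"
      using mult_eval[of "inv y \<otimes> x" e e] assms(2) xy by simp
    also have "\<dots> = (\<Sum>z\<in>carrier G. e (inv y \<otimes> z) * e (inv (inv y \<otimes> z) \<otimes> (inv y \<otimes> x)))"
      using sum_translate_left[of "inv y" "\<lambda>w. e w * e (inv w \<otimes> (inv y \<otimes> x))"] xy by simp
    also have "\<dots> = (\<Sum>z\<in>carrier G. e (inv z \<otimes> x) * e (inv y \<otimes> z))"
      using xy by (intro sum.cong refl) (simp add: inv_mult_group m_assoc)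
    finally show ?thesis by simp
  qed
  then obtain r where r: "(\<Sum>x\<in>carrier G. e (inv x \<otimes> x)) = of_nat r"
    "r = 0 \<Longrightarrow> \<forall>x\<in>carrier G. \<forall>y\<in>carrier G. e (inv y \<otimes> x) = 0"
    using idempotent_trace[OF fin, of "\<lambda>x y. e (inv y \<otimes> x)"] by blast
  show thesis
  proof (rule that)
    show "of_nat (card (carrier G)) * e \<one> = of_nat r" using r(1) by simp
    assume "r = 0"
    then have "e (inv \<one> \<otimes> x) = 0" if "x \<in> carrier G" for x using r(2) that by blast
    then show "e = 0" using assms(1) by (intro supp_ext) auto
  qed
qed

text \<open>When the \<open>n\<close>-th powers of \<open>u\<close> and \<open>w\<close> are 1, this
  is \<open>n\<close> times the average of \<open>x\<close> under the cyclic group generated by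
  \<open>x\<close> \<mapsto> \<open>u \<star> x \<star> inverse w\<close>. The exponent
  \<open>(n - 1) * j\<close> stands for \<open>- j\<close>.\<close>

definition orbit_sum :: "nat \<Rightarrow> ('a \<Rightarrow> 'r::comm_ring_1) \<Rightarrow> ('a \<Rightarrow> 'r) \<Rightarrow> ('a \<Rightarrow> 'r) \<Rightarrow> 'a \<Rightarrow> 'r" where
  "orbit_sum n u w x = (\<Sum>j<n. grp_pow G u j \<star> (x \<star> grp_pow G w ((n - 1) * j)))"

lemma supp_orbit_sum [simp]: "grp_supp G (orbit_sum n u w x)"
  unfolding orbit_sum_def by (intro supp_sum) simp

lemma pow_periodic: "grp_pow G u n = gone \<Longrightarrow> grp_pow G u (j + n) = grp_pow G u j"
  by (simp add: pow_add)

lemma pow_inverse: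
  assumes "grp_pow G w n = gone" "n > 0"
  shows "grp_pow G w ((n - 1) * j + j) = gone"
proof -
  have "(n - 1) * j + j = n * j" using assms(2) by (simp add: algebra_simps)
  then show ?thesis by (simp add: pow_mult assms(1) basis_one_pow)
qed

lemma orbit_sum_intertwines:
  assumes n: "n > 0" and u: "grp_supp G u" "grp_pow G u n = gone" and w: "grp_supp G w" "grp_pow G w n = gone"
  shows "u \<star> orbit_sum n u w x = orbit_sum n u w x \<star> w"
proof -
  define F where "F = (\<lambda>j. grp_pow G u j \<star> (x \<star> grp_pow G w ((n - 1) * j)) \<star> w)"
  have wn: "grp_pow G w ((n - 1) * (j + n)) = grp_pow G w ((n - 1) * j)" for j
  proof -
    have "(n - 1) * (j + n) = (n - 1) * j + n * (n - 1)" by (simp only: distrib_left mult.commute)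
    then show ?thesis by (simp add: pow_add pow_mult[of w n] w basis_one_pow)
  qed
  have per: "F (j + n) = F j" for j by (simp only: F_def pow_periodic[OF u(2)] wn)
  have "orbit_sum n u w x \<star> w = (\<Sum>j<n. F j)" by (simp add: orbit_sum_def F_def mult_sum_left)
  also have "\<dots> = (\<Sum>j<n. F (j + 1))" using sum_lessThan_shift_periodic[of F n 1] per by simp
  also have "\<dots> = (\<Sum>j<n. u \<star> (grp_pow G u j \<star> (x \<star> grp_pow G w ((n - 1) * j))))"
  proof (intro sum.cong refl)
    fix j
    \<comment> \<open>Modulo \<open>n\<close> the exponents read \<open>- (j + 1)\<close> and
      \<open>- j\<close>.\<close>
    have "grp_pow G w ((n - 1) * (j + 1)) \<star> w = grp_pow G w ((n - 1) * j + n)"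
    proof -
      have "(n - 1) * j + n = Suc ((n - 1) * (j + 1))" using n by (cases n) (simp_all add: algebra_simps)
      then show ?thesis by (simp only: grp_pow.simps)
    qed
    also have "\<dots> = grp_pow G w ((n - 1) * j)" using pow_periodic w by blast
    finally have *: "grp_pow G w ((n - 1) * (j + 1)) \<star> w = grp_pow G w ((n - 1) * j)" .
    have "F (j + 1) = grp_pow G u (Suc j) \<star> (x \<star> (grp_pow G w ((n - 1) * (j + 1)) \<star> w))"
      by (simp only: F_def mult_assoc Suc_eq_plus1)
    also have "\<dots> = u \<star> (grp_pow G u j \<star> (x \<star> grp_pow G w ((n - 1) * j)))"
      unfolding * pow_Suc_left[OF u(1)] by (simp add: mult_assoc)
    finally show "F (j + 1) = u \<star> (grp_pow G u j \<star> (x \<star> grp_pow G w ((n - 1) * j)))" .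
  qed
  also have "\<dots> = u \<star> orbit_sum n u w x" by (simp add: orbit_sum_def mult_sum_right)
  finally show ?thesis by simp
qed

lemma pow_intertwines:
  assumes "grp_supp G x" "u \<star> x = x \<star> w"
  shows "grp_pow G u j \<star> x = x \<star> grp_pow G w j"
proof (induction j)
  case (Suc j)
  have "grp_pow G u (Suc j) \<star> x = (grp_pow G u j \<star> x) \<star> w" using assms by (simp add: mult_assoc)
  then show ?case using Suc by (simp add: mult_assoc)
qed (use assms in simp)

lemma orbit_sum_fixed:
  assumes n: "n > 0" and w: "grp_pow G w n = gone" and x: "grp_supp G x" "u \<star> x = x \<star> w"
  shows "orbit_sum n u w x = (\<lambda>h. of_nat n * x h)"
proof -
  have "grp_pow G u j \<star> (x \<star> grp_pow G w ((n - 1) * j)) = x" for j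
  proof -
    have "grp_pow G u j \<star> (x \<star> grp_pow G w ((n - 1) * j)) = x \<star> (grp_pow G w j \<star> grp_pow G w ((n - 1) * j))"
      using pow_intertwines[OF x, of j] by (simp add: mult_assoc[symmetric])
    also have "grp_pow G w j \<star> grp_pow G w ((n - 1) * j) = gone"
      using pow_inverse[OF w n, of j] by (simp add: pow_add[symmetric] add.commute)
    finally show ?thesis using x by simp
  qed
  then show ?thesis by (simp add: orbit_sum_def fun_eq_iff sum_fun_eval)
qed

text \<open>If there were none, averaging would give 0 on all elements cut down by \<open>e\<close>
  on the left and \<open>f\<close> on the right. By the equality of class sums the trace of this
  zero map is that of the analogous map with \<open>u\<close>, \<open>e\<close> on both sides. The
  latter is a multiple of an idempotent map which fixes \<open>e\<close>, so its trace cannot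
  vanish.\<close>

lemma exists_intertwiner:
  fixes u w e f :: "'a \<Rightarrow> 'k::field_char_0"
  assumes n: "n > 0" and u: "grp_supp G u" "grp_pow G u n = gone" and w: "grp_supp G w" "grp_pow G w n = gone"
    and e: "grp_supp G e" "e \<star> e = e" "u \<star> e = e \<star> u" "e \<noteq> 0"
    and f: "grp_supp G f" "f \<star> f = f" "w \<star> f = f \<star> w"
    and cs: "\<And>j h. h \<in> carrier G \<Longrightarrow> class_sum G (grp_pow G w j \<star> f) h = class_sum G (grp_pow G u j \<star> e) h"
  obtains c where "grp_supp G c" "c \<noteq> 0" "u \<star> c = c \<star> w" "e \<star> c = c" "c \<star> f = c"
proof (rule ccontr)
  assume contra: "\<not> thesis"
  have zero: "e \<star> orbit_sum n u w y \<star> f = 0" for y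
  proof (rule ccontr)
    assume nz: "e \<star> orbit_sum n u w y \<star> f \<noteq> 0"
    have "u \<star> (e \<star> orbit_sum n u w y \<star> f) = e \<star> (u \<star> orbit_sum n u w y) \<star> f"
      by (simp only: mult_assoc[symmetric] e(3))
    also have "\<dots> = e \<star> orbit_sum n u w y \<star> f \<star> w"
      by (simp only: orbit_sum_intertwines[OF n u w] mult_assoc f(3))
    finally have "u \<star> (e \<star> orbit_sum n u w y \<star> f) = e \<star> orbit_sum n u w y \<star> f \<star> w" .
    moreover have "e \<star> (e \<star> orbit_sum n u w y \<star> f) = e \<star> orbit_sum n u w y \<star> f"
      by (simp only: mult_assoc[symmetric] e(2))
    moreover have "e \<star> orbit_sum n u w y \<star> f \<star> f = e \<star> orbit_sum n u w y \<star> f"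
      by (simp only: mult_assoc f(2))
    ultimately show False using contra that[OF _ nz] by simp
  qed
  have expand: "(e \<star> orbit_sum n u v y \<star> g) s = (\<Sum>j<n. ((e \<star> grp_pow G u j) \<star> (y \<star> (grp_pow G v ((n - 1) * j) \<star> g))) s)"
    for v y g s
    by (simp add: orbit_sum_def mult_sum_left mult_sum_right sum_fun_eval mult_assoc)
  \<comment> \<open>\<open>T\<close> is the projection of the group algebra onto the elements that
    commute with \<open>u\<close> and are fixed by \<open>e\<close> on both sides.\<close>
  define T where "T = (\<lambda>y h. (e \<star> orbit_sum n u u y \<star> e) h / of_nat n)"
  have T_scale: "T y = (\<lambda>h. inverse (of_nat n) * (e \<star> orbit_sum n u u y \<star> e) h)" for y
    by (simp add: T_def fun_eq_iff field_simps)
  have T_supp: "grp_supp G (T y)" for y unfolding T_scale by simp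
  have T_comm: "u \<star> T y = T y \<star> u" for y
  proof -
    have "u \<star> (e \<star> orbit_sum n u u y \<star> e) = e \<star> (u \<star> orbit_sum n u u y) \<star> e"
      by (simp only: mult_assoc[symmetric] e(3))
    also have "\<dots> = e \<star> orbit_sum n u u y \<star> e \<star> u"
      by (simp only: orbit_sum_intertwines[OF n u u] mult_assoc e(3))
    finally show ?thesis by (simp add: T_scale mult_scale)
  qed
  have T_fix: "T y = y" if y: "grp_supp G y" "u \<star> y = y \<star> u" "e \<star> y = y" "y \<star> e = y" for y
  proof -
    have "e \<star> orbit_sum n u u y \<star> e = (\<lambda>h. of_nat n * y h)"
      by (simp add: orbit_sum_fixed[OF n u(2) y(1,2)] mult_scale y(3,4))
    then show ?thesis using n by (simp add: T_def)
  qed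
  have T_e: "e \<star> T y = T y" "T y \<star> e = T y" for y
  proof -
    have "e \<star> (e \<star> orbit_sum n u u y \<star> e) = e \<star> orbit_sum n u u y \<star> e"
      by (simp only: mult_assoc[symmetric] e(2))
    moreover have "e \<star> orbit_sum n u u y \<star> e \<star> e = e \<star> orbit_sum n u u y \<star> e"
      by (simp only: mult_assoc e(2))
    ultimately show "e \<star> T y = T y" "T y \<star> e = T y" by (simp_all add: T_scale mult_scale)
  qed
  have T_lin: "T y s = (\<Sum>t\<in>carrier G. y t * T (grp_basis t) s)" if "s \<in> carrier G" for y s
  proof -
    have "(e \<star> orbit_sum n u u y \<star> e) s = (\<Sum>j<n. \<Sum>t\<in>carrier G. y t * ((e \<star> grp_pow G u j) \<star> (grp_basis t \<star> (grp_pow G u ((n - 1) * j) \<star> e))) s)"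
      unfolding expand using that by (intro sum.cong refl two_sided_eval)
    also have "\<dots> = (\<Sum>t\<in>carrier G. y t * (e \<star> orbit_sum n u u (grp_basis t) \<star> e) s)"
      unfolding expand by (subst sum.swap) (simp add: sum_distrib_left)
    finally show ?thesis by (simp add: T_def sum_divide_distrib)
  qed
  obtain r where r: "(\<Sum>x\<in>carrier G. T (grp_basis x) x) = of_nat r"
    "r = 0 \<Longrightarrow> \<forall>x\<in>carrier G. \<forall>y\<in>carrier G. T (grp_basis y) x = 0"
  proof (rule idempotent_trace[OF fin, of "\<lambda>x y. T (grp_basis y) x"])
    fix x y assume x: "x \<in> carrier G" and y: "y \<in> carrier G"
    have "T (T (grp_basis y)) x = (\<Sum>z\<in>carrier G. T (grp_basis y) z * T (grp_basis z) x)" using T_lin[OF x] .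
    moreover have "T (T (grp_basis y)) = T (grp_basis y)" using T_fix T_supp T_comm T_e by blast
    ultimately show "(\<Sum>z\<in>carrier G. T (grp_basis z) x * T (grp_basis y) z) = T (grp_basis y) x"
      by (simp add: mult.commute)
  qed blast
  have tr: "(\<Sum>t\<in>carrier G. (e \<star> orbit_sum n u v (grp_basis t) \<star> g) t)
      = (\<Sum>j<n. \<Sum>x\<in>carrier G. (e \<star> grp_pow G u j) x * (of_nat (card (centr G (inv x))) * class_sum G (grp_pow G v ((n - 1) * j) \<star> g) (inv x)))"
    for v g
    unfolding expand by (subst sum.swap) (simp only: two_sided_trace)
  \<comment> \<open>Both traces expand by \<open>two_sided_trace\<close>, and they differ only in
    class sums that agree by \<open>cs\<close>.\<close>
  have "(\<Sum>t\<in>carrier G. (e \<star> orbit_sum n u u (grp_basis t) \<star> e) t) = (\<Sum>t\<in>carrier G. (e \<star> orbit_sum n u w (grp_basis t) \<star> f) t)"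
    unfolding tr by (intro sum.cong refl) (simp add: cs)
  also have "\<dots> = 0" by (simp add: zero)
  finally have "(\<Sum>x\<in>carrier G. T (grp_basis x) x) = 0" by (simp add: T_def sum_divide_distrib[symmetric])
  then have "r = 0" using r(1) by simp
  then have "T e s = 0" if "s \<in> carrier G" for s using T_lin[OF that, of e] r(2) that by simp
  moreover have "T e = e" using T_fix e by blast
  ultimately have "e = 0" using e(1) by (intro supp_ext) auto
  then show False using e(4) by simp
qed

text \<open>Averaging a linear quasi-inverse of right multiplication by \<open>c\<close> over the group.\<close>

lemma von_neumann_regular:
  fixes c :: "'a \<Rightarrow> 'k::field_char_0"
  assumes c: "grp_supp G c"
  obtains x where "grp_supp G x" "c \<star> x \<star> c = c"
proof -
  define sc where "sc = (\<lambda>(k::'k) (a::'a \<Rightarrow> 'k) h. k * a h)"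
  interpret V: vector_space sc by unfold_locales (auto simp: sc_def algebra_simps fun_eq_iff)
  interpret VV: vector_space_pair sc sc by unfold_locales
  have "Vector_Spaces.linear sc sc (\<lambda>x. x \<star> c)"
    by unfold_locales (auto simp: sc_def mult_add_left mult_scale)
  then obtain g where lin: "Vector_Spaces.linear sc sc g" and g: "\<And>x. g (x \<star> c) \<star> c = x \<star> c"
    using VV.linear_exists_right_inverse_on[OF _ V.subspace_UNIV, of "\<lambda>x. x \<star> c"] by auto
  interpret g: Vector_Spaces.linear sc sc g by (rule lin)
  define N where "N = (of_nat (card (carrier G)) :: 'k)"
  have N: "N \<noteq> 0" using one_closed by (auto simp: N_def card_eq_0_iff)
  \<comment> \<open>The maps \<open>y\<close> \<mapsto>
    \<open>grp_basis t \<star> g (grp_basis (inv t) \<star> y)\<close> average to one that commutes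
    with left multiplication. Its value at 1 is \<open>x\<close>, so its value at \<open>c\<close>
    is \<open>c \<star> x\<close>.\<close>
  define x where "x = sc (inverse N) (\<Sum>t\<in>carrier G. grp_basis t \<star> g (grp_basis (inv t)))"
  have expand: "y = (\<Sum>s\<in>carrier G. sc (y s) (grp_basis s))" if "grp_supp G y" for y
  proof (rule supp_ext[OF that])
    show "grp_supp G (\<Sum>s\<in>carrier G. sc (y s) (grp_basis s))"
      unfolding sc_def by (intro supp_sum supp_closed supp_basis)
    fix h assume h: "h \<in> carrier G"
    have "(\<Sum>s\<in>carrier G. sc (y s) (grp_basis s)) h = (\<Sum>s\<in>carrier G. y s * grp_basis h s)"
      unfolding sum_fun_eval sc_def by (intro sum.cong refl) (auto simp: grp_basis_def)
    then show "y h = (\<Sum>s\<in>carrier G. sc (y s) (grp_basis s)) h" using sum_basis(1)[OF h, of y] by simp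
  qed
  have shift: "(\<Sum>t\<in>carrier G. grp_basis s \<star> (grp_basis t \<star> g (grp_basis (inv t))))
      = (\<Sum>t\<in>carrier G. grp_basis t \<star> g (grp_basis (inv t) \<star> grp_basis s))" if s: "s \<in> carrier G" for s
  proof -
    have "(\<Sum>t\<in>carrier G. grp_basis s \<star> (grp_basis t \<star> g (grp_basis (inv t))))
        = (\<Sum>t\<in>carrier G. grp_basis (s \<otimes> t) \<star> g (grp_basis (inv (s \<otimes> t) \<otimes> s)))"
      using s by (intro sum.cong refl) (simp add: mult_assoc[symmetric] basis_mult inv_mult_group m_assoc)
    also have "\<dots> = (\<Sum>t\<in>carrier G. grp_basis t \<star> g (grp_basis (inv t \<otimes> s)))"
      using sum_translate_left[OF s, of "\<lambda>t. grp_basis t \<star> g (grp_basis (inv t \<otimes> s))"] .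
    finally show ?thesis using s by (simp add: basis_mult)
  qed
  have sc_l: "sc k a \<star> b = sc k (a \<star> b)" and sc_r: "a \<star> sc k b = sc k (a \<star> b)" for k a b
    by (simp_all add: sc_def mult_scale)
  have "c \<star> (\<Sum>t\<in>carrier G. grp_basis t \<star> g (grp_basis (inv t)))
      = (\<Sum>s\<in>carrier G. sc (c s) (\<Sum>t\<in>carrier G. grp_basis s \<star> (grp_basis t \<star> g (grp_basis (inv t)))))"
    by (subst expand[OF c]) (simp only: mult_sum_left sc_l, simp only: mult_sum_right)
  also have "\<dots> = (\<Sum>s\<in>carrier G. \<Sum>t\<in>carrier G. grp_basis t \<star> g (grp_basis (inv t) \<star> sc (c s) (grp_basis s)))"
    by (intro sum.cong refl) (simp add: shift V.scale_sum_right sc_r g.scale)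
  also have "\<dots> = (\<Sum>t\<in>carrier G. grp_basis t \<star> g (grp_basis (inv t) \<star> (\<Sum>s\<in>carrier G. sc (c s) (grp_basis s))))"
    by (subst sum.swap) (simp only: mult_sum_right g.sum)
  also have "\<dots> = (\<Sum>t\<in>carrier G. grp_basis t \<star> g (grp_basis (inv t) \<star> c))" by (simp only: expand[OF c, symmetric])
  finally have cx: "c \<star> x = sc (inverse N) (\<Sum>t\<in>carrier G. grp_basis t \<star> g (grp_basis (inv t) \<star> c))"
    by (simp add: x_def sc_r)
  have "c \<star> x \<star> c = sc (inverse N) (\<Sum>t\<in>carrier G. grp_basis t \<star> (g (grp_basis (inv t) \<star> c) \<star> c))"
    unfolding cx by (simp only: sc_l mult_sum_left mult_assoc)
  also have "\<dots> = sc (inverse N) (\<Sum>t\<in>carrier G. c)"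
    by (simp only: g) (simp add: mult_assoc[symmetric] basis_mult c)
  also have "\<dots> = c" using N by (simp add: sc_def fun_eq_iff sum_fun_eval N_def)
  finally have "c \<star> x \<star> c = c" .
  moreover have "grp_supp G x" unfolding x_def sc_def by (intro supp_closed supp_sum supp_mult)
  ultimately show thesis using that by blast
qed

text \<open>The induction runs over the rank of the complement of the partial isomorphism
  \<open>a\<close> with quasi-inverse \<open>b\<close>.\<close>

lemma extend_partial_conjugation:
  fixes u w :: "'a \<Rightarrow> 'k::field_char_0"
  assumes n: "n > 0" and u: "grp_supp G u" "grp_pow G u n = gone" and w: "grp_supp G w" "grp_pow G w n = gone"
    and cs: "\<And>j h. h \<in> carrier G \<Longrightarrow> class_sum G (grp_pow G w j) h = class_sum G (grp_pow G u j) h"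
  shows "of_nat (card (carrier G)) * (gone - a \<star> b) \<one> = (of_nat r :: 'k) \<Longrightarrow> grp_supp G a \<Longrightarrow> grp_supp G b \<Longrightarrow>
    u \<star> a = a \<star> w \<Longrightarrow> w \<star> b = b \<star> u \<Longrightarrow> a \<star> b \<star> a = a \<Longrightarrow> b \<star> a \<star> b = b \<Longrightarrow>
    \<exists>x y. grp_supp G x \<and> grp_supp G y \<and> x \<star> y = gone \<and> y \<star> x = gone \<and> u \<star> x = x \<star> w"
proof (induction r arbitrary: a b rule: less_induct)
  case (less r)
  note ab = less.prems
  define e where "e = gone - a \<star> b"
  define f where "f = gone - b \<star> a"
  have supp: "grp_supp G e" "grp_supp G f" by (simp_all add: e_def f_def)
  have ee: "e \<star> e = e" using ab by (simp add: e_def mult_diff_left mult_diff_right mult_assoc[symmetric])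
  have ff: "f \<star> f = f" using ab by (simp add: f_def mult_diff_left mult_diff_right mult_assoc[symmetric])
  have ue: "u \<star> e = e \<star> u"
  proof -
    have "u \<star> (a \<star> b) = a \<star> (w \<star> b)" by (simp only: mult_assoc[symmetric] ab(4))
    then show ?thesis using ab u by (simp add: e_def mult_diff_left mult_diff_right mult_assoc)
  qed
  have wf: "w \<star> f = f \<star> w"
  proof -
    have "w \<star> (b \<star> a) = b \<star> (u \<star> a)" by (simp only: mult_assoc[symmetric] ab(5))
    then show ?thesis using ab w by (simp add: f_def mult_diff_left mult_diff_right mult_assoc)
  qed
  have be: "b \<star> e = 0" and ea: "e \<star> a = 0" and af: "a \<star> f = 0" and fb: "f \<star> b = 0"
    using ab by (simp_all add: e_def f_def mult_diff_left mult_diff_right mult_assoc[symmetric])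
  \<comment> \<open>The products removed from the powers of \<open>w\<close> and \<open>u\<close>,
    \<open>grp_pow G w j \<star> (b \<star> a)\<close> and
    \<open>grp_pow G u j \<star> (a \<star> b)\<close>, are cyclic rearrangements of each other
    because \<open>a\<close> intertwines, so the complements inherit equal class sums.\<close>
  have cs': "class_sum G (grp_pow G w j \<star> f) h = class_sum G (grp_pow G u j \<star> e) h" if h: "h \<in> carrier G" for j h
  proof -
    have "class_sum G (grp_pow G w j \<star> (b \<star> a)) h = class_sum G (a \<star> (grp_pow G w j \<star> b)) h"
      using class_sum_commute[OF h, of "grp_pow G w j \<star> b" a] by (simp add: mult_assoc)
    also have "a \<star> (grp_pow G w j \<star> b) = grp_pow G u j \<star> (a \<star> b)"
      using pow_intertwines[OF ab(2) ab(4), of j] by (simp add: mult_assoc[symmetric])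
    finally show ?thesis using cs[OF h, of j] by (simp add: e_def f_def mult_diff_right class_sum_linear)
  qed
  show ?case
  proof (cases "e = 0")
    case True
    then have ab1: "a \<star> b = gone" by (simp add: e_def)
    have "conj_class G \<one> = {\<one>}" by (rule conj_class_central) auto
    \<comment> \<open>The coefficient at 1 is a trace. It shows that the idempotent \<open>f\<close>
      has rank 0, so a one-sided inverse is two-sided.\<close>
    then have "(a \<star> b) \<one> = (b \<star> a) \<one>" using class_sum_commute[OF one_closed, of a b] by (simp add: class_sum_def)
    then have "f \<one> = 0" using ab1 by (simp add: f_def)
    then have "f = 0" using idempotent_rank[OF supp(2) ff] by (metis mult_zero_right of_nat_0_eq_iff)
    then have "b \<star> a = gone" by (simp add: f_def)
    then show ?thesis using ab ab1 by blast
  next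
    case False
    obtain c where c: "grp_supp G c" "c \<noteq> 0" "u \<star> c = c \<star> w" "e \<star> c = c" "c \<star> f = c"
      using exists_intertwiner[OF n u w supp(1) ee ue False supp(2) ff wf cs'] by blast
    obtain x where x: "grp_supp G x" "c \<star> x \<star> c = c" using von_neumann_regular[OF c(1)] by blast
    \<comment> \<open>Averaging makes the quasi-inverse of \<open>c\<close> intertwine in the
      opposite direction.\<close>
    define x1 where "x1 = (\<lambda>h. inverse (of_nat n) * orbit_sum n w u x h)"
    have x1: "grp_supp G x1" "w \<star> x1 = x1 \<star> u"
      by (simp_all add: x1_def mult_scale orbit_sum_intertwines[OF n w u])
    have cx1: "c \<star> x1 \<star> c = c"
    proof -
      have "c \<star> orbit_sum n w u x \<star> c = (\<Sum>j<n. (c \<star> grp_pow G w j) \<star> x \<star> (grp_pow G u ((n - 1) * j) \<star> c))"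
        by (simp add: orbit_sum_def mult_sum_left mult_sum_right mult_assoc)
      also have "\<dots> = (\<Sum>j<n. c)"
      proof (intro sum.cong refl)
        fix j
        have "(c \<star> grp_pow G w j) \<star> x \<star> (grp_pow G u ((n - 1) * j) \<star> c)
            = (grp_pow G u j \<star> c) \<star> x \<star> (c \<star> grp_pow G w ((n - 1) * j))"
          using pow_intertwines[OF c(1,3)] by simp
        also have "\<dots> = grp_pow G u j \<star> (c \<star> x \<star> c) \<star> grp_pow G w ((n - 1) * j)" by (simp only: mult_assoc)
        also have "\<dots> = c \<star> (grp_pow G w j \<star> grp_pow G w ((n - 1) * j))"
          unfolding x(2) pow_intertwines[OF c(1,3)] by (simp only: mult_assoc)
        also have "grp_pow G w j \<star> grp_pow G w ((n - 1) * j) = gone"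
          using pow_inverse[OF w(2) n, of j] by (simp add: pow_add[symmetric] add.commute)
        finally show "(c \<star> grp_pow G w j) \<star> x \<star> (grp_pow G u ((n - 1) * j) \<star> c) = c" using c by simp
      qed
      finally have "c \<star> orbit_sum n w u x \<star> c = (\<lambda>h. of_nat n * c h)" by (simp add: fun_eq_iff sum_fun_eval)
      then show ?thesis using n by (simp add: x1_def mult_scale fun_eq_iff)
    qed
    \<comment> \<open>Cutting down by the complementary idempotents makes the mixed products with
      \<open>a\<close> and \<open>b\<close> vanish, so that \<open>a + c\<close> and
      \<open>b + d\<close> multiply summand by summand.\<close>
    define d0 where "d0 = f \<star> x1 \<star> e"
    have d0: "c \<star> d0 \<star> c = c"
    proof -
      have "c \<star> d0 \<star> c = (c \<star> f) \<star> x1 \<star> (e \<star> c)" by (simp only: d0_def mult_assoc)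
      then show ?thesis using c cx1 by simp
    qed
    have wd0: "w \<star> d0 = d0 \<star> u"
    proof -
      have "w \<star> d0 = f \<star> (w \<star> x1) \<star> e" by (simp only: d0_def mult_assoc[symmetric] wf)
      also have "\<dots> = d0 \<star> u" by (simp only: d0_def x1(2) mult_assoc ue)
      finally show ?thesis .
    qed
    \<comment> \<open>The usual passage from \<open>c \<star> d0 \<star> c = c\<close> to a
      quasi-inverse that also satisfies \<open>d \<star> c \<star> d = d\<close>.\<close>
    define d where "d = d0 \<star> c \<star> d0"
    have d: "grp_supp G d" "c \<star> d \<star> c = c" "d \<star> c \<star> d = d"
    proof -
      have "c \<star> d \<star> c = (c \<star> d0 \<star> c) \<star> d0 \<star> c" by (simp only: d_def mult_assoc)
      then show "c \<star> d \<star> c = c" using d0 by simp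
      have "d \<star> c \<star> d = d0 \<star> ((c \<star> d0 \<star> c) \<star> d0 \<star> c) \<star> d0" by (simp only: d_def mult_assoc)
      then show "d \<star> c \<star> d = d" using d0 by (simp add: d_def)
    qed (simp add: d_def)
    have wd: "w \<star> d = d \<star> u"
    proof -
      have "w \<star> d = (w \<star> d0) \<star> c \<star> d0" by (simp only: d_def mult_assoc)
      also have "\<dots> = d0 \<star> (u \<star> c) \<star> d0" by (simp only: wd0 mult_assoc)
      also have "\<dots> = d0 \<star> c \<star> (w \<star> d0)" by (simp only: c(3) mult_assoc)
      finally show ?thesis by (simp only: wd0 d_def mult_assoc)
    qed
    have fd: "f \<star> d = d"
    proof -
      have "f \<star> d = (f \<star> f) \<star> x1 \<star> e \<star> c \<star> d0" by (simp only: d_def d0_def mult_assoc)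
      then show ?thesis by (simp only: ff d_def d0_def mult_assoc)
    qed
    have de: "d \<star> e = d"
    proof -
      have "d \<star> e = d0 \<star> c \<star> f \<star> x1 \<star> (e \<star> e)" by (simp only: d_def d0_def mult_assoc)
      then show ?thesis by (simp only: ee d_def d0_def mult_assoc)
    qed
    have ad: "a \<star> d = 0"
    proof -
      have "a \<star> d = a \<star> (f \<star> d)" by (simp only: fd)
      then show ?thesis by (simp add: mult_assoc[symmetric] af)
    qed
    have da: "d \<star> a = 0"
    proof -
      have "d \<star> a = d \<star> e \<star> a" by (simp only: de)
      then show ?thesis by (simp add: mult_assoc ea)
    qed
    have bc: "b \<star> c = 0"
    proof -
      have "b \<star> c = b \<star> (e \<star> c)" by (simp only: c)
      then show ?thesis by (simp add: mult_assoc[symmetric] be)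
    qed
    have cb: "c \<star> b = 0"
    proof -
      have "c \<star> b = c \<star> f \<star> b" by (simp only: c)
      then show ?thesis by (simp add: mult_assoc fb)
    qed
    have prod: "(a + c) \<star> (b + d) = a \<star> b + c \<star> d" "(b + d) \<star> (a + c) = b \<star> a + d \<star> c"
      by (simp_all add: mult_add_left mult_add_right ad da bc cb)
    have cd: "(c \<star> d) \<star> (c \<star> d) = c \<star> d" using d by (simp add: mult_assoc[symmetric])
    have cdnz: "c \<star> d \<noteq> 0" using d(2) c(2) by (metis mult_zero(1))
    obtain k where k: "of_nat (card (carrier G)) * (c \<star> d) \<one> = (of_nat k :: 'k)" "k = 0 \<Longrightarrow> c \<star> d = 0"
      using idempotent_rank[OF supp_mult cd] by blast
    have e': "(gone - (a + c) \<star> (b + d)) \<star> (gone - (a + c) \<star> (b + d)) = gone - (a + c) \<star> (b + d)"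
      "grp_supp G (gone - (a + c) \<star> (b + d))"
    proof -
      have "(a \<star> b) \<star> (c \<star> d) = 0" "(c \<star> d) \<star> (a \<star> b) = 0"
        using bc da by (simp_all add: mult_assoc) (simp_all add: mult_assoc[symmetric])
      moreover have "(a \<star> b) \<star> (a \<star> b) = a \<star> b" using ab by (simp add: mult_assoc[symmetric])
      ultimately show "(gone - (a + c) \<star> (b + d)) \<star> (gone - (a + c) \<star> (b + d)) = gone - (a + c) \<star> (b + d)"
        unfolding prod by (simp add: mult_diff_left mult_diff_right mult_add_left mult_add_right cd)
    qed simp
    obtain r' where r': "of_nat (card (carrier G)) * (gone - (a + c) \<star> (b + d)) \<one> = (of_nat r' :: 'k)"
      using idempotent_rank[OF e'(2,1)] by blast
    \<comment> \<open>The rank of the complement drops by the rank \<open>k\<close> of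
      \<open>c \<star> d\<close>, which is positive as \<open>c\<close> is nonzero.\<close>
    have "of_nat r = (of_nat (r' + k) :: 'k)"
      using ab(1) r' k(1) by (simp add: prod algebra_simps)
    then have "r = r' + k" by (simp only: of_nat_eq_iff)
    then have "r' < r" using k(2) cdnz by auto
    then show ?thesis
    proof (rule less.IH[OF _ r'])
      show "u \<star> (a + c) = (a + c) \<star> w" "w \<star> (b + d) = (b + d) \<star> u"
        using ab c wd by (simp_all add: mult_add_left mult_add_right)
      show "(a + c) \<star> (b + d) \<star> (a + c) = a + c" "(b + d) \<star> (a + c) \<star> (b + d) = b + d"
        unfolding prod using ab d ad da bc cb by (simp_all add: mult_add_left mult_add_right mult_assoc) 
    qed (rule supp_closed(2)[OF ab(2) c(1)], rule supp_closed(2)[OF ab(3) d(1)])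
  qed
qed

text \<open>The induction starts from the zero elements, whose complement is the whole
  algebra.\<close>

theorem class_sums_imp_conjugate:
  fixes u w :: "'a \<Rightarrow> 'k::field_char_0"
  assumes n: "n > 0" and u: "grp_supp G u" "grp_pow G u n = gone" and w: "grp_supp G w" "grp_pow G w n = gone"
    and cs: "\<And>j h. h \<in> carrier G \<Longrightarrow> class_sum G (grp_pow G w j) h = class_sum G (grp_pow G u j) h"
  shows "\<exists>x y. grp_supp G x \<and> grp_supp G y \<and> x \<star> y = gone \<and> y \<star> x = gone \<and> u \<star> x = x \<star> w"
proof -
  have "of_nat (card (carrier G)) * (gone - 0 \<star> 0) \<one> = (of_nat (card (carrier G)) :: 'k)"
    by (simp add: grp_basis_def)
  from extend_partial_conjugation[OF n u w cs this] show ?thesis by simp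
qed

end

section \<open>Real matrices of size three\<close>

definition mat_group :: "('r::semiring_1^3^3) set \<Rightarrow> ('r^3^3) monoid" where
  "mat_group R = \<lparr>carrier = R, mult = (**), one = mat 1\<rparr>"

lemma mat_group_simps [simp]:
  "carrier (mat_group R) = R" "x \<otimes>\<^bsub>mat_group R\<^esub> y = x ** y" "\<one>\<^bsub>mat_group R\<^esub> = mat 1"
  by (simp_all add: mat_group_def)

lemma fin_group_mat_group:
  assumes "finite R" "mat 1 \<in> R" "\<And>A B. A \<in> R \<Longrightarrow> B \<in> R \<Longrightarrow> A ** B \<in> R"
    "\<And>A. A \<in> R \<Longrightarrow> \<exists>B\<in>R. B ** A = mat 1"
  shows "fin_group (mat_group R)"
proof -
  have "group (mat_group R)"
    using assms by (intro groupI) (auto simp: matrix_mul_assoc)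
  then show ?thesis using assms(1) by (simp add: fin_group_def fin_group_axioms_def)
qed

text \<open>Nine explicit entries let the simplifier decide products, traces and determinants by
  polynomial arithmetic.\<close>

definition m9 :: "'r::zero \<Rightarrow> 'r \<Rightarrow> 'r \<Rightarrow> 'r \<Rightarrow> 'r \<Rightarrow> 'r \<Rightarrow> 'r \<Rightarrow> 'r \<Rightarrow> 'r \<Rightarrow> 'r^3^3" where
  "m9 a b c d e f g h i = vector [vector [a, b, c], vector [d, e, f], vector [g, h, i]]"

lemma m9_entries [simp]:
  "m9 a b c d e f g h i $ 1 = vector [a, b, c]" "m9 a b c d e f g h i $ 2 = vector [d, e, f]"
  "m9 a b c d e f g h i $ 3 = vector [g, h, i]"
  by (simp_all add: m9_def vector_3)

lemma m9_collapse: "A = m9 (A$1$1) (A$1$2) (A$1$3) (A$2$1) (A$2$2) (A$2$3) (A$3$1) (A$3$2) (A$3$3)"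
  by (simp add: vec_eq_iff forall_3 vector_3)

lemma m9_eq: "m9 a b c d e f g h i = m9 a' b' c' d' e' f' g' h' i' \<longleftrightarrow>
    a = a' \<and> b = b' \<and> c = c' \<and> d = d' \<and> e = e' \<and> f = f' \<and> g = g' \<and> h = h' \<and> i = i'"
  by (auto simp: vec_eq_iff forall_3 vector_3)

lemma m9_mult: "m9 a b c d e f g h i ** m9 a' b' c' d' e' f' g' h' i' =
    m9 (a*a' + b*d' + c*g') (a*b' + b*e' + c*h') (a*c' + b*f' + c*i')
       (d*a' + e*d' + f*g') (d*b' + e*e' + f*h') (d*c' + e*f' + f*i')
       (g*a' + h*d' + i*g') (g*b' + h*e' + i*h') (g*c' + h*f' + i*(i'::'r::comm_ring_1))"
  by (simp add: vec_eq_iff forall_3 vector_3 matrix_matrix_mult_def sum_3)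

lemma m9_one: "mat 1 = m9 1 0 0 0 1 0 0 0 (1::'r::comm_ring_1)"
  by (simp add: vec_eq_iff forall_3 vector_3 mat_def)

lemma m9_trace: "trace (m9 a b c d e f g h i) = a + e + (i::'r::comm_ring_1)"
  by (simp add: trace_def sum_3 vector_3)

lemma m9_det: "det (m9 a b c d e f g h i)
    = a*e*i + b*f*g + c*d*h - a*f*h - b*d*i - c*e*(g::'r::comm_ring_1)"
  by (simp add: det_3 vector_3)

lemma m9_transpose: "transpose (m9 a b c d e f g h i) = m9 a d g b e h c f i"
  by (simp add: vec_eq_iff forall_3 vector_3 transpose_def)

lemmas m9_simps = m9_eq m9_mult m9_one m9_trace m9_det m9_transpose

lemma rotation_matrixD:
  assumes "rotation_matrix (A::real^'n^'n)"
  shows "transpose A ** A = mat 1" "A ** transpose A = mat 1" "det A = 1"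
  using assms by (auto simp: rotation_matrix_def orthogonal_matrix_def)

lemma rotation_matrix_closed:
  "rotation_matrix (mat 1 :: real^'n^'n)"
  "rotation_matrix A \<Longrightarrow> rotation_matrix B \<Longrightarrow> rotation_matrix (A ** B :: real^'n^'n)"
  "rotation_matrix A \<Longrightarrow> rotation_matrix (transpose A :: real^'n^'n)"
  by (simp_all add: rotation_matrix_def orthogonal_matrix_id orthogonal_matrix_mul det_mul)

lemma orthogonal_matrix_entry_le:
  assumes "orthogonal_matrix (A::real^'n^'n)"
  shows "\<bar>A $ i $ j\<bar> \<le> 1"
proof -
  have "(A ** transpose A) $ i $ i = 1" using assms by (simp add: orthogonal_matrix_def mat_def)
  then have "(\<Sum>k\<in>UNIV. (A $ i $ k)\<^sup>2) = 1"
    by (simp add: matrix_matrix_mult_def transpose_def power2_eq_square)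
  moreover have "(A $ i $ j)\<^sup>2 \<le> (\<Sum>k\<in>UNIV. (A $ i $ k)\<^sup>2)" by (rule member_le_sum) auto
  ultimately show ?thesis by (simp add: abs_square_le_1)
qed

section \<open>Representations\<close>

context fin_group
begin

definition lin_rep :: "('a \<Rightarrow> real^3^3) \<Rightarrow> ('a \<Rightarrow> int) \<Rightarrow> real^3^3" where
  "lin_rep \<rho> u = (\<chi> i k. \<Sum>x\<in>carrier G. of_int (u x) * \<rho> x $ i $ k)"

lemma lin_rep_mult:
  assumes "\<And>x y. x \<in> carrier G \<Longrightarrow> y \<in> carrier G \<Longrightarrow> \<rho> (x \<otimes> y) = \<rho> x ** \<rho> y"
  shows "lin_rep \<rho> (grp_mult G a b) = lin_rep \<rho> a ** lin_rep \<rho> b"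
proof -
  have of_int_mult_eq: "real_of_int (grp_mult G a b x) = grp_mult G (\<lambda>x. of_int (a x)) (\<lambda>x. of_int (b x)) x" for x
    by (simp add: grp_mult_def)
  have "(\<Sum>x\<in>carrier G. of_int (grp_mult G a b x) * \<rho> x $ i $ k)
      = (\<Sum>j\<in>UNIV. (\<Sum>x\<in>carrier G. of_int (a x) * \<rho> x $ i $ j) * (\<Sum>y\<in>carrier G. of_int (b y) * \<rho> y $ j $ k))" for i k
  proof -
    have "(\<Sum>x\<in>carrier G. of_int (grp_mult G a b x) * \<rho> x $ i $ k)
        = (\<Sum>x\<in>carrier G. \<Sum>y\<in>carrier G. of_int (a x) * of_int (b y) * \<rho> (x \<otimes> y) $ i $ k)"
      unfolding of_int_mult_eq by (rule sum_mult_eval)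
    also have "\<dots> = (\<Sum>x\<in>carrier G. \<Sum>y\<in>carrier G. \<Sum>j\<in>UNIV. (of_int (a x) * \<rho> x $ i $ j) * (of_int (b y) * \<rho> y $ j $ k))"
      using assms by (intro sum.cong refl) (simp add: matrix_matrix_mult_def sum_distrib_left mult_ac)
    also have "\<dots> = (\<Sum>x\<in>carrier G. \<Sum>j\<in>UNIV. \<Sum>y\<in>carrier G. (of_int (a x) * \<rho> x $ i $ j) * (of_int (b y) * \<rho> y $ j $ k))"
      by (intro sum.cong refl) (rule sum.swap)
    also have "\<dots> = (\<Sum>j\<in>UNIV. \<Sum>x\<in>carrier G. \<Sum>y\<in>carrier G. (of_int (a x) * \<rho> x $ i $ j) * (of_int (b y) * \<rho> y $ j $ k))"
      by (rule sum.swap)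
    finally show ?thesis by (simp add: sum_product)
  qed
  then show ?thesis by (simp add: lin_rep_def matrix_matrix_mult_def)
qed

lemma lin_rep_one: "\<rho> \<one> = mat 1 \<Longrightarrow> lin_rep \<rho> (grp_basis \<one>) = mat 1"
proof -
  assume "\<rho> \<one> = mat 1"
  moreover have "(\<Sum>x\<in>carrier G. of_int (grp_basis \<one> x) * \<rho> x $ i $ k) = \<rho> \<one> $ i $ k" for i k
    using sum_basis(2)[OF one_closed, of "\<lambda>x. \<rho> x $ i $ k"]
    by (simp add: grp_basis_def of_int_of_bool if_distrib cong: if_cong)
  ultimately show ?thesis by (simp add: lin_rep_def vec_eq_iff)
qed

lemma trace_lin_rep: "trace (lin_rep \<rho> u) = (\<Sum>x\<in>carrier G. of_int (u x) * trace (\<rho> x))"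
  unfolding trace_def lin_rep_def by (simp add: sum_distrib_left) (rule sum.swap)

text \<open>This is the upper trace bound for the negative of the matrix representing
  \<open>u\<close>, which has finite order as well; the signs \<open>(- 1) ^ j\<close> in
  \<open>M\<close> disappear at the even exponent \<open>n * 2\<close>.\<close>

lemma trace_lin_rep_ge:
  assumes mult: "\<And>x y. x \<in> carrier G \<Longrightarrow> y \<in> carrier G \<Longrightarrow> \<rho> (x \<otimes> y) = \<rho> x ** \<rho> y"
    and one: "\<rho> \<one> = mat 1" and u: "tors1 G u"
  shows "trace (lin_rep \<rho> u) \<ge> - 3" "trace (lin_rep \<rho> u) = - 3 \<Longrightarrow> lin_rep \<rho> u = - mat 1"
proof -
  obtain n where n: "n > 0" "grp_pow G u n = grp_basis \<one>" and supp: "grp_supp G u" using u by (auto simp: tors1_def)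
  define M where "M = (\<lambda>j i k. of_real ((- 1) ^ j * lin_rep \<rho> (grp_pow G u j) $ i $ k) :: complex)"
  have lin_mult: "lin_rep \<rho> (grp_mult G a b) = lin_rep \<rho> a ** lin_rep \<rho> b" for a b
    by (rule lin_rep_mult[of \<rho>, OF mult])
  have M_mult: "(\<Sum>z\<in>UNIV. M j x z * M k z y) = M (j + k) x y" for j k x y
    unfolding M_def pow_add lin_mult
    by (simp add: matrix_matrix_mult_def power_add sum_distrib_left mult_ac)
  have M0: "M 0 x y = (if x = y then 1 else 0)" for x y
    using lin_rep_one[of \<rho>, OF one] by (simp add: M_def mat_def)
  have "grp_pow G u (n * 2) = grp_basis \<one>" by (simp only: pow_mult n(2) basis_one_pow)
  then have Mn: "M (n * 2) x y = (if x = y then 1 else 0)" for x y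
    using lin_rep_one[of \<rho>, OF one] by (simp add: M_def mat_def)
  have tr: "Re (\<Sum>x\<in>UNIV. M 1 x x) = - trace (lin_rep \<rho> u)"
    using supp by (simp add: M_def trace_def sum_negf)
  have n2: "n * 2 > 0" using n by simp
  show "trace (lin_rep \<rho> u) \<ge> - 3"
    using finite_order_trace(1)[OF finite_class.finite_UNIV n2 M_mult M0 Mn] unfolding tr by simp
  assume "trace (lin_rep \<rho> u) = - 3"
  then have "Re (\<Sum>x\<in>UNIV. M 1 x x) \<ge> real (card (UNIV :: 3 set))" unfolding tr by simp
  then have "M 1 x y = (if x = y then 1 else 0)" for x y
    by (rule finite_order_trace(2)[OF finite_class.finite_UNIV n2 M_mult M0 Mn]) simp_all
  then have "complex_of_real (- lin_rep \<rho> u $ x $ y) = of_real (if x = y then 1 else 0)" for x y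
    using supp by (simp add: M_def)
  then have "- lin_rep \<rho> u $ x $ y = (if x = y then 1 else 0)" for x y by (simp only: of_real_eq_iff)
  then have "- lin_rep \<rho> u = mat 1" by (simp add: vec_eq_iff mat_def)
  then show "lin_rep \<rho> u = - mat 1" by (metis minus_minus)
qed

end

section \<open>The octahedral rotation group\<close>

text \<open>Orthogonality and integrality leave the signed permutation matrices, here those of
  determinant 1.\<close>

definition oct :: "(real^3^3) set" where
  "oct = {A. rotation_matrix A \<and> (\<forall>i j. A $ i $ j \<in> \<int>)}"

lemma m9_in_oct: "m9 a b c d e f g h i \<in> oct \<longleftrightarrow>
    (m9 a b c d e f g h i ** m9 a d g b e h c f i = mat 1 \<and> det (m9 a b c d e f g h i) = 1 \<and>
     a \<in> \<int> \<and> b \<in> \<int> \<and> c \<in> \<int> \<and> d \<in> \<int> \<and> e \<in> \<int> \<and> f \<in> \<int> \<and> g \<in> \<int> \<and> h \<in> \<int> \<and> i \<in> \<int>)"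
proof -
  have "orthogonal_matrix A \<longleftrightarrow> A ** transpose A = mat 1" for A :: "real^3^3"
    using orthogonal_matrix[of "transpose A"] by (simp add: orthogonal_matrix_transpose)
  then show ?thesis by (auto simp: oct_def rotation_matrix_def forall_3 vector_3 m9_transpose)
qed

lemma Ints_unit_vector:
  fixes a b c :: real
  assumes "a \<in> \<int>" "b \<in> \<int>" "c \<in> \<int>" "a*a + b*b + c*c = 1"
  shows "(a = 1 \<and> b = 0 \<and> c = 0) \<or> (a = - 1 \<and> b = 0 \<and> c = 0) \<or> (a = 0 \<and> b = 1 \<and> c = 0) \<or>
    (a = 0 \<and> b = - 1 \<and> c = 0) \<or> (a = 0 \<and> b = 0 \<and> c = 1) \<or> (a = 0 \<and> b = 0 \<and> c = - 1)"
proof -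
  have ge: "x = 0 \<or> x*x \<ge> 1" if "x \<in> \<int>" for x :: real
  proof -
    obtain k where k: "x = of_int k" using \<open>x \<in> \<int>\<close> by (auto elim: Ints_cases)
    have "k = 0 \<or> k * k \<ge> 1" by (metis int_one_le_iff_zero_less not_real_square_gt_zero zero_less_mult_iff linorder_neqE_linordered_idom)
    then show ?thesis unfolding k by (metis of_int_0_eq_iff of_int_1_le_iff of_int_mult)
  qed
  have one: "x = 1 \<or> x = - 1" if "x * x = 1" for x :: real using that by (simp add: square_eq_1_iff)
  have nn: "a*a \<ge> 0" "b*b \<ge> 0" "c*c \<ge> 0" by simp_all
  consider "a \<noteq> 0" | "b \<noteq> 0" | "c \<noteq> 0" using assms(4) by fastforce
  then show ?thesis
  proof cases
    case 1
    then have "b*b = 0" "c*c = 0" "a*a = 1" using ge[OF assms(1)] assms(4) nn by linarith+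
    then show ?thesis using one by auto
  next
    case 2
    then have "a*a = 0" "c*c = 0" "b*b = 1" using ge[OF assms(2)] assms(4) nn by linarith+
    then show ?thesis using one by auto
  next
    case 3
    then have "a*a = 0" "b*b = 0" "c*c = 1" using ge[OF assms(3)] assms(4) nn by linarith+
    then show ?thesis using one by auto
  qed
qed

lemma oct_cases:
  assumes "A \<in> oct"
  shows "A = m9 1 0 0 0 1 0 0 0 1 \<or>
    A = m9 1 0 0 0 (- 1) 0 0 0 (- 1) \<or>
    A = m9 (- 1) 0 0 0 1 0 0 0 (- 1) \<or>
    A = m9 (- 1) 0 0 0 (- 1) 0 0 0 1 \<or>
    A = m9 1 0 0 0 0 1 0 (- 1) 0 \<or>
    A = m9 1 0 0 0 0 (- 1) 0 1 0 \<or>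
    A = m9 (- 1) 0 0 0 0 1 0 1 0 \<or>
    A = m9 (- 1) 0 0 0 0 (- 1) 0 (- 1) 0 \<or>
    A = m9 0 1 0 1 0 0 0 0 (- 1) \<or>
    A = m9 0 1 0 (- 1) 0 0 0 0 1 \<or>
    A = m9 0 (- 1) 0 1 0 0 0 0 1 \<or>
    A = m9 0 (- 1) 0 (- 1) 0 0 0 0 (- 1) \<or>
    A = m9 0 1 0 0 0 1 1 0 0 \<or>
    A = m9 0 1 0 0 0 (- 1) (- 1) 0 0 \<or>
    A = m9 0 (- 1) 0 0 0 1 (- 1) 0 0 \<or>
    A = m9 0 (- 1) 0 0 0 (- 1) 1 0 0 \<or>
    A = m9 0 0 1 1 0 0 0 1 0 \<or>
    A = m9 0 0 1 (- 1) 0 0 0 (- 1) 0 \<or>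
    A = m9 0 0 (- 1) 1 0 0 0 (- 1) 0 \<or>
    A = m9 0 0 (- 1) (- 1) 0 0 0 1 0 \<or>
    A = m9 0 0 1 0 1 0 (- 1) 0 0 \<or>
    A = m9 0 0 1 0 (- 1) 0 1 0 0 \<or>
    A = m9 0 0 (- 1) 0 1 0 1 0 0 \<or>
    A = m9 0 0 (- 1) 0 (- 1) 0 (- 1) 0 0"
proof -
  obtain a b c d e f g h i where A: "A = m9 a b c d e f g h i" using m9_collapse by blast
  have *: "a*a + b*b + c*c = 1" "d*d + e*e + f*f = 1" "a*d + b*e + c*f = 0" "a*g + b*h + c*i = 0" "d*g + e*h + f*i = 0"
    "a*e*i + b*f*g + c*d*h - a*f*h - b*d*i - c*e*g = 1"
    "a \<in> \<int>" "b \<in> \<int>" "c \<in> \<int>" "d \<in> \<int>" "e \<in> \<int>" "f \<in> \<int>"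
    using assms unfolding A m9_in_oct by (simp_all add: m9_simps)
  \<comment> \<open>The first two rows are signed unit vectors; orthogonality to both and the
    determinant fix the third.\<close>
  show ?thesis
    using Ints_unit_vector[OF *(7-9) *(1)] Ints_unit_vector[OF *(10-12) *(2)] *(3-6)
    unfolding A m9_eq by (elim disjE conjE) simp_all
qed

text \<open>A representative of the conjugacy class of \<open>A\<close>, where \<open>p\<close> is the trace of the
  underlying permutation matrix.\<close>

definition rep24 :: "real^3^3 \<Rightarrow> real \<Rightarrow> real^3^3" where
  "rep24 A p = (if p = 3 then (if trace A = 3 then m9 1 0 0 0 1 0 0 0 1 else m9 1 0 0 0 (- 1) 0 0 0 (- 1))
    else if p = 0 then m9 0 1 0 0 0 1 1 0 0
    else if trace A = 1 then m9 1 0 0 0 0 1 0 (- 1) 0 else m9 (- 1) 0 0 0 0 1 0 1 0)"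

text \<open>On \<open>oct\<close> this forgets the signs of a signed permutation matrix. It is the
  homomorphism onto the symmetric group of the three axes, with the diagonal matrices as
  kernel.\<close>

definition mabs :: "real^3^3 \<Rightarrow> real^3^3" where
  "mabs A = (\<chi> i j. \<bar>A $ i $ j\<bar>)"

lemma mabs_m9: "mabs (m9 a b c d e f g h i) = m9 \<bar>a\<bar> \<bar>b\<bar> \<bar>c\<bar> \<bar>d\<bar> \<bar>e\<bar> \<bar>f\<bar> \<bar>g\<bar> \<bar>h\<bar> \<bar>i\<bar>"
  by (simp add: vec_eq_iff forall_3 vector_3 mabs_def)

text \<open>One conjugating matrix for each element. As \<open>rep24\<close> depends only on two
  traces, these traces become complete invariants of conjugacy in \<open>oct\<close>.\<close>

lemma oct_conj_rep:
  assumes "A \<in> oct"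
  shows "\<exists>B\<in>oct. A ** B = B ** rep24 A (trace (mabs A))"
  using oct_cases[OF assms]
proof (elim disjE)
    assume "A = m9 1 0 0 0 1 0 0 0 1"
    then show ?thesis by (intro bexI[of _ "m9 1 0 0 0 1 0 0 0 1"]) (simp_all add: rep24_def mabs_m9 m9_simps m9_in_oct)
  next
    assume "A = m9 1 0 0 0 (- 1) 0 0 0 (- 1)"
    then show ?thesis by (intro bexI[of _ "m9 1 0 0 0 1 0 0 0 1"]) (simp_all add: rep24_def mabs_m9 m9_simps m9_in_oct)
  next
    assume "A = m9 (- 1) 0 0 0 1 0 0 0 (- 1)"
    then show ?thesis by (intro bexI[of _ "m9 0 1 0 1 0 0 0 0 (- 1)"]) (simp_all add: rep24_def mabs_m9 m9_simps m9_in_oct)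
  next
    assume "A = m9 (- 1) 0 0 0 (- 1) 0 0 0 1"
    then show ?thesis by (intro bexI[of _ "m9 0 1 0 0 0 1 1 0 0"]) (simp_all add: rep24_def mabs_m9 m9_simps m9_in_oct)
  next
    assume "A = m9 1 0 0 0 0 1 0 (- 1) 0"
    then show ?thesis by (intro bexI[of _ "m9 1 0 0 0 1 0 0 0 1"]) (simp_all add: rep24_def mabs_m9 m9_simps m9_in_oct)
  next
    assume "A = m9 1 0 0 0 0 (- 1) 0 1 0"
    then show ?thesis by (intro bexI[of _ "m9 (- 1) 0 0 0 1 0 0 0 (- 1)"]) (simp_all add: rep24_def mabs_m9 m9_simps m9_in_oct)
  next
    assume "A = m9 (- 1) 0 0 0 0 1 0 1 0"
    then show ?thesis by (intro bexI[of _ "m9 1 0 0 0 1 0 0 0 1"]) (simp_all add: rep24_def mabs_m9 m9_simps m9_in_oct)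
  next
    assume "A = m9 (- 1) 0 0 0 0 (- 1) 0 (- 1) 0"
    then show ?thesis by (intro bexI[of _ "m9 (- 1) 0 0 0 1 0 0 0 (- 1)"]) (simp_all add: rep24_def mabs_m9 m9_simps m9_in_oct)
  next
    assume "A = m9 0 1 0 1 0 0 0 0 (- 1)"
    then show ?thesis by (intro bexI[of _ "m9 0 1 0 0 0 1 1 0 0"]) (simp_all add: rep24_def mabs_m9 m9_simps m9_in_oct)
  next
    assume "A = m9 0 1 0 (- 1) 0 0 0 0 1"
    then show ?thesis by (intro bexI[of _ "m9 0 1 0 0 0 1 1 0 0"]) (simp_all add: rep24_def mabs_m9 m9_simps m9_in_oct)
  next
    assume "A = m9 0 (- 1) 0 1 0 0 0 0 1"
    then show ?thesis by (intro bexI[of _ "m9 0 1 0 0 0 (- 1) (- 1) 0 0"]) (simp_all add: rep24_def mabs_m9 m9_simps m9_in_oct)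
  next
    assume "A = m9 0 (- 1) 0 (- 1) 0 0 0 0 (- 1)"
    then show ?thesis by (intro bexI[of _ "m9 0 1 0 0 0 (- 1) (- 1) 0 0"]) (simp_all add: rep24_def mabs_m9 m9_simps m9_in_oct)
  next
    assume "A = m9 0 1 0 0 0 1 1 0 0"
    then show ?thesis by (intro bexI[of _ "m9 1 0 0 0 1 0 0 0 1"]) (simp_all add: rep24_def mabs_m9 m9_simps m9_in_oct)
  next
    assume "A = m9 0 1 0 0 0 (- 1) (- 1) 0 0"
    then show ?thesis by (intro bexI[of _ "m9 (- 1) 0 0 0 (- 1) 0 0 0 1"]) (simp_all add: rep24_def mabs_m9 m9_simps m9_in_oct)
  next
    assume "A = m9 0 (- 1) 0 0 0 1 (- 1) 0 0"
    then show ?thesis by (intro bexI[of _ "m9 1 0 0 0 (- 1) 0 0 0 (- 1)"]) (simp_all add: rep24_def mabs_m9 m9_simps m9_in_oct)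
  next
    assume "A = m9 0 (- 1) 0 0 0 (- 1) 1 0 0"
    then show ?thesis by (intro bexI[of _ "m9 (- 1) 0 0 0 1 0 0 0 (- 1)"]) (simp_all add: rep24_def mabs_m9 m9_simps m9_in_oct)
  next
    assume "A = m9 0 0 1 1 0 0 0 1 0"
    then show ?thesis by (intro bexI[of _ "m9 (- 1) 0 0 0 0 (- 1) 0 (- 1) 0"]) (simp_all add: rep24_def mabs_m9 m9_simps m9_in_oct)
  next
    assume "A = m9 0 0 1 (- 1) 0 0 0 (- 1) 0"
    then show ?thesis by (intro bexI[of _ "m9 1 0 0 0 0 (- 1) 0 1 0"]) (simp_all add: rep24_def mabs_m9 m9_simps m9_in_oct)
  next
    assume "A = m9 0 0 (- 1) 1 0 0 0 (- 1) 0"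
    then show ?thesis by (intro bexI[of _ "m9 1 0 0 0 0 1 0 (- 1) 0"]) (simp_all add: rep24_def mabs_m9 m9_simps m9_in_oct)
  next
    assume "A = m9 0 0 (- 1) (- 1) 0 0 0 1 0"
    then show ?thesis by (intro bexI[of _ "m9 (- 1) 0 0 0 0 1 0 1 0"]) (simp_all add: rep24_def mabs_m9 m9_simps m9_in_oct)
  next
    assume "A = m9 0 0 1 0 1 0 (- 1) 0 0"
    then show ?thesis by (intro bexI[of _ "m9 0 1 0 (- 1) 0 0 0 0 1"]) (simp_all add: rep24_def mabs_m9 m9_simps m9_in_oct)
  next
    assume "A = m9 0 0 1 0 (- 1) 0 1 0 0"
    then show ?thesis by (intro bexI[of _ "m9 0 1 0 (- 1) 0 0 0 0 1"]) (simp_all add: rep24_def mabs_m9 m9_simps m9_in_oct)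
  next
    assume "A = m9 0 0 (- 1) 0 1 0 1 0 0"
    then show ?thesis by (intro bexI[of _ "m9 0 1 0 1 0 0 0 0 (- 1)"]) (simp_all add: rep24_def mabs_m9 m9_simps m9_in_oct)
  next
    assume "A = m9 0 0 (- 1) 0 (- 1) 0 (- 1) 0 0"
    then show ?thesis by (intro bexI[of _ "m9 0 1 0 1 0 0 0 0 (- 1)"]) (simp_all add: rep24_def mabs_m9 m9_simps m9_in_oct)
qed

lemma trace_similar:
  "Q ** transpose Q = mat 1 \<Longrightarrow> trace (transpose Q ** A ** Q) = trace (A :: real^3^3)"
proof -
  assume Q: "Q ** transpose Q = mat 1"
  have "trace (transpose Q ** A ** Q) = trace (Q ** (transpose Q ** A))" by (rule trace_mul_sym)
  then show ?thesis using Q by (simp add: matrix_mul_assoc)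
qed

lemma oct_closed:
  assumes "A \<in> oct"
  shows "B \<in> oct \<Longrightarrow> A ** B \<in> oct" "transpose A \<in> oct" "transpose A ** A = mat 1" "A ** transpose A = mat 1"
proof -
  show "A ** B \<in> oct" if "B \<in> oct"
  proof -
    have "(A ** B) $ i $ j \<in> \<int>" for i j
      using assms that unfolding matrix_matrix_mult_def by (auto simp: oct_def intro!: Ints_sum)
    then show ?thesis using assms that by (simp add: oct_def rotation_matrix_closed)
  qed
  show "transpose A \<in> oct" using assms by (auto simp: oct_def rotation_matrix_closed) (simp add: transpose_def)
qed (use assms rotation_matrixD in \<open>auto simp: oct_def\<close>)

lemma one_in_oct: "mat 1 \<in> oct"
proof -
  have "(mat 1 :: real^3^3) $ i $ j \<in> \<int>" for i j by (simp add: mat_def)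
  then show ?thesis by (simp add: oct_def rotation_matrix_closed)
qed

lemma finite_oct: "finite oct"
proof (rule finite_subset)
  let ?e = "{- 1, 0, 1 :: real}"
  show "oct \<subseteq> (\<lambda>((a,b,c),(d,e,f),(g,h,i)). m9 a b c d e f g h i) `
      ((?e \<times> ?e \<times> ?e) \<times> (?e \<times> ?e \<times> ?e) \<times> (?e \<times> ?e \<times> ?e))"
  proof
    fix A assume A: "A \<in> oct"
    have e: "A $ i $ j \<in> ?e" for i j
    proof -
      have "A $ i $ j \<in> \<int>" and le: "\<bar>A $ i $ j\<bar> \<le> 1"
        using A orthogonal_matrix_entry_le[of A i j] by (simp_all add: oct_def rotation_matrix_def)
      then obtain k where k: "A $ i $ j = of_int k" by (elim Ints_cases)
      then have "\<bar>k\<bar> \<le> 1" using le by linarith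
      then have "k = - 1 \<or> k = 0 \<or> k = 1" by linarith
      then show ?thesis unfolding k by (elim disjE) simp_all
    qed
    show "A \<in> (\<lambda>((a,b,c),(d,e,f),(g,h,i)). m9 a b c d e f g h i) `
      ((?e \<times> ?e \<times> ?e) \<times> (?e \<times> ?e \<times> ?e) \<times> (?e \<times> ?e \<times> ?e))"
    proof (rule image_eqI)
      show "A = (\<lambda>((a,b,c),(d,e,f),(g,h,i)). m9 a b c d e f g h i) ((A$1$1,A$1$2,A$1$3),(A$2$1,A$2$2,A$2$3),(A$3$1,A$3$2,A$3$3))"
        unfolding prod.case by (rule m9_collapse)
    qed (intro SigmaI e)
  qed
qed (intro finite_imageI finite_cartesian_product finite.intros)

interpretation oct: fin_group "mat_group oct"
  by (rule fin_group_mat_group) (use finite_oct one_in_oct oct_closed in blast)+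

lemma oct_inv: "A \<in> oct \<Longrightarrow> inv\<^bsub>mat_group oct\<^esub> A = transpose A"
  using oct.inv_equality[of "transpose A" A] oct_closed by simp

lemma mabs_mult: "A \<in> oct \<Longrightarrow> mabs (A ** B) = mabs A ** mabs B"
  by (subst (1 2) m9_collapse[of B], drule oct_cases, elim disjE)
    (simp_all add: m9_mult mabs_m9)

lemma mabs_transpose: "mabs (transpose A) = transpose (mabs A)"
  by (simp add: mabs_def transpose_def vec_eq_iff)

lemma mabs_one: "mabs (mat 1) = mat 1"
  by (simp add: m9_one mabs_m9)

lemma mabs_orthogonal:
  assumes "A \<in> oct"
  shows "transpose (mabs A) ** mabs A = mat 1" "mabs A ** transpose (mabs A) = mat 1"
  using mabs_mult[OF oct_closed(2)[OF assms], of A] mabs_mult[OF assms, of "transpose A"]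
  unfolding oct_closed(3,4)[OF assms] mabs_transpose mabs_one by simp_all

text \<open>The five pairs are the conjugacy classes: the identity, half turns about coordinate
  axes, turns of order three, half turns about the remaining axes, quarter turns. The third claim
  says which squares are coordinate half turns; the fourth prepares the integrality condition from
  the diagonals.\<close>

lemma oct_types:
  assumes "A \<in> oct"
  shows "(trace (mabs A), trace A) \<in> {(3, 3), (3, - 1), (0, 0), (1, - 1), (1, 1)}"
    and "det (mabs A) = (if trace (mabs A) = 1 then - 1 else 1)"
    and "trace (mabs (A ** A)) = 3 \<and> trace (A ** A) = - 1 \<longleftrightarrow> trace (mabs A) = 1 \<and> trace A = 1"
    and "det (mabs A) * (\<Sum>i\<in>UNIV. \<Sum>j\<in>UNIV. A $ i $ j) \<in> {3, - 1}"
    and "trace (mabs A) = 3 \<and> trace A = 3 \<longleftrightarrow> A = mat 1"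
  using oct_cases[OF assms]
  by (elim disjE; simp add: mabs_m9 m9_simps sum_3 vector_3)+

lemma oct_conj_class:
  assumes h: "h \<in> oct"
  shows "conj_class (mat_group oct) h = {A\<in>oct. trace (mabs A) = trace (mabs h) \<and> trace A = trace h}"
proof (intro Set.set_eqI iffI)
  fix A assume "A \<in> conj_class (mat_group oct) h"
  then obtain t where t: "t \<in> oct" "A = t ** h ** transpose t" by (auto simp: conj_class_def oct_inv)
  have "trace A = trace h" using trace_similar[of "transpose t" h] oct_closed(3)[OF t(1)] by (simp add: t(2))
  moreover have "mabs A = mabs t ** mabs h ** transpose (mabs t)"
    by (simp add: t(2) mabs_mult[OF oct_closed(1)[OF t(1) h]] mabs_mult[OF t(1)] mabs_transpose)
  then have "trace (mabs A) = trace (mabs h)"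
    using trace_similar[of "transpose (mabs t)" "mabs h"] mabs_orthogonal(1)[OF t(1)] by simp
  moreover have "A \<in> oct" unfolding t(2) using t(1) h by (intro oct_closed)
  ultimately show "A \<in> {A\<in>oct. trace (mabs A) = trace (mabs h) \<and> trace A = trace h}" by simp
next
  have rep: "\<exists>B\<in>oct. transpose B ** A ** B = rep24 A (trace (mabs A)) \<and> B ** rep24 A (trace (mabs A)) ** transpose B = A"
    if A: "A \<in> oct" for A
  proof -
    obtain B where B: "B \<in> oct" "A ** B = B ** rep24 A (trace (mabs A))" using oct_conj_rep[OF A] by blast
    have "transpose B ** A ** B = transpose B ** (B ** rep24 A (trace (mabs A)))"
      by (simp only: matrix_mul_assoc[symmetric] B(2))
    also have "\<dots> = rep24 A (trace (mabs A))"
      by (simp only: matrix_mul_assoc oct_closed(3)[OF B(1)] matrix_mul_lid)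
    finally have "transpose B ** A ** B = rep24 A (trace (mabs A))" .
    moreover have "B ** rep24 A (trace (mabs A)) ** transpose B = A"
      by (simp only: B(2)[symmetric] matrix_mul_assoc[symmetric] oct_closed(4)[OF B(1)] matrix_mul_rid)
    ultimately show ?thesis using B(1) by blast
  qed
  fix A assume A: "A \<in> {A\<in>oct. trace (mabs A) = trace (mabs h) \<and> trace A = trace h}"
  define r where "r = rep24 A (trace (mabs A))"
  have r': "r = rep24 h (trace (mabs h))" using A by (simp add: r_def rep24_def)
  have Ao: "A \<in> oct" using A by simp
  obtain B where B: "B \<in> oct" "transpose B ** A ** B = r" "B ** r ** transpose B = A"
    using rep[OF Ao] unfolding r_def[symmetric] by blast
  obtain C where C: "C \<in> oct" "C ** r ** transpose C = h" using rep[OF h] unfolding r'[symmetric] by blast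
  have r: "r \<in> oct" unfolding B(2)[symmetric] using B(1) Ao by (intro oct_closed)
  have "A \<in> conj_class (mat_group oct) r" "h \<in> conj_class (mat_group oct) r"
    using oct.conj_classI[of B r] oct.conj_classI[of C r] B(1,3) C by (simp_all add: oct_inv)
  then show "A \<in> conj_class (mat_group oct) h" using oct.conj_class_eq[of r h] r by simp
qed

abbreviation "s3 \<equiv> mabs ` oct"

lemma s3_cases:
  assumes "z \<in> s3"
  shows "z = m9 1 0 0 0 1 0 0 0 1 \<or> z = m9 1 0 0 0 0 1 0 1 0 \<or> z = m9 0 1 0 1 0 0 0 0 1 \<or>
    z = m9 0 1 0 0 0 1 1 0 0 \<or> z = m9 0 0 1 1 0 0 0 1 0 \<or> z = m9 0 0 1 0 1 0 1 0 0"
proof -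
  obtain A where A: "A \<in> oct" "z = mabs A" using assms by blast
  show ?thesis unfolding A(2) using oct_cases[OF A(1)] by (elim disjE) (simp_all add: mabs_m9 m9_eq)
qed

lemma s3_closed: "x \<in> s3 \<Longrightarrow> y \<in> s3 \<Longrightarrow> x ** y \<in> s3" "x \<in> s3 \<Longrightarrow> transpose x \<in> s3" "mat 1 \<in> s3"
  "x \<in> s3 \<Longrightarrow> transpose x ** x = mat 1"
proof -
  show "x ** y \<in> s3" if "x \<in> s3" "y \<in> s3"
    using that by (auto simp: mabs_mult[symmetric] intro: oct_closed)
  show "transpose x \<in> s3" if "x \<in> s3"
    using that by (auto simp: mabs_transpose[symmetric] intro: oct_closed)
  show "mat 1 \<in> s3" using one_in_oct mabs_one by (metis image_eqI)
qed (auto simp: mabs_orthogonal)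

interpretation s3: fin_group "mat_group s3"
  by (rule fin_group_mat_group) (use finite_oct s3_closed in blast)+

lemma s3_inv: "x \<in> s3 \<Longrightarrow> inv\<^bsub>mat_group s3\<^esub> x = transpose x"
  using s3.inv_equality[of "transpose x" x] s3_closed by simp

interpretation to_s3: fin_hom "mat_group oct" "mat_group s3" mabs
  by unfold_locales (auto simp: hom_def mabs_mult)

text \<open>The symmetric group is dihedral over its even permutations, of which there are
  three.\<close>

lemma trivial_augs_s3: "trivial_augs (mat_group s3)"
proof (rule s3.trivial_augs_dihedral[of "{z\<in>s3. det z = 1}"])
  have det: "det x = 1 \<or> det x = - 1" if "x \<in> s3" for x
    using s3_cases[OF that] by (elim disjE) (simp_all add: m9_det)
  show "subgroup {z\<in>s3. det z = 1} (mat_group s3)"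
  proof (rule s3.subgroupI)
    have "mat 1 \<in> {z\<in>s3. det z = 1}" using s3_closed(3) by simp
    then show "{z\<in>s3. det z = 1} \<noteq> {}" by blast
  qed (use s3_closed in \<open>auto simp: s3_inv det_mul\<close>)
  fix s t assume "s \<in> carrier (mat_group s3) - {z\<in>s3. det z = 1}" "t \<in> carrier (mat_group s3) - {z\<in>s3. det z = 1}"
  then show "s \<otimes>\<^bsub>mat_group s3\<^esub> t \<in> {z\<in>s3. det z = 1}" using det[of s] det[of t] s3_closed by (auto simp: det_mul)
next
  have even: "z = m9 1 0 0 0 1 0 0 0 1 \<or> z = m9 0 1 0 0 0 1 1 0 0 \<or> z = m9 0 0 1 1 0 0 0 1 0"
    if "z \<in> {z\<in>s3. det z = 1}" for z
    using s3_cases[of z] that by (auto simp: m9_det)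
  have odd: "z = m9 1 0 0 0 0 1 0 1 0 \<or> z = m9 0 1 0 1 0 0 0 0 1 \<or> z = m9 0 0 1 0 1 0 1 0 0"
    if "z \<in> carrier (mat_group s3) - {z\<in>s3. det z = 1}" for z
    using s3_cases[of z] that by (auto simp: m9_det)
  show "a \<otimes>\<^bsub>mat_group s3\<^esub> b = b \<otimes>\<^bsub>mat_group s3\<^esub> a" if "a \<in> {z\<in>s3. det z = 1}" "b \<in> {z\<in>s3. det z = 1}" for a b
    using even[OF that(1)] even[OF that(2)] by (elim disjE) (simp_all add: m9_simps)
  show "s \<otimes>\<^bsub>mat_group s3\<^esub> a \<otimes>\<^bsub>mat_group s3\<^esub> inv\<^bsub>mat_group s3\<^esub> s = inv\<^bsub>mat_group s3\<^esub> a"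
    if "s \<in> carrier (mat_group s3) - {z\<in>s3. det z = 1}" "a \<in> {z\<in>s3. det z = 1}" for s a
  proof -
    have "s ** a ** transpose s = transpose a"
      using odd[OF that(1)] even[OF that(2)] by (elim disjE) (simp_all add: m9_simps)
    then show ?thesis using that by (simp add: s3_inv)
  qed
  have sub: "{z\<in>s3. det z = 1} \<subseteq> {m9 1 0 0 0 1 0 0 0 1, m9 0 1 0 0 0 1 1 0 0, m9 0 0 1 1 0 0 0 1 0}"
    using even by blast
  have "card {z\<in>s3. det z = 1} \<le> card {m9 1 0 0 0 1 0 0 0 1, m9 0 1 0 0 0 1 1 0 0, m9 0 0 1 1 0 0 0 (1::real) 0}"
    using sub by (intro card_mono) auto
  also have "\<dots> \<le> 3" by (simp add: card_insert_if)
  finally have "card {z\<in>s3. det z = 1} \<le> 3" .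
  moreover have "finite {z\<in>s3. det z = 1}" using finite_oct by auto
  ultimately show "card ((\<lambda>a. a \<otimes>\<^bsub>mat_group s3\<^esub> a) ` {z\<in>s3. det z = 1}) \<le> 3"
    using card_image_le le_trans by blast
qed

lemma s3_traces:
  assumes "z \<in> s3"
  shows "trace z = 3 \<or> trace z = 0 \<or> trace z = 1" "trace (z ** z) = (if trace z = 0 then 0 else 3)"
  using s3_cases[OF assms] by (elim disjE; simp add: m9_simps)+

text \<open>At the five pairs of traces that occur these are the partial augmentations of
  \<open>v\<close>.\<close>

definition type_sum :: "(real^3^3 \<Rightarrow> int) \<Rightarrow> real \<Rightarrow> real \<Rightarrow> int" where
  "type_sum v p q = (\<Sum>A\<in>{A\<in>oct. trace (mabs A) = p \<and> trace A = q}. v A)"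

lemma sum_types:
  "(\<Sum>A\<in>oct. of_int (v A) * f (trace (mabs A)) (trace A)) =
     of_int (type_sum v 3 3) * f 3 3 + of_int (type_sum v 3 (- 1)) * f 3 (- 1) + of_int (type_sum v 0 0) * f 0 0
     + of_int (type_sum v 1 (- 1)) * f 1 (- 1) + of_int (type_sum v 1 1) * (f 1 1 :: real)"
proof -
  let ?T = "{(3, 3), (3, - 1), (0, 0), (1, - 1), (1, 1)} :: (real \<times> real) set"
  have "(\<Sum>A\<in>oct. of_int (v A) * f (trace (mabs A)) (trace A))
      = (\<Sum>y\<in>?T. \<Sum>A\<in>{A\<in>oct. (trace (mabs A), trace A) = y}. of_int (v A) * f (trace (mabs A)) (trace A))"
    by (rule sum.group[symmetric]) (use finite_oct oct_types(1) in auto)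
  also have "\<dots> = (\<Sum>y\<in>?T. of_int (type_sum v (fst y) (snd y)) * f (fst y) (snd y))"
  proof (rule sum.cong[OF refl])
    fix y :: "real \<times> real"
    show "(\<Sum>A\<in>{A\<in>oct. (trace (mabs A), trace A) = y}. of_int (v A) * f (trace (mabs A)) (trace A))
        = of_int (type_sum v (fst y) (snd y)) * f (fst y) (snd y)"
      unfolding type_sum_def of_int_sum sum_distrib_right by (intro sum.cong) auto
  qed
  also have "\<dots> = of_int (type_sum v 3 3) * f 3 3 + of_int (type_sum v 3 (- 1)) * f 3 (- 1) + of_int (type_sum v 0 0) * f 0 0
     + of_int (type_sum v 1 (- 1)) * f 1 (- 1) + of_int (type_sum v 1 1) * (f 1 1 :: real)"
    by simp
  finally show ?thesis .
qed

text \<open>The point stabiliser in the action of the octahedral group on the four diagonals of the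
  cube provides an integrality condition: \<open>sgn A\<close> times the sum of the entries of \<open>A\<close> is
  congruent to \<open>- 1\<close> modulo \<open>4\<close>, so \<open>- 1\<close> is not in the image of the twisted representation.\<close>

lemma oct_twisted_trace:
  assumes v: "tors1 (mat_group oct) v"
  shows "(\<Sum>A\<in>oct. of_int (v A) * (det (mabs A) * trace A)) > - 3"
proof -
  define \<rho> where "\<rho> = (\<lambda>A. det (mabs A) *\<^sub>R A)"
  have mult: "\<rho> (A ** B) = \<rho> A ** \<rho> B" if "A \<in> oct" for A B
    using that by (simp add: \<rho>_def mabs_mult det_mul scalar_matrix_assoc[symmetric] matrix_scalar_ac)
  have one: "\<rho> (mat 1) = mat 1" by (simp add: \<rho>_def mabs_one)
  have tr: "trace (oct.lin_rep \<rho> v) = (\<Sum>A\<in>oct. of_int (v A) * (det (mabs A) * trace A))"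
    by (simp only: oct.trace_lin_rep mat_group_simps) (simp add: \<rho>_def trace_def sum_distrib_left)
  have "trace (oct.lin_rep \<rho> v) \<noteq> - 3"
  proof
    assume "trace (oct.lin_rep \<rho> v) = - 3"
    then have neg: "oct.lin_rep \<rho> v = - mat 1"
      using oct.trace_lin_rep_ge(2)[of \<rho> v] mult one v by simp
    have "(\<Sum>i\<in>UNIV. \<Sum>j\<in>UNIV. oct.lin_rep \<rho> v $ i $ j) = - 3"
      unfolding neg by (simp add: mat_def sum_3)
    moreover have "(\<Sum>i\<in>UNIV. \<Sum>j\<in>UNIV. oct.lin_rep \<rho> v $ i $ j)
        = (\<Sum>A\<in>oct. of_int (v A) * (det (mabs A) * (\<Sum>i\<in>UNIV. \<Sum>j\<in>UNIV. A $ i $ j)))"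
      by (simp add: oct.lin_rep_def \<rho>_def sum_3 sum.distrib algebra_simps sum_distrib_left)
    \<comment> \<open>Each twisted sum of entries is \<open>4 * i - 1\<close> with \<open>i\<close>
      equal to 0 or 1. Augmentation 1 thus makes the total \<open>4 * k - 1\<close>, which is never
      \<open>- 3\<close>.\<close>
    moreover have "\<dots> = (\<Sum>A\<in>oct. of_int (v A * (if det (mabs A) * (\<Sum>i\<in>UNIV. \<Sum>j\<in>UNIV. A $ i $ j) = 3 then 3 else - 1)))"
      using oct_types(4) by (intro sum.cong refl) auto
    moreover have "\<dots> = of_int (\<Sum>A\<in>oct. v A * (4 * of_bool (det (mabs A) * (\<Sum>i\<in>UNIV. \<Sum>j\<in>UNIV. A $ i $ j) = 3) - 1))"
      unfolding of_int_sum by (intro sum.cong refl) auto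
    ultimately have "(\<Sum>A\<in>oct. v A * (4 * of_bool (det (mabs A) * (\<Sum>i\<in>UNIV. \<Sum>j\<in>UNIV. A $ i $ j) = 3) - 1)) = - 3"
      by linarith
    moreover define k where "k = (\<Sum>A\<in>oct. v A * of_bool (det (mabs A) * (\<Sum>i\<in>UNIV. \<Sum>j\<in>UNIV. A $ i $ j) = 3))"
    ultimately have "4 * k - (\<Sum>A\<in>oct. v A) = - 3"
      by (simp add: right_diff_distrib sum_subtractf sum_distrib_left mult.left_commute del: sum_mult_of_bool_eq)
    moreover have "(\<Sum>A\<in>oct. v A) = 1" using v by (simp add: tors1_def)
    ultimately have "4 * k - 1 = - 3" by simp
    then show False by presburger
  qed
  moreover have "trace (oct.lin_rep \<rho> v) \<ge> - 3"
    using oct.trace_lin_rep_ge(1)[of \<rho> v] mult one v by simp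
  ultimately show ?thesis using tr by linarith
qed

text \<open>With no mass at the identity, the quotient \<open>s3\<close> determines all partial
  augmentations up to the integer \<open>type_sum u 1 (- 1)\<close>. The traces in the standard and
  the twisted representation confine it to a short interval, and the wrong values left there are
  excluded by looking at the square of \<open>u\<close>.\<close>

lemma trivial_augs_oct: "trivial_augs (mat_group oct)"
  unfolding trivial_augs_def
proof (intro allI impI)
  fix u assume u: "tors1 (mat_group oct) u"
  have central_one: "t \<otimes>\<^bsub>mat_group oct\<^esub> mat 1 = mat 1 \<otimes>\<^bsub>mat_group oct\<^esub> t" for t by simp
  have cls: "class_sum (mat_group oct) v h = type_sum v (trace (mabs h)) (trace h)" if "h \<in> oct" for v h
    by (simp add: class_sum_def type_sum_def oct_conj_class[OF that])
  have id_type: "type_sum v 3 3 = v (mat 1)" for v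
  proof -
    have "{A\<in>oct. trace (mabs A) = 3 \<and> trace A = 3} = {mat 1}" using oct_types(5) one_in_oct by blast
    then show ?thesis by (simp add: type_sum_def)
  qed
  have id: "v = grp_basis (mat 1)" if "tors1 (mat_group oct) v" "v (mat 1) \<noteq> 0" for v
    using oct.berman_higman[OF that(1) _ central_one that(2)] one_in_oct by simp
  have basis_type: "type_sum (grp_basis (mat 1)) 3 (- 1) = 0"
    unfolding type_sum_def grp_basis_def by (intro sum.neutral) (auto simp: m9_simps)
  have T1: "(\<Sum>A\<in>oct. of_int (v A) * trace A) = 3 * type_sum v 3 3 - type_sum v 3 (- 1) - type_sum v 1 (- 1) + type_sum v 1 1" for v
    using sum_types[of v "\<lambda>p q. q"] by simp
  have T2: "(\<Sum>A\<in>oct. of_int (v A) * (det (mabs A) * trace A)) = 3 * type_sum v 3 3 - type_sum v 3 (- 1) + type_sum v 1 (- 1) - type_sum v 1 1" for v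
    using sum_types[of v "\<lambda>p q. (if p = 1 then - 1 else 1) * q"] by (simp add: oct_types(2) cong: sum.cong)
  have T2_gt: "3 * type_sum v 3 3 - type_sum v 3 (- 1) + type_sum v 1 (- 1) - type_sum v 1 1 > - 3" if "tors1 (mat_group oct) v" for v
    using oct_twisted_trace[OF that] unfolding T2 by linarith
  have lin1: "trace (oct.lin_rep (\<lambda>A. A) v) = 3 * type_sum v 3 3 - type_sum v 3 (- 1) - type_sum v 1 (- 1) + type_sum v 1 1" for v
    using T1[of v] by (simp add: oct.trace_lin_rep)
  have T1_ge: "3 * type_sum v 3 3 - type_sum v 3 (- 1) - type_sum v 1 (- 1) + type_sum v 1 1 \<ge> - 3" if "tors1 (mat_group oct) v" for v
    using oct.trace_lin_rep_ge(1)[of "\<lambda>A. A" v] that unfolding lin1 by simp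
  define u2 where "u2 = grp_pow (mat_group oct) u 2"
  have u2: "tors1 (mat_group oct) u2" unfolding u2_def by (rule oct.tors1_pow[OF u])
  have supp: "grp_supp (mat_group oct) u" using u by (simp add: tors1_def)
  have u2_eq: "u2 = grp_mult (mat_group oct) u u" using oct.one_mult[OF supp] by (simp add: u2_def numeral_2_eq_2)
  \<comment> \<open>The extreme trace forces \<open>u\<close> to act as \<open>- mat 1\<close>,
    hence its square as the identity.\<close>
  have T1_neg: "3 * type_sum u2 3 3 - type_sum u2 3 (- 1) - type_sum u2 1 (- 1) + type_sum u2 1 1 = 3"
    if "3 * type_sum u 3 3 - type_sum u 3 (- 1) - type_sum u 1 (- 1) + type_sum u 1 1 = - 3"
  proof -
    have "trace (oct.lin_rep (\<lambda>A. A) u) = - 3" unfolding lin1 using that by linarith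
    then have "oct.lin_rep (\<lambda>A. A) u = - mat 1" using oct.trace_lin_rep_ge(2)[of "\<lambda>A. A" u] u by simp
    then have "oct.lin_rep (\<lambda>A. A) u2 = (- mat 1) ** (- mat 1)" using oct.lin_rep_mult[of "\<lambda>A. A" u u] u2_eq by simp
    also have "\<dots> = mat 1" by (simp add: m9_one vec_eq_iff forall_3 vector_3 matrix_matrix_mult_def sum_3)
    finally have "trace (oct.lin_rep (\<lambda>A. A) u2) = 3" by (simp add: m9_simps)
    then show ?thesis unfolding lin1 by linarith
  qed
  obtain y where y: "aug_at (mat_group s3) (push (mat_group oct) mabs u) y"
    using trivial_augs_s3 to_s3.tors1_push[OF u] by (auto simp: trivial_augs_def)
  have yc: "y \<in> s3" using y by (simp add: aug_at_def)
  have y2: "aug_at (mat_group s3) (push (mat_group oct) mabs u2) (y ** y)"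
  proof -
    have "y [^]\<^bsub>mat_group s3\<^esub> (2::nat) = y ** y" by (simp add: numeral_2_eq_2)
    then show ?thesis
      using s3.aug_at_pow[OF trivial_augs_s3 to_s3.tors1_push[OF u] y, of 2]
      by (simp only: u2_def to_s3.push_pow)
  qed
  have fib: "(\<Sum>A\<in>oct. of_int (v A) * f (trace (mabs A))) = (f (trace z) :: real)"
    if z: "aug_at (mat_group s3) (push (mat_group oct) mabs v) z" for v z f
  proof -
    have "(\<Sum>A\<in>oct. of_int (v A) * f (trace (mabs A))) = (\<Sum>x\<in>s3. of_int (push (mat_group oct) mabs v x) * f (trace x))"
      using to_s3.sum_push'[of "\<lambda>A. of_int (v A)" "\<lambda>x. f (trace x)"] by (simp add: push_def)
    also have "\<dots> = f (trace z)"
    proof (rule s3.aug_at_sum[OF z, of "\<lambda>x. f (trace x)", simplified])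
      fix x t assume "x \<in> s3" "t \<in> s3"
      then have "trace (t ** x ** inv\<^bsub>mat_group s3\<^esub> t) = trace x"
        using trace_similar[of "transpose t" x] s3_closed(4) by (simp add: s3_inv)
      then show "f (trace (t ** x ** inv\<^bsub>mat_group s3\<^esub> t)) = f (trace x)" by simp
    qed
    finally show ?thesis .
  qed
  have fib3: "type_sum v 3 3 + type_sum v 3 (- 1) = (if trace z = 3 then 1 else 0)"
    and fib0: "type_sum v 0 0 = (if trace z = 0 then 1 else 0)"
    and fib1: "type_sum v 1 (- 1) + type_sum v 1 1 = (if trace z = 1 then 1 else 0)"
    if z: "aug_at (mat_group s3) (push (mat_group oct) mabs v) z" for v z
  proof -
    have *: "real_of_int (type_sum v 3 3 + type_sum v 3 (- 1)) = of_int (if trace z = 3 then 1 else 0)"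
      "real_of_int (type_sum v 0 0) = of_int (if trace z = 0 then 1 else 0)"
      "real_of_int (type_sum v 1 (- 1) + type_sum v 1 1) = of_int (if trace z = 1 then 1 else 0)"
      using fib[OF z, of "\<lambda>p. if p = 3 then 1 else 0"] sum_types[of v "\<lambda>p q. if p = 3 then 1 else 0"]
        fib[OF z, of "\<lambda>p. if p = 0 then 1 else 0"] sum_types[of v "\<lambda>p q. if p = 0 then 1 else 0"]
        fib[OF z, of "\<lambda>p. if p = 1 then 1 else 0"] sum_types[of v "\<lambda>p q. if p = 1 then 1 else 0"]
      by simp_all
    show "type_sum v 3 3 + type_sum v 3 (- 1) = (if trace z = 3 then 1 else 0)"
      "type_sum v 0 0 = (if trace z = 0 then 1 else 0)"
      "type_sum v 1 (- 1) + type_sum v 1 1 = (if trace z = 1 then 1 else 0)"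
      using * by (simp_all only: of_int_eq_iff)
  qed
  \<comment> \<open>The congruence for squares at the coordinate half turn \<open>h\<close>: its
    class consists of the squares of quarter turns only.\<close>
  have frob: "[type_sum u2 3 (- 1) = type_sum u 1 1] (mod 2)"
  proof -
    define h where "h = (m9 1 0 0 0 (- 1) 0 0 0 (- 1) :: real^3^3)"
    have h: "h \<in> oct" "trace (mabs h) = 3" "trace h = - 1" by (simp_all add: h_def m9_in_oct m9_simps mabs_m9)
    have "{A\<in>oct. A [^]\<^bsub>mat_group oct\<^esub> (2::nat) \<in> conj_class (mat_group oct) h} = {A\<in>oct. trace (mabs A) = 1 \<and> trace A = 1}"
      using oct_types(3) oct_closed by (auto simp: oct_conj_class[OF h(1)] h numeral_2_eq_2)
    then show ?thesis
      using oct.class_sum_pow_cong[of 2 u h] supp h(1)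
      unfolding cls[OF h(1)] h u2_def[symmetric] by (simp add: type_sum_def)
  qed
  have u2_one: "type_sum u2 3 (- 1) = 0" if "type_sum u2 3 3 \<noteq> 0"
    using id[OF u2] that basis_type by (simp add: id_type)
  show "\<exists>g. aug_at (mat_group oct) u g"
  proof (cases "u (mat 1) = 0")
    case False
    then have "u = grp_basis (mat 1)" using id u by blast
    moreover have "aug_at (mat_group oct) (grp_basis (mat 1)) (mat 1)"
    proof -
      have "conj_class (mat_group oct) (mat 1) = {mat 1}"
        using oct.conj_class_central[of "mat 1"] one_in_oct by simp
      then show ?thesis
        using oct.conj_class_sym one_in_oct by (fastforce simp: aug_at_def class_sum_def grp_basis_def intro: sum.neutral oct.conj_class_refl)
    qed
    ultimately show ?thesis by blast
  next
    case True
    then have z: "type_sum u 3 3 = 0" by (simp add: id_type)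
    have par: "odd (type_sum u 1 1) \<longleftrightarrow> odd (type_sum u2 3 (- 1))"
      using frob by (auto simp: cong_def even_iff_mod_2_eq_zero odd_iff_mod_2_eq_one)
    \<comment> \<open>By parity the square \<open>u2\<close> has mass at the coordinate half turns,
      so none at the identity, and the fibre over the identity of \<open>s3\<close> gives this mass
      the value 1. Trace 3 then forces the values -2 and 2 at the two remaining classes over
      transpositions, and the twisted trace becomes -5, below its bound.\<close>
    have no_neg: False
      if tr: "trace y \<noteq> 0" and neg: "3 * type_sum u 3 3 - type_sum u 3 (- 1) - type_sum u 1 (- 1) + type_sum u 1 1 = - 3"
        and odd: "odd (type_sum u 1 1)"
    proof -
      have "odd (type_sum u2 3 (- 1))" using par odd by simp
      then have "type_sum u2 3 3 = 0" using u2_one by fastforce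
      moreover have "trace (y ** y) = 3" using s3_traces(2)[OF yc] tr by simp
      ultimately have "type_sum u2 3 (- 1) = 1" "type_sum u2 1 (- 1) + type_sum u2 1 1 = 0" "type_sum u2 3 3 = 0"
        using fib3[OF y2] fib1[OF y2] by simp_all
      then show False using T1_neg[OF neg] T2_gt[OF u2] by linarith
    qed
    have main: "(type_sum u 3 (- 1), type_sum u 0 0, type_sum u 1 (- 1), type_sum u 1 1)
        \<in> {(1, 0, 0, 0), (0, 1, 0, 0), (0, 0, 1, 0), (0, 0, 0, 1)}"
    proof -
      consider "trace y = 3" | "trace y = 0" | "trace y = 1" using s3_traces(1)[OF yc] by blast
      then show ?thesis
      proof cases
        case 1
        then have *: "type_sum u 3 (- 1) = 1" "type_sum u 0 0 = 0" "type_sum u 1 1 = - type_sum u 1 (- 1)"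
          using fib3[OF y] fib0[OF y] fib1[OF y] z by simp_all
        \<comment> \<open>The standard trace gives the upper bound and the twisted trace the lower
          one; the strictness of the latter removes the value -1.\<close>
        then have "type_sum u 1 (- 1) = 0 \<or> type_sum u 1 (- 1) = 1" using T1_ge[OF u] T2_gt[OF u] z by linarith
        moreover have "type_sum u 1 (- 1) \<noteq> 1" using no_neg * z 1 by auto
        ultimately show ?thesis using * by simp
      next
        case 2
        then have *: "type_sum u 3 (- 1) = 0" "type_sum u 0 0 = 1" "type_sum u 1 1 = - type_sum u 1 (- 1)"
          using fib3[OF y] fib0[OF y] fib1[OF y] z by simp_all
        have "trace (y ** y) = 0" using s3_traces(2)[OF yc] 2 by simp
        then have "type_sum u2 3 3 + type_sum u2 3 (- 1) = 0" using fib3[OF y2] by simp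
        then have "type_sum u2 3 (- 1) = 0" using u2_one by force
        then have "even (type_sum u 1 (- 1))" using par * by simp
        moreover have "- 2 < type_sum u 1 (- 1)" "type_sum u 1 (- 1) < 2" using T1_ge[OF u] T2_gt[OF u] * z by linarith+
        ultimately have "type_sum u 1 (- 1) = 0" by presburger
        then show ?thesis using * by simp
      next
        case 3
        then have *: "type_sum u 3 (- 1) = 0" "type_sum u 0 0 = 0" "type_sum u 1 1 = 1 - type_sum u 1 (- 1)"
          using fib3[OF y] fib0[OF y] fib1[OF y] z by simp_all
        then have "type_sum u 1 (- 1) = 0 \<or> type_sum u 1 (- 1) = 1 \<or> type_sum u 1 (- 1) = 2" using T1_ge[OF u] T2_gt[OF u] z by linarith
        moreover have "type_sum u 1 (- 1) \<noteq> 2" using no_neg * z 3 by auto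
        ultimately show ?thesis using * by auto
      qed
    qed
    define g :: "real^3^3" where "g = (if type_sum u 3 (- 1) = 1 then m9 1 0 0 0 (- 1) 0 0 0 (- 1)
      else if type_sum u 0 0 = 1 then m9 0 1 0 0 0 1 1 0 0
      else if type_sum u 1 1 = 1 then m9 1 0 0 0 0 1 0 (- 1) 0 else m9 (- 1) 0 0 0 0 1 0 1 0)"
    have g: "g \<in> oct" by (simp add: g_def m9_in_oct m9_simps)
    have "class_sum (mat_group oct) u h = (if h \<in> conj_class (mat_group oct) g then 1 else 0)" if h: "h \<in> oct" for h
      unfolding cls[OF h] oct_conj_class[OF g] using main z oct_types(1)[OF h] h
      by (auto simp: g_def m9_simps mabs_m9)
    then show ?thesis using g by (auto simp: aug_at_def)
  qed
qed

lemma (in fin_hom) trivial_augs_iso: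
  assumes inj: "inj_on \<phi> (carrier G)" and surj: "\<phi> ` carrier G = carrier H" and H: "trivial_augs H"
  shows "trivial_augs G"
proof (rule trivial_augs_lift[OF H])
  fix x y assume x: "x \<in> carrier G" and y: "y \<in> carrier G" and "\<phi> y \<in> conj_class H (\<phi> x)"
  then obtain q where q: "q \<in> carrier H" "\<phi> y = q \<otimes>\<^bsub>H\<^esub> \<phi> x \<otimes>\<^bsub>H\<^esub> inv\<^bsub>H\<^esub> q" by (auto simp: conj_class_def)
  then obtain t where t: "t \<in> carrier G" "q = \<phi> t" using surj by blast
  have "\<phi> y = \<phi> (t \<otimes>\<^bsub>G\<^esub> x \<otimes>\<^bsub>G\<^esub> inv\<^bsub>G\<^esub> t)" using q t x by simp
  then have "y = t \<otimes>\<^bsub>G\<^esub> x \<otimes>\<^bsub>G\<^esub> inv\<^bsub>G\<^esub> t" using inj_onD[OF inj] x y t by simp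
  then show "y \<in> conj_class G x" using t by (auto simp: conj_class_def)
qed

section \<open>Rotations\<close>

definition cq :: "real^3^3 \<Rightarrow> real^3^3 \<Rightarrow> real^3^3" where
  "cq Q A = transpose Q ** A ** Q"

lemma orthogonal_matrixD:
  assumes "orthogonal_matrix (Q::real^'n^'n)"
  shows "transpose Q ** Q = mat 1" "Q ** transpose Q = mat 1"
  using assms by (auto simp: orthogonal_matrix_def)

lemma mat_vec_minus: "A *v (- x) = - (A *v x)" for A :: "real^'n^'m"
  by (simp add: vec_eq_iff matrix_vector_mult_def sum_negf)

lemma mat_diff_right: "A ** (B - C) = A ** B - A ** C" for A :: "real^'n^'m"
  by (simp add: vec_eq_iff matrix_matrix_mult_def sum_subtractf algebra_simps)

lemma cq_mult: "orthogonal_matrix Q \<Longrightarrow> cq Q (A ** B) = cq Q A ** cq Q B"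
proof -
  assume Q: "orthogonal_matrix Q"
  have "cq Q A ** cq Q B = transpose Q ** A ** (Q ** transpose Q) ** B ** Q" by (simp add: cq_def matrix_mul_assoc)
  then show ?thesis by (simp add: orthogonal_matrixD(2)[OF Q] cq_def matrix_mul_assoc)
qed

lemma cq_inverse: "orthogonal_matrix Q \<Longrightarrow> Q ** cq Q A ** transpose Q = A"
proof -
  assume Q: "orthogonal_matrix Q"
  have "Q ** cq Q A ** transpose Q = (Q ** transpose Q) ** A ** (Q ** transpose Q)" by (simp add: cq_def matrix_mul_assoc)
  then show ?thesis by (simp add: orthogonal_matrixD(2)[OF Q])
qed

lemma cq_inj: "orthogonal_matrix Q \<Longrightarrow> cq Q A = cq Q B \<Longrightarrow> A = B"
  using cq_inverse by metis

lemma cq_one: "orthogonal_matrix Q \<Longrightarrow> cq Q (mat 1) = mat 1"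
  by (simp add: cq_def orthogonal_matrixD)

lemma cq_transpose: "cq Q (transpose A) = transpose (cq Q A)"
  by (simp add: cq_def matrix_transpose_mul matrix_mul_assoc)

lemma cq_trace: "orthogonal_matrix Q \<Longrightarrow> trace (cq Q A) = trace A"
  unfolding cq_def by (rule trace_similar) (rule orthogonal_matrixD)

lemma cq_vector: "orthogonal_matrix Q \<Longrightarrow> cq Q A *v x = transpose Q *v (A *v (Q *v x))"
  by (simp only: cq_def matrix_vector_mul_assoc matrix_mul_assoc)

lemma transpose_vector: "orthogonal_matrix Q \<Longrightarrow> transpose Q *v (Q *v x) = x" "orthogonal_matrix Q \<Longrightarrow> Q *v (transpose Q *v x) = x"
  for Q :: "real^'n^'n"
  by (simp_all only: matrix_vector_mul_assoc orthogonal_matrixD matrix_vector_mul_lid)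

lemma cq_rotation: "orthogonal_matrix Q \<Longrightarrow> rotation_matrix A \<Longrightarrow> rotation_matrix (cq Q A)"
proof -
  assume Q: "orthogonal_matrix Q" and A: "rotation_matrix A"
  have "det (transpose Q) * det Q = 1" using orthogonal_matrixD(1)[OF Q] by (metis det_I det_mul)
  moreover have "det (cq Q A) = (det (transpose Q) * det Q) * det A" by (simp add: cq_def det_mul)
  ultimately show ?thesis
    using Q A by (simp add: rotation_matrix_def) (simp add: cq_def orthogonal_matrix_mul orthogonal_matrix_transpose)
qed

lemma rotation_inner: "rotation_matrix A \<Longrightarrow> (A *v x) \<bullet> (A *v y) = x \<bullet> y" for A :: "real^'n^'n"
proof -
  assume "rotation_matrix A"
  then have "(A *v x) v* A = x"
    using transpose_vector(1)[of A x] by (simp add: rotation_matrix_def transpose_matrix_vector)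
  then show ?thesis by (simp add: dot_lmul_matrix[symmetric])
qed

lemma rotation_norm: "rotation_matrix A \<Longrightarrow> norm (A *v x) = norm x" for A :: "real^'n^'n"
  by (simp add: norm_eq_sqrt_inner rotation_inner)

text \<open>Rotation about the first axis with cosine \<open>e\<close> and sine \<open>f\<close>,
  once \<open>e*e + f*f = 1\<close>.\<close>

definition rz :: "real \<Rightarrow> real \<Rightarrow> real^3^3" where
  "rz e f = m9 1 0 0 0 e f 0 (- f) e"

text \<open>Under the same condition, a half turn about an axis orthogonal to the first one; it
  reverses the first axis.\<close>

definition fl :: "real \<Rightarrow> real \<Rightarrow> real^3^3" where
  "fl e f = m9 (- 1) 0 0 0 e f 0 f (- e)"

lemma m9_vector_e1: "m9 a b c d e f g h i *v axis 1 1 = vector [a, d, g]" for a :: real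
  by (simp add: vec_eq_iff forall_3 vector_3 matrix_vector_mult_def sum_3 axis_def)

lemma m9_vector: "(m9 a b c d e f g h i *v x) = vector [a * x$1 + b * x$2 + c * x$3, d * x$1 + e * x$2 + f * x$3, g * x$1 + h * x$2 + i * x$3]" for a :: real
  by (simp add: vec_eq_iff forall_3 vector_3 matrix_vector_mult_def sum_3)

lemma rotation_m9:
  assumes "rotation_matrix (m9 a b c d e f g h (i::real))"
  shows "a*a + b*b + c*c = 1" "d*d + e*e + f*f = 1" "g*g + h*h + i*i = 1" "a*d + b*e + c*f = 0" "a*g + b*h + c*i = 0" "d*g + e*h + f*i = 0"
    "a*e*i + b*f*g + c*d*h - a*f*h - b*d*i - c*e*g = 1"
  using rotation_matrixD(2,3)[OF assms] by (simp_all add: m9_simps)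

lemma rotation_fix_e1:
  assumes A: "rotation_matrix A" and fx: "A *v axis 1 1 = axis 1 1"
  obtains e f where "A = rz e f" "e*e + f*f = 1"
proof -
  obtain a b c d e f g h i where A9: "A = m9 a b c d e f g h i" using m9_collapse by blast
  have adg: "a = 1" "d = 0" "g = 0"
    using fx unfolding A9 m9_vector_e1 by (auto simp: vec_eq_iff forall_3 vector_3 axis_def)
  note r = rotation_m9[OF A[unfolded A9], unfolded adg, simplified]
  have bc: "b = 0" "c = 0" using r(1) by simp_all
  \<comment> \<open>The left side is the sum of two squared row norms minus twice the
    determinant.\<close>
  have "(e - i)*(e - i) + (f + h)*(f + h) = 0"
    using r bc by (simp add: algebra_simps)
  then have "i = e" "h = - f" by (simp_all add: sum_squares_eq_zero_iff)
  then show thesis using that[of e f] r bc A9 adg by (simp add: rz_def)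
qed

lemma rotation_flip_e1:
  assumes A: "rotation_matrix A" and fx: "A *v axis 1 1 = - axis 1 1"
  obtains e f where "A = fl e f" "e*e + f*f = 1"
proof -
  obtain a b c d e f g h i where A9: "A = m9 a b c d e f g h i" using m9_collapse by blast
  have adg: "a = - 1" "d = 0" "g = 0"
    using fx unfolding A9 m9_vector_e1 by (auto simp: vec_eq_iff forall_3 vector_3 axis_def)
  note r = rotation_m9[OF A[unfolded A9], unfolded adg, simplified]
  have bc: "b = 0" "c = 0" using r(1) by simp_all
  have "(e + i)*(e + i) + (f - h)*(f - h) = 0"
    using r bc by (simp add: algebra_simps)
  then have "i = - e" "h = f" by (simp_all add: sum_squares_eq_zero_iff)
  then show thesis using that[of e f] r bc A9 adg by (simp add: fl_def)
qed

text \<open>With determinant 1 and odd dimension, \<open>det (A - mat 1)\<close> equals its own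
  negative.\<close>

lemma rotation_has_axis:
  assumes A: "rotation_matrix (A::real^3^3)"
  obtains w where "norm w = 1" "A *v w = w"
proof -
  have "det (A - mat 1) = det (A ** (mat 1 - transpose A))"
    using rotation_matrixD(2)[OF A] by (simp add: mat_diff_right)
  also have "\<dots> = det (mat 1 - transpose A)" by (simp only: det_mul rotation_matrixD(3)[OF A] mult_1_left)
  also have "mat 1 - transpose A = transpose (mat 1 - A)" by (auto simp: vec_eq_iff transpose_def mat_def)
  also have "det (transpose (mat 1 - A)) = det (mat 1 - A)" by (rule det_transpose)
  also have "mat 1 - A = - (A - mat 1)" by simp
  also have "det (- (A - mat 1)) = - det (A - mat 1)"
  proof -
    have "det (- X) = - det X" for X :: "real^3^3" by (simp add: det_3)
    then show ?thesis .
  qed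
  finally have "det (A - mat 1) = 0" by simp
  then have "\<not> (\<exists>B. B ** (A - mat 1) = mat 1)"
    by (metis det_I det_mul mult_zero_right zero_neq_one)
  then obtain x where x: "(A - mat 1) *v x = 0" "x \<noteq> 0" unfolding matrix_left_invertible_ker by blast
  have Ax: "A *v x = x" using x(1) by (simp add: matrix_vector_mult_diff_rdistrib)
  show thesis
  proof (rule that)
    show "norm (x /\<^sub>R norm x) = 1" using x by simp
    show "A *v (x /\<^sub>R norm x) = x /\<^sub>R norm x" using Ax by (simp add: matrix_vector_mult_scaleR)
  qed
qed

lemma rotate_to_e1:
  assumes "norm (w::real^3) = 1"
  obtains Q where "orthogonal_matrix Q" "Q *v axis 1 1 = w"
  using orthogonal_matrix_exists_basis[OF assms, of 1] by blast

lemma cq_fix_e1: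
  assumes "orthogonal_matrix Q" "Q *v axis 1 1 = w" "A *v w = w"
  shows "cq Q A *v axis 1 1 = axis 1 1"
  using assms transpose_vector(1)[of Q "axis 1 1"] by (simp add: cq_vector)

lemma cq_flip_e1:
  assumes "orthogonal_matrix Q" "Q *v axis 1 1 = w" "A *v w = - w"
  shows "cq Q A *v axis 1 1 = - axis 1 1"
  using assms transpose_vector(1)[of Q "axis 1 1"] by (simp add: cq_vector mat_vec_minus)

lemma rotation_fixed_line:
  fixes A :: "real^3^3"
  assumes A: "rotation_matrix A" "A \<noteq> mat 1" and w: "A *v w = w" "norm w = 1" and x: "A *v x = x"
  obtains c where "x = c *\<^sub>R w"
proof -
  obtain Q where Q: "orthogonal_matrix Q" "Q *v axis 1 1 = w" using rotate_to_e1[OF w(2)] .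
  obtain e f where ef: "cq Q A = rz e f" "e*e + f*f = 1"
    using rotation_fix_e1[OF cq_rotation[OF Q(1) A(1)] cq_fix_e1[OF Q w(1)]] .
  have "e \<noteq> 1"
  proof
    assume "e = 1"
    then have "cq Q A = mat 1" using ef by (simp add: rz_def m9_one)
    then show False using A(2) cq_inj[OF Q(1), of A "mat 1"] cq_one[OF Q(1)] by simp
  qed
  define y where "y = transpose Q *v x"
  have "rz e f *v y = y" by (simp only: ef(1)[symmetric] cq_vector[OF Q(1)] y_def transpose_vector(2)[OF Q(1)] x)
  then have eqs: "e * y$2 + f * y$3 = y$2" "e * y$3 - f * y$2 = y$3"
    unfolding rz_def m9_vector by (simp_all add: vec_eq_iff forall_3 vector_3)
  \<comment> \<open>Cramer's rule for the plane orthogonal to the axis; the determinant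
    \<open>(e - 1)*(e - 1) + f*f\<close> vanishes only for the identity.\<close>
  define p q where "p = (e - 1) * y$2 + f * y$3" and "q = (e - 1) * y$3 - f * y$2"
  have "p = 0" "q = 0" using eqs by (simp_all add: p_def q_def algebra_simps)
  moreover have "(e - 1) * p - f * q = ((e - 1)*(e - 1) + f*f) * y$2" "f * p + (e - 1) * q = ((e - 1)*(e - 1) + f*f) * y$3"
    by (simp_all add: p_def q_def algebra_simps)
  moreover have "(e - 1)*(e - 1) + f*f \<noteq> 0" using \<open>e \<noteq> 1\<close> by (simp add: sum_squares_eq_zero_iff)
  ultimately have "y$2 = 0" "y$3 = 0" by auto
  then have "y = (y$1) *\<^sub>R axis 1 1" by (simp add: vec_eq_iff forall_3 axis_def)
  then have "Q *v y = (y$1) *\<^sub>R w" using Q(2) by (metis matrix_vector_mult_scaleR)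
  moreover have "Q *v y = x" by (simp only: y_def transpose_vector(2)[OF Q(1)])
  ultimately show thesis using that by metis
qed

lemma rz_simps: "rz e f ** rz e' f' = rz (e*e' - f*f') (e*f' + f*e')" "transpose (rz e f) = rz e (- f)" "trace (rz e f) = 1 + 2 * e"
  "fl e f ** rz e' f' = rz e' (- f') ** fl e f" "rz e f = rz e' f' \<longleftrightarrow> e = e' \<and> f = f'" "rz 1 0 = mat 1" "trace (fl e f) = - 1"
  by (auto simp: rz_def fl_def m9_simps algebra_simps)

text \<open>Integrality is required of traces only, because this is what survives the passage to an
  orthonormal basis.\<close>

locale rot_group =
  fixes R :: "(real^3^3) set"
  assumes finR: "finite R" and oneR: "mat 1 \<in> R" and multR: "A \<in> R \<Longrightarrow> B \<in> R \<Longrightarrow> A ** B \<in> R"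
    and transR: "A \<in> R \<Longrightarrow> transpose A \<in> R" and rotR: "A \<in> R \<Longrightarrow> rotation_matrix A"
    and intR: "A \<in> R \<Longrightarrow> trace A \<in> \<int>"

sublocale rot_group \<subseteq> fin_group "mat_group R"
  by (rule fin_group_mat_group) (use finR oneR multR transR rotR rotation_matrixD in blast)+

context rot_group
begin

lemma inv_transpose: "A \<in> R \<Longrightarrow> inv\<^bsub>mat_group R\<^esub> A = transpose A"
  using inv_equality[of "transpose A" A] rotation_matrixD(1)[OF rotR] transR by simp

lemma rot_group_cq:
  assumes Q: "orthogonal_matrix Q"
  shows "rot_group (cq Q ` R)"
proof
  show "mat 1 \<in> cq Q ` R" using oneR cq_one[OF Q] by (metis image_eqI)
  show "A ** B \<in> cq Q ` R" if "A \<in> cq Q ` R" "B \<in> cq Q ` R" for A B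
    using that by (auto simp: cq_mult[OF Q, symmetric] intro: multR)
  show "transpose A \<in> cq Q ` R" if "A \<in> cq Q ` R" for A
    using that by (auto simp: cq_transpose[symmetric] intro: transR)
qed (use finR rotR intR in \<open>auto simp: cq_rotation[OF Q] cq_trace[OF Q]\<close>)

lemma trivial_augs_cq:
  assumes Q: "orthogonal_matrix Q" and T: "trivial_augs (mat_group (cq Q ` R))"
  shows "trivial_augs (mat_group R)"
proof -
  interpret R': rot_group "cq Q ` R" using rot_group_cq[OF Q] .
  interpret h: fin_hom "mat_group R" "mat_group (cq Q ` R)" "cq Q"
    by unfold_locales (auto simp: hom_def cq_mult[OF Q])
  show ?thesis by (rule h.trivial_augs_iso) (use T cq_inj[OF Q] in \<open>auto intro: inj_onI\<close>)
qed

lemma rz_norm: "rz e f \<in> R \<Longrightarrow> e*e + f*f = 1"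
  using rotation_m9(2)[of 1 0 0 0 e f 0 "- f" e] rotR by (simp add: rz_def)

text \<open>The crystallographic restriction: twice the cosine is an integer of absolute value at
  most 2.\<close>

lemma rz_values:
  assumes "rz e f \<in> R"
  shows "(e = 1 \<and> f = 0) \<or> (e = - 1 \<and> f = 0) \<or> (e = 0 \<and> (f = 1 \<or> f = - 1)) \<or>
    ((e = 1/2 \<or> e = - 1/2) \<and> (f = sqrt 3 / 2 \<or> f = - (sqrt 3 / 2)))"
proof -
  have ef: "e*e + f*f = 1" using rz_norm[OF assms] .
  obtain k where "1 + 2 * e = of_int k" using intR[OF assms] unfolding rz_simps by (elim Ints_cases)
  then have e: "e = of_int (k - 1) / 2" by simp
  have "e*e \<le> 1" using ef by (metis le_add_same_cancel1 zero_le_square)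
  then have "\<bar>e\<bar> \<le> 1" using abs_square_le_1[of e] by (simp add: power2_eq_square)
  then have "\<bar>real_of_int (k - 1)\<bar> \<le> 2" unfolding e by simp
  then have "k - 1 = - 2 \<or> k - 1 = - 1 \<or> k - 1 = 0 \<or> k - 1 = 1 \<or> k - 1 = 2" by linarith
  then have es: "e = - 1 \<or> e = - 1/2 \<or> e = 0 \<or> e = 1/2 \<or> e = 1" unfolding e by auto
  have half: "f = sqrt 3 / 2 \<or> f = - (sqrt 3 / 2)" if "f*f = 3/4"
  proof -
    have "(f - sqrt 3 / 2) * (f + sqrt 3 / 2) = 0" using that by (simp add: algebra_simps)
    then show ?thesis by auto
  qed
  show ?thesis using es ef half by (auto simp: square_eq_1_iff simp del: eq_divide_eq_numeral1)
qed

text \<open>The product of a quarter turn with a turn of order three or six about the same axis has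
  a cosine whose square is 3/4, which the restriction forbids.\<close>

lemma rz_incompatible:
  assumes "rz 0 f \<in> R" "rz e' f' \<in> R"
  shows "e' \<noteq> 1/2" "e' \<noteq> - 1/2"
proof -
  have False if e': "e' = 1/2 \<or> e' = - 1/2"
  proof -
    have f: "f*f = 1" "f'*f' = 3/4" using rz_norm[OF assms(1)] rz_norm[OF assms(2)] e' by (auto simp del: eq_divide_eq_numeral1)
    define p where "p = - (f*f')"
    have "rz p (f*e') \<in> R" using multR[OF assms] by (simp add: rz_simps p_def)
    then have "p = 1 \<or> p = - 1 \<or> p = 0 \<or> p = 1/2 \<or> p = - 1/2" using rz_values by blast
    moreover have "p*p = (f*f)*(f'*f')" by (simp add: p_def)
    then have "p*p = 3/4" using f by simp
    ultimately show False by (auto simp del: eq_divide_eq_numeral1)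
  qed
  then show "e' \<noteq> 1/2" "e' \<noteq> - 1/2" by auto
qed

lemma trivial_augs_fix_e1:
  assumes line: "\<And>A. A \<in> R \<Longrightarrow> A *v axis 1 1 = axis 1 1 \<or> A *v axis 1 1 = - axis 1 1"
  shows "trivial_augs (mat_group R)"
proof (rule trivial_augs_dihedral[of "{A\<in>R. A *v axis 1 1 = axis 1 1}"])
  let ?A = "{A\<in>R. A *v axis 1 1 = axis 1 1}"
  have rz: "\<exists>e f. A = rz e f" if "A \<in> ?A" for A using rotation_fix_e1[of A] rotR that by blast
  have fl: "\<exists>e f. A = fl e f" if "A \<in> carrier (mat_group R) - ?A" for A
    using rotation_flip_e1[of A] rotR line that by force
  show "subgroup ?A (mat_group R)"
  proof (rule subgroupI)
    have "mat 1 \<in> ?A" using oneR by simp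
    then show "?A \<noteq> {}" by blast
    fix A assume A: "A \<in> ?A"
    have "transpose A *v axis 1 1 = axis 1 1"
      using transpose_vector(1)[of A "axis 1 1"] A rotR by (simp add: rotation_matrix_def)
    then show "inv\<^bsub>mat_group R\<^esub> A \<in> ?A" using A transR by (simp add: inv_transpose)
    fix B assume "B \<in> ?A"
    then show "A \<otimes>\<^bsub>mat_group R\<^esub> B \<in> ?A" using A multR by (simp add: matrix_vector_mul_assoc[symmetric])
  qed auto
  show "A \<otimes>\<^bsub>mat_group R\<^esub> B = B \<otimes>\<^bsub>mat_group R\<^esub> A" if AB: "A \<in> ?A" "B \<in> ?A" for A B
    using rz[OF AB(1)] rz[OF AB(2)] by (auto simp: rz_simps algebra_simps)
  show "S \<otimes>\<^bsub>mat_group R\<^esub> A \<otimes>\<^bsub>mat_group R\<^esub> inv\<^bsub>mat_group R\<^esub> S = inv\<^bsub>mat_group R\<^esub> A"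
    if SA: "S \<in> carrier (mat_group R) - ?A" "A \<in> ?A" for S A
  proof -
    obtain e f e' f' where forms: "S = fl e f" "A = rz e' f'" using fl[OF SA(1)] rz[OF SA(2)] by blast
    have "S ** A = transpose A ** S" unfolding forms by (simp add: rz_simps)
    then have "S ** A ** transpose S = transpose A ** (S ** transpose S)" by (simp add: matrix_mul_assoc)
    also have "S ** transpose S = mat 1" using SA rotR rotation_matrixD by auto
    finally show ?thesis using SA by (simp add: inv_transpose)
  qed
  show "S \<otimes>\<^bsub>mat_group R\<^esub> T \<in> ?A" if "S \<in> carrier (mat_group R) - ?A" "T \<in> carrier (mat_group R) - ?A" for S T
  proof -
    have "S *v axis 1 1 = - axis 1 1" "T *v axis 1 1 = - axis 1 1" using line that by auto
    then have "(S ** T) *v axis 1 1 = axis 1 1"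
      by (simp add: matrix_vector_mul_assoc[symmetric] mat_vec_minus)
    then show ?thesis using that multR by simp
  qed
  show "card ((\<lambda>A. A \<otimes>\<^bsub>mat_group R\<^esub> A) ` ?A) \<le> 3"
  proof -
    \<comment> \<open>A quarter turn about the axis excludes orders three and six and leaves two
      squares; without quarter turns every square has order one or three.\<close>
    have sub: "(\<lambda>A. A \<otimes>\<^bsub>mat_group R\<^esub> A) ` ?A \<subseteq> {rz 1 0, rz (- 1) 0} \<or>
        (\<lambda>A. A \<otimes>\<^bsub>mat_group R\<^esub> A) ` ?A \<subseteq> {rz 1 0, rz (- 1/2) (sqrt 3 / 2), rz (- 1/2) (- (sqrt 3 / 2))}"
    proof (cases "\<exists>f. rz 0 f \<in> R")
      case True
      then obtain f where f: "rz 0 f \<in> R" by blast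
      have "A ** A \<in> {rz 1 0, rz (- 1) 0}" if A: "A \<in> ?A" for A
      proof -
        obtain e' f' where "A = rz e' f'" using rz[OF A] by blast
        then show ?thesis using rz_values[of e' f'] rz_incompatible[OF f, of e' f'] A by (auto simp: rz_simps simp del: eq_divide_eq_numeral1)
      qed
      then show ?thesis by auto
    next
      case False
      have "A ** A \<in> {rz 1 0, rz (- 1/2) (sqrt 3 / 2), rz (- 1/2) (- (sqrt 3 / 2))}" if A: "A \<in> ?A" for A
      proof -
        obtain e' f' where "A = rz e' f'" using rz[OF A] by blast
        then show ?thesis using rz_values[of e' f'] False A by (auto simp: rz_simps simp del: eq_divide_eq_numeral1)
      qed
      then show ?thesis by auto
    qed
    have c3: "card {a, b, c} \<le> 3" for a b c :: "real^3^3" by (simp add: card_insert_if)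
    have c2: "card {a, b} \<le> 3" for a b :: "real^3^3" by (simp add: card_insert_if)
    show ?thesis using sub
    proof
      assume "(\<lambda>A. A \<otimes>\<^bsub>mat_group R\<^esub> A) ` ?A \<subseteq> {rz 1 0, rz (- 1) 0}"
      then show ?thesis by (rule le_trans[OF card_mono[rotated] c2]) simp
    next
      assume "(\<lambda>A. A \<otimes>\<^bsub>mat_group R\<^esub> A) ` ?A \<subseteq> {rz 1 0, rz (- 1/2) (sqrt 3 / 2), rz (- 1/2) (- (sqrt 3 / 2))}"
      then show ?thesis by (rule le_trans[OF card_mono[rotated] c3]) simp
    qed
  qed
qed

lemma trivial_augs_reducible:
  assumes v: "norm v = 1" and line: "\<And>A. A \<in> R \<Longrightarrow> A *v v = v \<or> A *v v = - v"
  shows "trivial_augs (mat_group R)"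
proof -
  obtain Q where Q: "orthogonal_matrix Q" "Q *v axis 1 1 = v" using rotate_to_e1[OF v] .
  interpret R': rot_group "cq Q ` R" using rot_group_cq[OF Q(1)] .
  have "trivial_augs (mat_group (cq Q ` R))"
    by (rule R'.trivial_augs_fix_e1) (use line cq_fix_e1[OF Q] cq_flip_e1[OF Q] in blast)
  then show ?thesis by (rule trivial_augs_cq[OF Q(1)])
qed

end

section \<open>Rotation groups without an invariant line\<close>

locale irr_rot_group = rot_group +
  assumes irr: "norm v = 1 \<Longrightarrow> \<exists>A\<in>R. A *v v \<noteq> v \<and> A *v v \<noteq> - v"
begin

lemma no_stable_line:
  assumes w: "w \<noteq> 0" and st: "\<And>A. A \<in> R \<Longrightarrow> \<exists>c. A *v w = c *\<^sub>R w"
  shows False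
proof -
  have "A *v w = w \<or> A *v w = - w" if A: "A \<in> R" for A
  proof -
    obtain c where c: "A *v w = c *\<^sub>R w" using st[OF A] by blast
    have "\<bar>c\<bar> * norm w = norm w" using rotation_norm[OF rotR[OF A], of w] c by simp
    then have "c = 1 \<or> c = - 1" using w by auto
    then show ?thesis using c by auto
  qed
  then have "A *v (w /\<^sub>R norm w) = w /\<^sub>R norm w \<or> A *v (w /\<^sub>R norm w) = - (w /\<^sub>R norm w)" if "A \<in> R" for A
    using that unfolding matrix_vector_mult_scaleR scaleR_minus_right[symmetric] by metis
  moreover have "norm (w /\<^sub>R norm w) = 1" using w by simp
  ultimately show False using irr by blast
qed

text \<open>A nonzero sum over the group would be a fixed vector and span a stable line.\<close>

lemma sum_vector_zero: "(\<Sum>A\<in>R. A *v y) = 0"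
proof (rule ccontr)
  assume nz: "(\<Sum>A\<in>R. A *v y) \<noteq> 0"
  have "B *v (\<Sum>A\<in>R. A *v y) = (\<Sum>A\<in>R. A *v y)" if B: "B \<in> R" for B
  proof -
    have "B *v (\<Sum>A\<in>R. A *v y) = (\<Sum>A\<in>R. (B ** A) *v y)"
      by (simp add: linear_sum[OF matrix_vector_mul_linear] matrix_vector_mul_assoc)
    then show ?thesis using sum_translate_left[of B "\<lambda>A. A *v y"] B by simp
  qed
  then show False using no_stable_line[OF nz] by (metis scaleR_one)
qed

lemma sum_trace: "(\<Sum>A\<in>R. trace A) = 0"
proof -
  have "(\<Sum>A\<in>R. A $ i $ i) = 0" for i
  proof -
    have "(\<Sum>A\<in>R. A *v axis i 1) $ i = 0" by (simp add: sum_vector_zero)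
    then show ?thesis by (simp add: matrix_vector_mult_basis column_def)
  qed
  then show ?thesis by (simp add: trace_def sum_3 sum.distrib)
qed

lemma nontrivial_axis:
  obtains A w where "A \<in> R" "A \<noteq> mat 1" "norm w = 1" "A *v w = w"
proof -
  obtain A where A: "A \<in> R" "A *v axis 1 1 \<noteq> axis 1 1" using irr[of "axis 1 1"] by auto
  then show thesis using rotation_has_axis[OF rotR[OF A(1)]] that by (metis matrix_vector_mul_lid)
qed

text \<open>Schur's lemma over the reals, where a commuting matrix may lack eigenvectors in general.
  Here it preserves the axis \<open>w\<close> of a nontrivial rotation, which gives an eigenvalue
  \<open>c\<close>. If \<open>N = Z - c\<close> were nonzero, its kernel would be the line of
  \<open>w\<close> or contain a plane; both cases lead to a stable line.\<close>

lemma commutant_scalar: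
  assumes Z: "\<And>A. A \<in> R \<Longrightarrow> A ** Z = Z ** A"
  obtains c where "\<And>x. Z *v x = c *\<^sub>R x"
proof -
  obtain A w where A: "A \<in> R" "A \<noteq> mat 1" and w: "norm w = 1" "A *v w = w" using nontrivial_axis .
  have comm: "B *v (Z *v x) = Z *v (B *v x)" if "B \<in> R" for B x
    using Z[OF that] by (simp add: matrix_vector_mul_assoc)
  have "A *v (Z *v w) = Z *v w" using comm[OF A(1), of w] w by simp
  then obtain c where c: "Z *v w = c *\<^sub>R w" using rotation_fixed_line[OF rotR[OF A(1)] A(2) w(2,1)] by blast
  define N where "N = Z - c *\<^sub>R mat 1"
  have N: "N *v x = Z *v x - c *\<^sub>R x" for x
    by (simp add: N_def matrix_vector_mult_diff_rdistrib scaleR_matrix_vector_assoc[symmetric])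
  have Ncomm: "B *v (N *v x) = N *v (B *v x)" if "B \<in> R" for B x
    by (simp add: N matrix_vector_mult_diff_distrib comm[OF that] matrix_vector_mult_scaleR)
  have Nw: "N *v w = 0" by (simp add: N c)
  have "N *v x = 0" for x
  proof (rule ccontr)
    assume x: "N *v x \<noteq> 0"
    show False
    proof (cases "\<forall>y. N *v y = 0 \<longrightarrow> (\<exists>k. y = k *\<^sub>R w)")
      case True
      have "N *v (B *v w) = 0" if "B \<in> R" for B using Ncomm[OF that, of w] Nw by simp
      then show False using True no_stable_line[of w] w(1) by (metis norm_zero zero_neq_one)
    next
      case False
      then obtain y where y: "N *v y = 0" "\<And>k. y \<noteq> k *\<^sub>R w" by blast
      \<comment> \<open>All rows of \<open>N\<close> are orthogonal to \<open>w\<close> and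
        \<open>y\<close>, hence multiples of \<open>n\<close>. So \<open>N\<close> has rank one, and
        its image is a stable line.\<close>
      define n where "n = cross3 w y"
      have "\<not> collinear {0, w, y}" using y(2) y(2)[of 0] w(1) by (auto simp: collinear_lemma)
      then have n: "n \<noteq> 0" by (simp add: n_def cross_eq_0)
      have "\<exists>k. N $ i = k *\<^sub>R n" for i
      proof -
        have "(N $ i) \<bullet> w = 0" "(N $ i) \<bullet> y = 0"
          using Nw y(1) by (metis matrix_vector_mul_component zero_index)+
        then have "cross3 n (N $ i) = 0"
          using Lagrange[of "N $ i" w y] cross_skew[of n "N $ i"] by (simp add: n_def)
        then have "collinear {0, n, N $ i}" by (simp add: cross_eq_0)
        then show ?thesis using n by (auto simp: collinear_lemma)
      qed
      then obtain k where k: "\<And>i. N $ i = k i *\<^sub>R n" by metis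
      define kv where "kv = (\<chi> i. k i)"
      have Nv: "N *v z = (n \<bullet> z) *\<^sub>R kv" for z
        by (simp add: vec_eq_iff matrix_vector_mul_component k kv_def)
      have kv: "kv \<noteq> 0" using x by (auto simp: Nv)
      have "B *v kv = ((n \<bullet> (B *v n)) / (n \<bullet> n)) *\<^sub>R kv" if B: "B \<in> R" for B
      proof -
        have "(n \<bullet> n) *\<^sub>R (B *v kv) = (n \<bullet> (B *v n)) *\<^sub>R kv"
          using Ncomm[OF B, of n] by (simp add: Nv matrix_vector_mult_scaleR)
        then have "(1 / (n \<bullet> n)) *\<^sub>R ((n \<bullet> n) *\<^sub>R (B *v kv)) = (1 / (n \<bullet> n)) *\<^sub>R ((n \<bullet> (B *v n)) *\<^sub>R kv)" by simp
        then show ?thesis using n by simp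
      qed
      then show False using no_stable_line[OF kv] by blast
    qed
  qed
  then show thesis using that[of c] by (simp add: N)
qed

text \<open>Schur orthogonality for products of diagonal entries, summed over all pairs of
  indices.\<close>

lemma sum_trace_squared: "(\<Sum>A\<in>R. (trace A)\<^sup>2) = card R"
proof -
  have ij: "(\<Sum>A\<in>R. A $ i $ i * A $ j $ j) = (if i = j then card R / 3 else 0)" for i j
  proof -
    \<comment> \<open>A group average of rank one maps, hence a scalar \<open>c\<close>. Its trace
      gives \<open>3 * c\<close>, and its coefficient at \<open>(i, j)\<close> is the required
      sum.\<close>
    define F where "F = (\<lambda>y. \<Sum>A\<in>R. ((A *v axis j 1) \<bullet> y) *\<^sub>R (A *v axis i (1::real)))"
    have lin: "linear F" unfolding F_def
      by (intro linearI) (simp_all add: inner_add_right scaleR_add_left sum.distrib scaleR_sum_right)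
    have FB: "F (B *v y) = B *v F y" if B: "B \<in> R" for B y
    proof -
      have "F (B *v y) = (\<Sum>A\<in>R. (((B ** A) *v axis j 1) \<bullet> (B *v y)) *\<^sub>R ((B ** A) *v axis i 1))"
        unfolding F_def using sum_translate_left[of B "\<lambda>A. ((A *v axis j 1) \<bullet> (B *v y)) *\<^sub>R (A *v axis i 1)"] B by simp
      also have "\<dots> = B *v F y"
        unfolding F_def
        by (simp add: linear_sum[OF matrix_vector_mul_linear] matrix_vector_mul_assoc[symmetric]
            rotation_inner[OF rotR[OF B]] matrix_vector_mult_scaleR)
      finally show ?thesis .
    qed
    have MF: "matrix F *v y = F y" for y using fun_cong[OF matrix_vector_mul(2)[OF lin]] .
    have "B ** matrix F = matrix F ** B" if "B \<in> R" for B
      by (rule iffD2[OF matrix_eq]) (simp add: matrix_vector_mul_assoc[symmetric] MF FB[OF that])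
    then obtain c where "\<And>y. matrix F *v y = c *\<^sub>R y" using commutant_scalar by blast
    then have c: "F y = c *\<^sub>R y" for y by (simp add: MF)
    have comp: "x \<bullet> axis k 1 = x $ k" for x :: "real^3" and k by (simp add: inner_axis)
    have col: "(A *v axis l 1) $ k = A $ k $ l" for A :: "real^3^3" and k l
      by (simp add: matrix_vector_mult_basis column_def)
    have "(\<Sum>k\<in>UNIV. F (axis k 1) \<bullet> axis k 1) = 3 * c"
      by (simp add: c sum_3 inner_axis_axis)
    moreover have "(\<Sum>k\<in>UNIV. F (axis k 1) \<bullet> axis k 1) = (\<Sum>A\<in>R. (A *v axis j 1) \<bullet> (A *v axis i 1))"
    proof -
      have "F (axis k 1) \<bullet> axis k 1 = (\<Sum>A\<in>R. (A *v axis j 1) $ k * (A *v axis i 1) $ k)" for k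
        by (simp add: F_def comp)
      then have "(\<Sum>k\<in>UNIV. F (axis k 1) \<bullet> axis k 1) = (\<Sum>k\<in>UNIV. \<Sum>A\<in>R. (A *v axis j 1) $ k * (A *v axis i 1) $ k)"
        by simp
      also have "\<dots> = (\<Sum>A\<in>R. \<Sum>k\<in>UNIV. (A *v axis j 1) $ k * (A *v axis i 1) $ k)" by (rule sum.swap)
      finally show ?thesis by (simp add: inner_vec_def)
    qed
    moreover have "\<dots> = card R * (axis j (1::real) \<bullet> axis i (1::real) :: real)"
      using rotation_inner[OF rotR] by simp
    ultimately have "3 * c = (if i = j then card R else 0)" by (auto simp: inner_axis_axis split: if_splits)
    moreover have "F (axis j 1) \<bullet> axis i 1 = (\<Sum>A\<in>R. A $ i $ i * A $ j $ j)"
      by (simp add: F_def comp col mult.commute)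
    moreover have "F (axis j 1) \<bullet> axis i 1 = (if i = j then c else 0)" by (simp add: c inner_axis_axis)
    ultimately show ?thesis by auto
  qed
  have "(\<Sum>A\<in>R. (trace A)\<^sup>2) = (\<Sum>i\<in>UNIV. \<Sum>j\<in>UNIV. \<Sum>A\<in>R. A $ i $ i * A $ j $ j)"
    by (simp add: trace_def power2_eq_square sum_3 sum.distrib algebra_simps sum_distrib_left)
  then show ?thesis unfolding ij by (simp add: sum_3)
qed

lemma trace_values:
  assumes A: "A \<in> R"
  shows "trace A \<in> {3, - 1, 0, 1, 2}" "trace A = 3 \<longleftrightarrow> A = mat 1"
proof -
  obtain w where w: "norm w = 1" "A *v w = w" using rotation_has_axis[OF rotR[OF A]] .
  obtain Q where Q: "orthogonal_matrix Q" "Q *v axis 1 1 = w" using rotate_to_e1[OF w(1)] .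
  interpret R': rot_group "cq Q ` R" using rot_group_cq[OF Q(1)] .
  obtain e f where ef: "cq Q A = rz e f"
    using rotation_fix_e1[OF cq_rotation[OF Q(1) rotR[OF A]] cq_fix_e1[OF Q w(2)]] by blast
  have mem: "rz e f \<in> cq Q ` R" using A ef by (metis image_eqI)
  have tr: "trace A = 1 + 2 * e" using cq_trace[OF Q(1), of A] ef by (simp add: rz_simps)
  show "trace A \<in> {3, - 1, 0, 1, 2}" using R'.rz_values[OF mem] tr by (auto simp del: eq_divide_eq_numeral1)
  show "trace A = 3 \<longleftrightarrow> A = mat 1"
  proof
    assume "trace A = 3"
    then have "e = 1" using tr by simp
    then have "cq Q A = cq Q (mat 1)" using R'.rz_values[OF mem] ef cq_one[OF Q(1)] by (auto simp: rz_simps)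
    then show "A = mat 1" using cq_inj[OF Q(1)] by blast
  qed (simp add: m9_simps)
qed

lemma noncentral:
  assumes A: "A \<in> R" "A \<noteq> mat 1"
  shows "centr (mat_group R) A \<noteq> R"
proof
  assume c: "centr (mat_group R) A = R"
  obtain w where w: "norm w = 1" "A *v w = w" using rotation_has_axis[OF rotR[OF A(1)]] .
  have "\<exists>k. B *v w = k *\<^sub>R w" if B: "B \<in> R" for B
  proof -
    have "B ** A = A ** B" using B c by (auto simp: centr_def)
    then have "A *v (B *v w) = B *v w" using w by (metis matrix_vector_mul_assoc)
    then show ?thesis using rotation_fixed_line[OF rotR[OF A(1)] A(2) w(2,1)] by blast
  qed
  then show False using no_stable_line[of w] w(1) by force
qed

text \<open>A commuting rotation preserves the axis of \<open>A\<close>. If it reversed the axis it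
  would invert \<open>A\<close>, but \<open>A\<close> is not of order at most two by its
  trace.\<close>

lemma centr_axis:
  assumes A: "A \<in> R" and tr: "trace A \<noteq> 3" "trace A \<noteq> - 1"
  obtains Q e f where "orthogonal_matrix Q" "cq Q A = rz e f" "trace A = 1 + 2 * e"
    "\<And>B. B \<in> centr (mat_group R) A \<Longrightarrow> B \<in> R \<and> (\<exists>e' f'. cq Q B = rz e' f')"
proof -
  obtain w where w: "norm w = 1" "A *v w = w" using rotation_has_axis[OF rotR[OF A]] .
  obtain Q where Q: "orthogonal_matrix Q" "Q *v axis 1 1 = w" using rotate_to_e1[OF w(1)] .
  obtain e f where ef: "cq Q A = rz e f" "e*e + f*f = 1"
    using rotation_fix_e1[OF cq_rotation[OF Q(1) rotR[OF A]] cq_fix_e1[OF Q w(2)]] .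
  have te: "trace A = 1 + 2 * e" using cq_trace[OF Q(1), of A] ef by (simp add: rz_simps)
  have f0: "f \<noteq> 0" using ef(2) te tr by (auto simp: square_eq_1_iff)
  have A1: "A \<noteq> mat 1" using tr(1) by (auto simp: m9_simps)
  show thesis
  proof (rule that[OF Q(1) ef(1) te])
    fix B assume "B \<in> centr (mat_group R) A"
    then have B: "B \<in> R" "B ** A = A ** B" by (auto simp: centr_def)
    have "A *v (B *v w) = B *v w" using w B(2) by (metis matrix_vector_mul_assoc)
    then obtain k where k: "B *v w = k *\<^sub>R w" using rotation_fixed_line[OF rotR[OF A] A1 w(2,1)] by blast
    have "\<bar>k\<bar> = 1" using rotation_norm[OF rotR[OF B(1)], of w] k w(1) by simp
    then consider "B *v w = w" | "B *v w = - w" using k by (metis abs_if minus_equation_iff scaleR_minus1_left scaleR_one)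
    then show "B \<in> R \<and> (\<exists>e' f'. cq Q B = rz e' f')"
    proof cases
      case 1
      then show ?thesis
        using rotation_fix_e1[OF cq_rotation[OF Q(1) rotR[OF B(1)]] cq_fix_e1[OF Q 1]] B(1) by blast
    next
      case 2
      obtain e' f' where fl: "cq Q B = fl e' f'"
        using rotation_flip_e1[OF cq_rotation[OF Q(1) rotR[OF B(1)]] cq_flip_e1[OF Q 2]] by blast
      have "fl e' f' ** rz e f = rz e f ** fl e' f'" using B(2) cq_mult[OF Q(1)] by (metis ef(1) fl)
      then have "rz e (- f) ** fl e' f' = rz e f ** fl e' f'" by (simp add: rz_simps)
      then have "rz e (- f) ** fl e' f' ** transpose (fl e' f') = rz e f ** fl e' f' ** transpose (fl e' f')" by simp
      moreover have "fl e' f' ** transpose (fl e' f') = mat 1"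
        using rotation_matrixD(2)[OF cq_rotation[OF Q(1) rotR[OF B(1)]]] fl by simp
      ultimately have "rz e (- f) = rz e f" by (simp add: matrix_mul_assoc[symmetric])
      then show ?thesis using f0 by (simp add: rz_simps)
    qed
  qed
qed

text \<open>The centraliser consists of rotations about a single axis, so \<open>rz_values\<close>
  and \<open>rz_incompatible\<close> leave a short list of its elements.\<close>

lemma card_centr_le:
  assumes A: "A \<in> R"
  shows "trace A = 2 \<Longrightarrow> card (centr (mat_group R) A) \<le> 6"
    and "trace A = 1 \<Longrightarrow> card (centr (mat_group R) A) \<le> 4"
    and "trace A = 0 \<Longrightarrow> (\<And>B. B \<in> R \<Longrightarrow> trace B \<noteq> 2) \<Longrightarrow> card (centr (mat_group R) A) \<le> 3"
proof -
  let ?s = "sqrt 3 / 2"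
  have bound: "card (centr (mat_group R) A) \<le> length xs" if Q: "orthogonal_matrix Q" and sub: "cq Q ` centr (mat_group R) A \<subseteq> set xs" for Q xs
  proof -
    have "card (centr (mat_group R) A) = card (cq Q ` centr (mat_group R) A)"
      using cq_inj[OF Q] by (intro card_image[symmetric] inj_onI) blast
    also have "\<dots> \<le> card (set xs)" using sub by (intro card_mono) auto
    also have "\<dots> \<le> length xs" by (rule card_length)
    finally show ?thesis .
  qed
  have ax: "\<exists>Q e f. orthogonal_matrix Q \<and> rz e f \<in> cq Q ` R \<and> trace A = 1 + 2 * e \<and>
      (\<forall>B\<in>centr (mat_group R) A. \<exists>e' f'. cq Q B = rz e' f' \<and> rz e' f' \<in> cq Q ` R)" if "trace A \<noteq> 3" "trace A \<noteq> - 1"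
    using centr_axis[OF A that] A by (metis image_eqI)
  show "card (centr (mat_group R) A) \<le> 6" if tr: "trace A = 2"
  proof -
    obtain Q e f where Q: "orthogonal_matrix Q" "rz e f \<in> cq Q ` R" "trace A = 1 + 2 * e"
      and B: "\<forall>B\<in>centr (mat_group R) A. \<exists>e' f'. cq Q B = rz e' f' \<and> rz e' f' \<in> cq Q ` R" using ax tr by auto
    interpret R': rot_group "cq Q ` R" using rot_group_cq[OF Q(1)] .
    have e: "e = 1/2" using Q(3) tr by simp
    have "cq Q ` centr (mat_group R) A \<subseteq> set [rz 1 0, rz (- 1) 0, rz (1/2) ?s, rz (1/2) (- ?s), rz (- 1/2) ?s, rz (- 1/2) (- ?s)]"
    proof clarify
      fix B assume "B \<in> centr (mat_group R) A"
      then obtain e' f' where "cq Q B = rz e' f'" and mem: "rz e' f' \<in> cq Q ` R" using B by blast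
      moreover have "e' \<noteq> 0" using R'.rz_incompatible(1)[of f' e f] mem Q(2) e by auto
      ultimately show "cq Q B \<in> set [rz 1 0, rz (- 1) 0, rz (1/2) ?s, rz (1/2) (- ?s), rz (- 1/2) ?s, rz (- 1/2) (- ?s)]"
        using R'.rz_values[OF mem] by (auto simp: rz_simps(5) simp del: eq_divide_eq_numeral1)
    qed
    then show ?thesis using bound[OF Q(1)] by fastforce
  qed
  show "card (centr (mat_group R) A) \<le> 4" if tr: "trace A = 1"
  proof -
    obtain Q e f where Q: "orthogonal_matrix Q" "rz e f \<in> cq Q ` R" "trace A = 1 + 2 * e"
      and B: "\<forall>B\<in>centr (mat_group R) A. \<exists>e' f'. cq Q B = rz e' f' \<and> rz e' f' \<in> cq Q ` R" using ax tr by auto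
    interpret R': rot_group "cq Q ` R" using rot_group_cq[OF Q(1)] .
    have e: "e = 0" using Q(3) tr by simp
    have "cq Q ` centr (mat_group R) A \<subseteq> set [rz 1 0, rz (- 1) 0, rz 0 1, rz 0 (- 1)]"
    proof clarify
      fix B assume "B \<in> centr (mat_group R) A"
      then obtain e' f' where "cq Q B = rz e' f'" and mem: "rz e' f' \<in> cq Q ` R" using B by blast
      moreover have "e' \<noteq> 1/2" "e' \<noteq> - 1/2" using R'.rz_incompatible[of f e' f'] mem Q(2) e by auto
      ultimately show "cq Q B \<in> set [rz 1 0, rz (- 1) 0, rz 0 1, rz 0 (- 1)]"
        using R'.rz_values[OF mem] by (auto simp: rz_simps(5) simp del: eq_divide_eq_numeral1)
    qed
    then show ?thesis using bound[OF Q(1)] by fastforce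
  qed
  show "card (centr (mat_group R) A) \<le> 3" if tr: "trace A = 0" and no: "\<And>B. B \<in> R \<Longrightarrow> trace B \<noteq> 2"
  proof -
    obtain Q e f where Q: "orthogonal_matrix Q" "rz e f \<in> cq Q ` R" "trace A = 1 + 2 * e"
      and B: "\<forall>B\<in>centr (mat_group R) A. \<exists>e' f'. cq Q B = rz e' f' \<and> rz e' f' \<in> cq Q ` R" using ax tr by auto
    interpret R': rot_group "cq Q ` R" using rot_group_cq[OF Q(1)] .
    have e: "e = - 1/2" using Q(3) tr by simp
    have no': "rz (1/2) g \<notin> cq Q ` R" for g
    proof
      assume "rz (1/2) g \<in> cq Q ` R"
      then obtain C where C: "C \<in> R" "cq Q C = rz (1/2) g" by (metis imageE)
      have "trace C = 2" using cq_trace[OF Q(1), of C] C(2) by (simp add: rz_simps)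
      then show False using no C(1) by blast
    qed
    have "cq Q ` centr (mat_group R) A \<subseteq> set [rz 1 0, rz (- 1/2) ?s, rz (- 1/2) (- ?s)]"
    proof clarify
      fix B assume "B \<in> centr (mat_group R) A"
      then obtain e' f' where "cq Q B = rz e' f'" and mem: "rz e' f' \<in> cq Q ` R" using B by blast
      moreover have "e' \<noteq> 0" using R'.rz_incompatible(2)[of f' e f] mem Q(2) e by auto
      moreover have "e' \<noteq> 1/2" using no' mem by metis
      \<comment> \<open>A half turn times the given turn of order three would have trace 2.\<close>
      moreover have "\<not> (e' = - 1 \<and> f' = 0)"
        using R'.multR[OF Q(2), of "rz e' f'"] mem no'[of "- f"] e by (auto simp: rz_simps)
      ultimately show "cq Q B \<in> set [rz 1 0, rz (- 1/2) ?s, rz (- 1/2) (- ?s)]"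
        using R'.rz_values[OF mem] by (auto simp: rz_simps(5) simp del: eq_divide_eq_numeral1)
    qed
    then show ?thesis using bound[OF Q(1)] by fastforce
  qed
qed

lemma trace_conj: "A \<in> R \<Longrightarrow> B \<in> conj_class (mat_group R) A \<Longrightarrow> trace B = trace A"
proof -
  assume "A \<in> R" "B \<in> conj_class (mat_group R) A"
  then obtain t where t: "t \<in> R" "B = t ** A ** transpose t" by (auto simp: conj_class_def inv_transpose)
  then show ?thesis using trace_similar[of "transpose t" A] rotation_matrixD(1)[OF rotR] by simp
qed

definition ntr :: "real \<Rightarrow> nat" where
  "ntr t = card {A\<in>R. trace A = t}"

text \<open>The class of \<open>A\<close> lies in the set of elements with the same trace; the index
  of the centraliser is the size of the class.\<close>

lemma card_le_ntr:
  assumes A: "A \<in> R" and c: "card (centr (mat_group R) A) \<le> k"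
  shows "card R \<le> ntr (trace A) * k"
proof -
  have "conj_class (mat_group R) A \<subseteq> {B\<in>R. trace B = trace A}"
    using trace_conj[OF A] conj_class_closed[of A] A by auto
  then have "card (conj_class (mat_group R) A) \<le> ntr (trace A)"
    unfolding ntr_def using finR by (intro card_mono) auto
  then have "card (conj_class (mat_group R) A) * card (centr (mat_group R) A) \<le> ntr (trace A) * k"
    using c by (rule mult_le_mono)
  then show ?thesis using card_class[of A] A by simp
qed

lemma sum_over_traces:
  fixes f :: "real \<Rightarrow> real"
  shows "(\<Sum>A\<in>R. f (trace A)) = f 3 + ntr (- 1) * f (- 1) + ntr 0 * f 0 + ntr 1 * f 1 + ntr 2 * f 2"
proof -
  have "(\<Sum>A\<in>R. f (trace A)) = (\<Sum>t\<in>{3, - 1, 0, 1, 2}. \<Sum>A\<in>{A\<in>R. trace A = t}. f (trace A))"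
    by (rule sum.group[symmetric]) (use finR trace_values(1) in auto)
  also have "\<dots> = (\<Sum>t\<in>{3, - 1, 0, 1, 2}. ntr t * f t)"
    by (intro sum.cong refl) (simp add: ntr_def)
  also have "\<dots> = ntr 3 * f 3 + ntr (- 1) * f (- 1) + ntr 0 * f 0 + ntr 1 * f 1 + ntr 2 * f 2" by simp
  also have "ntr 3 = 1"
  proof -
    have "{A\<in>R. trace A = 3} = {mat 1}" using trace_values(2) oneR by blast
    then show ?thesis by (simp add: ntr_def)
  qed
  finally show ?thesis by simp
qed

lemma ntr_pos: "ntr t > 0 \<longleftrightarrow> (\<exists>A\<in>R. trace A = t)"
  using finR by (auto simp: ntr_def card_gt_0_iff)

text \<open>Summing 1, the trace and its square over the group gives three equations:
  \<open>ntr 0 = 8 + 3 * ntr 2\<close> and \<open>card R = 12 + 2 * ntr 1 + 6 * ntr 2\<close>.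
  Elements of trace 2 would give \<open>card R \<le> 6 * ntr 2\<close>, a contradiction. After that,
  the bound 24 from trace 0 means \<open>ntr 1 \<le> 6\<close>, while a quarter turn gives
  \<open>card R \<le> 4 * ntr 1\<close> and so \<open>ntr 1 \<ge> 6\<close>.\<close>

lemma counting:
  shows "ntr 2 = 0" "ntr 0 = 8" "(card R = 12 \<and> ntr 1 = 0 \<and> ntr (- 1) = 3) \<or> (card R = 24 \<and> ntr 1 = 6 \<and> ntr (- 1) = 9)"
proof -
  have 1: "real (card R) = 1 + ntr (- 1) + ntr 0 + ntr 1 + ntr 2"
    using sum_over_traces[of "\<lambda>_. 1"] by simp
  have 2: "0 = 3 - real (ntr (- 1)) + ntr 1 + 2 * ntr 2"
    using sum_over_traces[of "\<lambda>t. t"] sum_trace by simp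
  have 3: "real (card R) = 9 + ntr (- 1) + ntr 1 + 4 * ntr 2"
    using sum_over_traces[of "\<lambda>t. t\<^sup>2"] sum_trace_squared by simp
  have eqs: "card R = 1 + ntr (- 1) + ntr 0 + ntr 1 + ntr 2" "ntr (- 1) = 3 + ntr 1 + 2 * ntr 2"
    "card R = 9 + ntr (- 1) + ntr 1 + 4 * ntr 2"
    using 1 2 3 by linarith+
  show n2: "ntr 2 = 0"
  proof (rule ccontr)
    assume "ntr 2 \<noteq> 0"
    then obtain A where A: "A \<in> R" "trace A = 2" using ntr_pos[of 2] by blast
    then show False using card_le_ntr[OF A(1) card_centr_le(1)[OF A]] eqs by simp
  qed
  show n0: "ntr 0 = 8" using eqs n2 by linarith
  then obtain A where A: "A \<in> R" "trace A = 0" using ntr_pos[of 0] by auto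
  have "\<And>B. B \<in> R \<Longrightarrow> trace B \<noteq> 2" using n2 ntr_pos[of 2] by auto
  then have le: "card R \<le> 24" using card_le_ntr[OF A(1) card_centr_le(3)[OF A]] A(2) n0 by simp
  show "(card R = 12 \<and> ntr 1 = 0 \<and> ntr (- 1) = 3) \<or> (card R = 24 \<and> ntr 1 = 6 \<and> ntr (- 1) = 9)"
  proof (cases "ntr 1 = 0")
    case True
    then show ?thesis using eqs n2 by linarith
  next
    case False
    then obtain B where B: "B \<in> R" "trace B = 1" using ntr_pos[of 1] by blast
    have "card R \<le> ntr 1 * 4" using card_le_ntr[OF B(1) card_centr_le(2)[OF B]] B(2) by simp
    then show ?thesis using eqs n2 le by linarith
  qed
qed

end

lemma (in fin_group) commute_if_card_3:
  assumes "card (carrier G) = 3" "x \<in> carrier G" "y \<in> carrier G"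
  shows "x \<otimes> y = y \<otimes> x"
proof (cases "x = \<one> \<or> y = \<one> \<or> x = y")
  case False
  have four: False if "z \<in> carrier G" "card {\<one>, x, y, z} = 4" for z
  proof -
    have "card {\<one>, x, y, z} \<le> card (carrier G)" using assms that(1) by (intro card_mono) auto
    then show False using assms(1) that(2) by simp
  qed
  have "a \<otimes> b = \<one>" if ab: "(a = x \<and> b = y) \<or> (a = y \<and> b = x)" for a b
  proof (rule ccontr)
    assume "a \<otimes> b \<noteq> \<one>"
    moreover have "a \<otimes> b \<noteq> a" "a \<otimes> b \<noteq> b" using ab False assms by auto
    ultimately have "card {\<one>, x, y, a \<otimes> b} = 4" using ab False by auto
    then show False using four[of "a \<otimes> b"] ab assms by auto
  qed
  then show ?thesis by metis
qed (use assms in auto)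

section \<open>Rotation groups of order twelve\<close>

context irr_rot_group
begin

lemma symmetric_trace:
  assumes A: "A \<in> R" "transpose A = A"
  shows "trace A = 3 \<or> trace A = - 1"
proof -
  obtain w where w: "norm w = 1" "A *v w = w" using rotation_has_axis[OF rotR[OF A(1)]] .
  obtain Q where Q: "orthogonal_matrix Q" "Q *v axis 1 1 = w" using rotate_to_e1[OF w(1)] .
  obtain e f where ef: "cq Q A = rz e f" "e*e + f*f = 1"
    using rotation_fix_e1[OF cq_rotation[OF Q(1) rotR[OF A(1)]] cq_fix_e1[OF Q w(2)]] .
  have "rz e (- f) = rz e f" using cq_transpose[of Q A] A(2) ef(1) by (simp add: rz_simps)
  then have "f = 0" by (simp add: rz_simps)
  then have "e = 1 \<or> e = - 1" using ef(2) by (simp add: square_eq_1_iff)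
  moreover have "trace A = 1 + 2 * e" using cq_trace[OF Q(1), of A] ef by (simp add: rz_simps)
  ultimately show ?thesis by auto
qed

lemma centr_mult: "A \<in> centr (mat_group R) C \<Longrightarrow> B \<in> centr (mat_group R) C \<Longrightarrow> A ** B \<in> centr (mat_group R) C"
  unfolding centr_def by (auto intro: multR) (metis matrix_mul_assoc)

text \<open>The half turns and the identity form a normal subgroup \<open>V\<close> of order four
  with abelian quotient. The half turns are one conjugacy class, and each coset of \<open>V\<close>
  outside \<open>V\<close> is a single orbit under conjugation by \<open>V\<close>.\<close>

lemma trivial_augs_12:
  assumes N: "card R = 12" "ntr 1 = 0" "ntr (- 1) = 3"
  shows "trivial_augs (mat_group R)"
proof -
  define J where "J = {A\<in>R. trace A = - 1}"
  define V where "V = insert (mat 1) J"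
  have cardJ: "card J = 3" using N(3) by (simp add: J_def ntr_def)
  have finJ: "finite J" using finR by (simp add: J_def)
  have JR: "a \<in> R" "trace a = - 1" "a \<noteq> mat 1" if "a \<in> J" for a using that by (auto simp: J_def m9_simps)
  have tv: "A = mat 1 \<or> A \<in> J \<or> trace A = 0" if "A \<in> R" for A
  proof -
    have "trace A \<noteq> 1" "trace A \<noteq> 2" using ntr_pos[of 1] ntr_pos[of 2] N(2) counting(1) that by auto
    then show ?thesis using trace_values[OF that] that by (auto simp: J_def)
  qed
  have classJ: "conj_class (mat_group R) a \<subseteq> J" if "a \<in> J" for a
    using trace_conj[of a] conj_class_closed[of a] JR[OF that] by (auto simp: J_def)
  have not1: "conj_class (mat_group R) a \<noteq> {a}" if a: "a \<in> J" for a
  proof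
    assume c: "conj_class (mat_group R) a = {a}"
    have "card (centr (mat_group R) a) = card R" using card_class[of a] JR[OF a] c by simp
    moreover have "centr (mat_group R) a \<subseteq> R" by (auto simp: centr_def)
    ultimately have "centr (mat_group R) a = R" using finR by (simp add: card_subset_eq)
    then show False using noncentral JR[OF a] by blast
  qed
  \<comment> \<open>Three elements, none of which is a class by itself, can only form one
    class.\<close>
  have class_eq: "conj_class (mat_group R) a = J" if a: "a \<in> J" for a
  proof (rule ccontr)
    assume ne: "conj_class (mat_group R) a \<noteq> J"
    have aR: "a \<in> carrier (mat_group R)" using JR[OF a] by simp
    obtain b where b: "b \<in> conj_class (mat_group R) a" "b \<noteq> a" using not1[OF a] conj_class_refl[OF aR] by blast
    obtain c where c: "c \<in> J" "c \<notin> conj_class (mat_group R) a" using ne classJ[OF a] by blast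
    have cR: "c \<in> carrier (mat_group R)" using JR[OF c(1)] by simp
    have bJ: "b \<in> J" using b classJ[OF a] by blast
    have abc: "a \<noteq> c" "b \<noteq> c" using c b conj_class_refl[OF aR] by auto
    have "card {a, b, c} = 3" using b(2) abc by auto
    then have J3: "J = {a, b, c}" using card_subset_eq[OF finJ, of "{a, b, c}"] a bJ c cardJ by auto
    have "conj_class (mat_group R) c \<subseteq> {c}"
    proof
      fix x assume x: "x \<in> conj_class (mat_group R) c"
      then have "x \<in> {a, b, c}" using classJ[OF c(1)] J3 by auto
      moreover have "x \<notin> conj_class (mat_group R) a"
        using conj_class_sym[OF cR x] conj_class_trans[OF aR, of x c] c(2) by blast
      ultimately show "x \<in> {c}" using conj_class_refl[OF aR] b(1) by auto
    qed
    then have "conj_class (mat_group R) c = {c}" using conj_class_refl[OF cR] by blast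
    then show False using not1[OF c(1)] by blast
  qed
  have centr4: "card (centr (mat_group R) a) = 4" if "a \<in> J" for a
    using card_class[of a] JR[OF that] class_eq[OF that] cardJ N(1) by simp
  have centrV: "centr (mat_group R) a = V" if a: "a \<in> J" for a
  proof -
    \<comment> \<open>An element of trace 0 that commutes with \<open>a\<close> would have four
      elements in its centraliser: the identity, itself, its inverse and \<open>a\<close>. The bound
      is three.\<close>
    have "centr (mat_group R) a \<subseteq> V"
    proof
      fix t assume t: "t \<in> centr (mat_group R) a"
      then have tR: "t \<in> R" "t ** a = a ** t" by (auto simp: centr_def)
      have "trace t \<noteq> 0"
      proof
        assume t0: "trace t = 0"
        have no2: "\<And>B. B \<in> R \<Longrightarrow> trace B \<noteq> 2" using ntr_pos[of 2] counting(1) by auto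
        have trt: "trace (transpose t) = 0" using t0 by (simp add: trace_def transpose_def)
        have tt: "transpose t \<noteq> t" using symmetric_trace[OF tR(1)] t0 by auto
        have "{mat 1, t, transpose t, a} \<subseteq> centr (mat_group R) t"
          using tR JR[OF a] oneR transR[OF tR(1)] rotation_matrixD(1,2)[OF rotR[OF tR(1)]] by (auto simp: centr_def)
        moreover have "card {mat 1, t, transpose t, a} = 4"
        proof -
          have "trace (mat 1 :: real^3^3) = 3" by (simp add: m9_simps)
          then have "mat 1 \<noteq> t" "mat 1 \<noteq> transpose t" "mat 1 \<noteq> a" "t \<noteq> a" "transpose t \<noteq> a"
            using t0 trt JR(2)[OF a] by auto
          then show ?thesis using tt by auto
        qed
        moreover have "finite (centr (mat_group R) t)" using finR by (auto simp: centr_def)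
        ultimately have "4 \<le> card (centr (mat_group R) t)" using card_mono by metis
        then show False using card_centr_le(3)[OF tR(1) t0 no2] by simp
      qed
      then show "t \<in> V" using tv[OF tR(1)] by (auto simp: V_def)
    qed
    moreover have "mat 1 \<notin> J" using JR(3) by blast
    then have "card V = 4" using cardJ finJ by (simp add: V_def)
    ultimately show ?thesis using centr4[OF a] finJ by (intro card_subset_eq) (auto simp: V_def)
  qed
  obtain a where a: "a \<in> J" using cardJ by fastforce
  have VR: "V \<subseteq> R" using JR oneR by (auto simp: V_def)
  have cardV: "card V = 4" using centr4[OF a] centrV[OF a] by simp
  have Jconj: "t ** b ** transpose t \<in> J" if "t \<in> R" "b \<in> J" for t b
    using conj_classI[of t b] classJ[OF that(2)] that by (auto simp: inv_transpose)
  have subV: "subgroup V (mat_group R)"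
  proof (rule subgroupI)
    show "V \<subseteq> carrier (mat_group R)" "V \<noteq> {}" using VR by (auto simp: V_def)
    fix x assume x: "x \<in> V"
    have "transpose x \<in> V" using x by (auto simp: V_def J_def transR trace_def) (simp_all add: transpose_def)
    then show "inv\<^bsub>mat_group R\<^esub> x \<in> V" using inv_transpose x VR by auto
    fix y assume "y \<in> V"
    then show "x \<otimes>\<^bsub>mat_group R\<^esub> y \<in> V" using x centr_mult[of x a y] centrV[OF a] by simp
  qed
  have normal: "V \<lhd> mat_group R"
  proof (rule normal_invI[OF subV])
    fix x v assume x: "x \<in> carrier (mat_group R)" and v: "v \<in> V"
    have "x ** v ** transpose x \<in> V"
    proof (cases "v = mat 1")
      case True
      then show ?thesis using rotation_matrixD(2)[OF rotR] x by (auto simp: V_def)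
    next
      case False
      then show ?thesis using Jconj x v by (auto simp: V_def)
    qed
    then show "x \<otimes>\<^bsub>mat_group R\<^esub> v \<otimes>\<^bsub>mat_group R\<^esub> inv\<^bsub>mat_group R\<^esub> x \<in> V" using x by (simp add: inv_transpose)
  qed
  interpret V: normal V "mat_group R" by (rule normal)
  have fgM: "fin_group (mat_group R Mod V)"
    using V.factorgroup_is_group finR by (auto simp: fin_group_def fin_group_axioms_def FactGroup_def RCOSETS_def)
  interpret Q: fin_group "mat_group R Mod V" by (rule fgM)
  interpret h: fin_hom "mat_group R" "mat_group R Mod V" "\<lambda>x. V #>\<^bsub>mat_group R\<^esub> x"
    by unfold_locales (rule V.r_coset_hom_Mod)
  have "card (carrier (mat_group R Mod V)) * card V = card R"
    using lagrange[OF subV] by (simp add: FactGroup_def order_def)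
  then have c3: "card (carrier (mat_group R Mod V)) = 3" using cardV N(1) by simp
  show ?thesis
  proof (rule h.trivial_augs_lift)
    show "trivial_augs (mat_group R Mod V)" using Q.trivial_augs_abelian Q.commute_if_card_3[OF c3] by blast
    fix x y assume x: "x \<in> carrier (mat_group R)" and y: "y \<in> carrier (mat_group R)"
      and nx: "centr (mat_group R) x \<noteq> carrier (mat_group R)" and ny: "centr (mat_group R) y \<noteq> carrier (mat_group R)"
      and conj: "V #>\<^bsub>mat_group R\<^esub> y \<in> conj_class (mat_group R Mod V) (V #>\<^bsub>mat_group R\<^esub> x)"
    have "conj_class (mat_group R Mod V) (V #>\<^bsub>mat_group R\<^esub> x) = {V #>\<^bsub>mat_group R\<^esub> x}"
      using Q.conj_class_central[OF h.\<phi>_closed[OF x]] Q.commute_if_card_3[OF c3] h.\<phi>_closed[OF x] by blast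
    then have "V #>\<^bsub>mat_group R\<^esub> y = V #>\<^bsub>mat_group R\<^esub> x" using conj by simp
    then have "y \<in> V #>\<^bsub>mat_group R\<^esub> x" using rcos_self[OF y subV] by simp
    then obtain v where v: "v \<in> V" "y = v ** x" by (auto simp: r_coset_def)
    have one_central: "centr (mat_group R) (mat 1) = carrier (mat_group R)" by (auto simp: centr_def)
    show "y \<in> conj_class (mat_group R) x"
    proof (cases "x \<in> V")
      case True
      have "x \<in> J" using True nx one_central by (auto simp: V_def)
      moreover have "y \<in> V" using subgroup.m_closed[OF subV v(1) True] v(2) by simp
      then have "y \<in> J" using ny one_central by (auto simp: V_def)
      ultimately show ?thesis using class_eq by simp
    next
      case False
      \<comment> \<open>Half turns have centraliser \<open>V\<close>, so only the identity of
        \<open>V\<close> commutes with \<open>x\<close>. The conjugates under \<open>V\<close> are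
        therefore distinct and, lying in the coset, fill it.\<close>
      define F :: "real^3^3 \<Rightarrow> real^3^3" where "F = (\<lambda>w. w ** x ** transpose w)"
      have inj: "inj_on F V"
      proof (rule inj_onI)
        fix w z assume w: "w \<in> V" and z: "z \<in> V" and eq: "F w = F z"
        have wz: "w \<in> R" "z \<in> R" using w z VR by auto
        have "inv\<^bsub>mat_group R\<^esub> z \<otimes>\<^bsub>mat_group R\<^esub> w \<in> centr (mat_group R) x"
          using conj_eq_iff[of w z x] wz x eq by (simp add: F_def inv_transpose)
        then have c: "transpose z ** w \<in> centr (mat_group R) x" using wz by (simp add: inv_transpose)
        have "transpose z ** w \<in> V"
          using subgroup.m_closed[OF subV subgroup.m_inv_closed[OF subV z] w] wz by (simp add: inv_transpose)
        moreover have "transpose z ** w \<notin> J"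
        proof
          assume j: "transpose z ** w \<in> J"
          then have "x \<in> centr (mat_group R) (transpose z ** w)" using c x by (auto simp: centr_def)
          then show False using centrV[OF j] False by simp
        qed
        ultimately have "transpose z ** w = mat 1" by (auto simp: V_def)
        then have "z ** transpose z ** w = z" by (simp add: matrix_mul_assoc[symmetric])
        then show "w = z" using rotation_matrixD(2)[OF rotR[OF wz(2)]] by simp
      qed
      have sub: "F ` V \<subseteq> (\<lambda>w. w ** x) ` V"
      proof clarify
        fix w assume w: "w \<in> V"
        have "w \<in> R" using w VR by blast
        then have wV: "transpose w \<in> V" using subgroup.m_inv_closed[OF subV w] inv_transpose by simp
        have "x ** transpose w ** transpose x \<in> V"
          using V.inv_op_closed2[OF x wV] x by (simp add: inv_transpose)
        then have m: "w ** (x ** transpose w ** transpose x) \<in> V" using subgroup.m_closed[OF subV w] by simp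
        have "F w = w ** x ** transpose w ** (transpose x ** x)"
          using rotation_matrixD(1)[OF rotR] x by (simp add: F_def)
        also have "\<dots> = w ** (x ** transpose w ** transpose x) ** x" by (simp only: matrix_mul_assoc)
        finally show "F w \<in> (\<lambda>w. w ** x) ` V" using m by blast
      qed
      have finV: "finite V" using finJ by (simp add: V_def)
      have "card ((\<lambda>w. w ** x) ` V) \<le> card (F ` V)"
        using card_image_le[OF finV, of "\<lambda>w. w ** x"] card_image[OF inj] by simp
      then have "F ` V = (\<lambda>w. w ** x) ` V" using sub finV by (intro card_seteq) auto
      then have "y \<in> F ` V" using v by blast
      then show ?thesis using VR by (auto simp: F_def conj_class_def inv_transpose)
    qed
  qed
qed

end

text \<open>The octahedral group is itself without invariant line, so \<open>counting\<close> bounds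
  its order.\<close>

lemma card_oct: "card oct \<le> 24"
proof -
  interpret oct: irr_rot_group oct
  proof
    show "trace A \<in> \<int>" if "A \<in> oct" for A using that by (auto simp: oct_def trace_def intro!: Ints_sum)
    fix v :: "real^3" assume v: "norm v = 1"
    let ?A = "m9 0 1 0 0 0 1 1 0 (0::real)" and ?B = "m9 1 0 0 0 (- 1) 0 0 0 (- 1::real)"
    have mem: "?A \<in> oct" "?B \<in> oct" by (simp_all add: m9_in_oct m9_simps)
    show "\<exists>A\<in>oct. A *v v \<noteq> v \<and> A *v v \<noteq> - v"
    proof (rule ccontr)
      assume "\<not> (\<exists>A\<in>oct. A *v v \<noteq> v \<and> A *v v \<noteq> - v)"
      then have "?A *v v = v \<or> ?A *v v = - v" "?B *v v = v \<or> ?B *v v = - v" using mem by blast+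
      then have "v$1 = 0 \<and> v$2 = 0 \<and> v$3 = 0"
        unfolding m9_vector by (auto simp: vec_eq_iff forall_3 vector_3)
      then have "v = 0" by (simp add: vec_eq_iff forall_3)
      then show False using v by simp
    qed
  qed (use finite_oct one_in_oct oct_closed in \<open>auto simp: oct_def\<close>)
  show ?thesis using oct.counting(3) by auto
qed

section \<open>Rotation groups of order twenty-four\<close>

context irr_rot_group
begin

text \<open>Trace 1 means a quarter turn. Its square is a half turn about the same axis, so a
  quarter turn with the same square shares the axis, commutes with \<open>g\<close> and lies in the
  centraliser of order four.\<close>

lemma order4_square:
  assumes g: "g \<in> R" "trace g = 1"
  shows "trace (g ** g) = - 1" "transpose (g ** g) = g ** g" "transpose g \<noteq> g"
    and "centr (mat_group R) g = {mat 1, g, g ** g, transpose g}"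
    and "h \<in> R \<Longrightarrow> trace h = 1 \<Longrightarrow> h ** h = g ** g \<Longrightarrow> h = g \<or> h = transpose g"
proof -
  obtain w where w: "norm w = 1" "g *v w = w" using rotation_has_axis[OF rotR[OF g(1)]] .
  obtain Q where Q: "orthogonal_matrix Q" "Q *v axis 1 1 = w" using rotate_to_e1[OF w(1)] .
  interpret R': rot_group "cq Q ` R" using rot_group_cq[OF Q(1)] .
  obtain e f where ef: "cq Q g = rz e f" "e*e + f*f = 1"
    using rotation_fix_e1[OF cq_rotation[OF Q(1) rotR[OF g(1)]] cq_fix_e1[OF Q w(2)]] .
  have e: "e = 0" using cq_trace[OF Q(1), of g] ef(1) g(2) by (simp add: rz_simps)
  have gg: "cq Q (g ** g) = rz (- 1) 0" using ef e by (simp add: cq_mult[OF Q(1)] rz_simps)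
  show tr: "trace (g ** g) = - 1" using cq_trace[OF Q(1), of "g ** g"] gg by (simp add: rz_simps)
  have "cq Q (transpose (g ** g)) = cq Q (g ** g)" by (simp add: cq_transpose gg rz_simps)
  then show sym: "transpose (g ** g) = g ** g" using cq_inj[OF Q(1)] by blast
  show ns: "transpose g \<noteq> g" using symmetric_trace[OF g(1)] g(2) by auto
  have trt: "trace (transpose g) = 1" using g(2) by (simp add: trace_def transpose_def)
  have "{mat 1, g, g ** g, transpose g} \<subseteq> centr (mat_group R) g"
    using g oneR multR[OF g(1) g(1)] transR[OF g(1)] rotation_matrixD(1,2)[OF rotR[OF g(1)]]
    by (auto simp: centr_def matrix_mul_assoc)
  moreover have "card {mat 1, g, g ** g, transpose g} = 4"
  proof -
    have "trace (mat 1 :: real^3^3) = 3" by (simp add: m9_simps)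
    then have "mat 1 \<noteq> g" "mat 1 \<noteq> transpose g" "mat 1 \<noteq> g ** g" "g \<noteq> g ** g" "g ** g \<noteq> transpose g"
      using g(2) trt tr by auto
    then show ?thesis using ns by auto
  qed
  moreover have "finite (centr (mat_group R) g)" using finR by (auto simp: centr_def)
  ultimately show centr: "centr (mat_group R) g = {mat 1, g, g ** g, transpose g}"
    using card_centr_le(2)[OF g] card_seteq by metis
  show "h = g \<or> h = transpose g" if h: "h \<in> R" "trace h = 1" "h ** h = g ** g"
  proof -
    obtain x where x: "norm x = 1" "h *v x = x" using rotation_has_axis[OF rotR[OF h(1)]] .
    have "(g ** g) *v x = x" using h(3) x(2) by (metis matrix_vector_mul_assoc)
    moreover have "(g ** g) *v w = w" using w(2) by (simp add: matrix_vector_mul_assoc[symmetric])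
    moreover have "g ** g \<noteq> mat 1" using tr by (auto simp: m9_simps)
    ultimately obtain k where k: "x = k *\<^sub>R w"
      using rotation_fixed_line[OF rotR[OF multR[OF g(1) g(1)]] _ _ w(1)] by blast
    have k0: "k \<noteq> 0" using k x(1) by auto
    have "k *\<^sub>R (h *v w) = k *\<^sub>R w" using x(2) k by (simp add: matrix_vector_mult_scaleR)
    then have "h *v w = w" using k0 by simp
    then obtain e' f' where "cq Q h = rz e' f'"
      using rotation_fix_e1[OF cq_rotation[OF Q(1) rotR[OF h(1)]] cq_fix_e1[OF Q]] by blast
    then have "cq Q (h ** g) = cq Q (g ** h)" using ef(1) by (simp add: cq_mult[OF Q(1)] rz_simps algebra_simps)
    then have "h \<in> centr (mat_group R) g" using cq_inj[OF Q(1)] h(1) by (auto simp: centr_def)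
    then show ?thesis using centr h(2) tr by (auto simp: m9_simps)
  qed
qed

lemma half_turn_eq:
  assumes "a \<in> R" "b \<in> R" "trace a = - 1" "trace b = - 1" "norm w = 1" "a *v w = w" "b *v w = w"
  shows "a = b"
proof -
  obtain Q where Q: "orthogonal_matrix Q" "Q *v axis 1 1 = w" using rotate_to_e1[OF assms(5)] .
  have "cq Q c = rz (- 1) 0" if c: "c \<in> R" "trace c = - 1" "c *v w = w" for c
  proof -
    obtain e f where ef: "cq Q c = rz e f" "e*e + f*f = 1"
      using rotation_fix_e1[OF cq_rotation[OF Q(1) rotR[OF c(1)]] cq_fix_e1[OF Q c(3)]] .
    have "e = - 1" using cq_trace[OF Q(1), of c] ef(1) c(2) by (simp add: rz_simps)
    then show ?thesis using ef by simp
  qed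
  then show ?thesis using assms cq_inj[OF Q(1), of a b] by metis
qed

text \<open>Distinct commuting half turns have orthogonal axes. The group permutes the three axes up
  to sign, so in the orthonormal basis along them it consists of signed permutation
  matrices.\<close>

lemma commuting_half_turns:
  assumes "finite F" "card F = 3" and F: "\<And>a. a \<in> F \<Longrightarrow> a \<in> R \<and> trace a = - 1"
    and conj: "\<And>t a. t \<in> R \<Longrightarrow> a \<in> F \<Longrightarrow> t ** a ** transpose t \<in> F"
    and comm: "\<And>a b. a \<in> F \<Longrightarrow> b \<in> F \<Longrightarrow> a ** b = b ** a"
  obtains Q where "orthogonal_matrix Q" "\<And>g. g \<in> R \<Longrightarrow> cq Q g \<in> oct"
proof -
  obtain a b c where abc: "F = {a, b, c}" "a \<noteq> b" "b \<noteq> c" "a \<noteq> c" using assms(2) by (auto simp: card_3_iff)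
  define al :: "3 \<Rightarrow> real^3^3" where "al = (\<lambda>i. if i = 1 then a else if i = 2 then b else c)"
  have al_inj: "al i = al j \<Longrightarrow> i = j" for i j
    using exhaust_3[of i] exhaust_3[of j] abc by (auto simp: al_def)
  have alF: "al i \<in> F" for i using abc by (auto simp: al_def)
  have al_surj: "\<exists>i. x = al i" if x: "x \<in> F" for x
  proof -
    have "al 1 = a" "al 2 = b" "al 3 = c" by (simp_all add: al_def)
    then show ?thesis using x abc(1) by (metis empty_iff insert_iff)
  qed
  have "\<exists>w. norm w = 1 \<and> al i *v w = w" for i using rotation_has_axis[OF rotR] F[OF alF[of i]] by metis
  then obtain v where v: "\<And>i. norm (v i) = 1" "\<And>i. al i *v v i = v i" by metis
  have not1: "x \<noteq> mat 1" if "x \<in> F" for x using F[OF that] by (auto simp: m9_simps)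
  have line: "\<exists>s. (s = 1 \<or> s = - 1) \<and> y = s *\<^sub>R v k" if y: "al k *v y = y" "norm y = 1" for k y
  proof -
    obtain s where s: "y = s *\<^sub>R v k"
      using rotation_fixed_line[OF rotR not1[OF alF] v(2) v(1) y(1)] F[OF alF] by blast
    then have "\<bar>s\<bar> = 1" using y(2) v(1)[of k] by simp
    then show ?thesis using s by (auto simp: abs_if split: if_splits)
  qed
  \<comment> \<open>Commuting half turns preserve each other's axes; the sign is negative because
    two half turns with a common axis coincide.\<close>
  have neg: "al j *v v i = - v i" if ij: "i \<noteq> j" for i j
  proof -
    have "al i *v (al j *v v i) = al j *v v i"
      using comm[OF alF[of i] alF[of j]] v(2)[of i] by (metis matrix_vector_mul_assoc)
    moreover have "norm (al j *v v i) = 1" using rotation_norm[OF rotR] F[OF alF] v(1) by simp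
    ultimately obtain s where s: "s = 1 \<or> s = - 1" "al j *v v i = s *\<^sub>R v i" using line by blast
    moreover have "al j *v v i \<noteq> v i"
      using half_turn_eq[of "al i" "al j" "v i"] F[OF alF] v al_inj[of i j] ij by blast
    ultimately show ?thesis by auto
  qed
  have ortho: "v i \<bullet> v j = (if i = j then 1 else 0)" for i j
  proof (cases "i = j")
    case True
    then show ?thesis using v(1)[of j] by (simp add: norm_eq_1)
  next
    case False
    have "v i \<bullet> v j = (al j *v v i) \<bullet> (al j *v v j)" using rotation_inner[OF rotR] F[OF alF] by simp
    also have "\<dots> = - (v i \<bullet> v j)" using neg[OF False] v(2) by simp
    finally show ?thesis using False by simp
  qed
  define Q :: "real^3^3" where "Q = (\<chi> i j. v j $ i)"
  have col: "column j Q = v j" for j by (simp add: Q_def column_def vec_eq_iff)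
  have Q: "orthogonal_matrix Q"
    unfolding orthogonal_matrix_orthonormal_columns col using ortho v(1) by (auto simp: orthogonal_def)
  have Qe: "Q *v axis j 1 = v j" for j by (simp add: matrix_vector_mult_basis col)
  show thesis
  proof (rule that[OF Q])
    fix g assume g: "g \<in> R"
    have entry: "cq Q g $ i $ j = v i \<bullet> (g *v v j)" for i j
    proof -
      have "cq Q g $ i $ j = (cq Q g *v axis j 1) $ i" by (simp add: matrix_vector_mult_basis column_def)
      also have "\<dots> = (transpose Q *v (g *v v j)) $ i" by (simp only: cq_vector[OF Q] Qe)
      also have "\<dots> = (transpose Q $ i) \<bullet> (g *v v j)" by (rule matrix_vector_mul_component)
      also have "transpose Q $ i = v i" by (simp add: transpose_def Q_def vec_eq_iff)
      finally show ?thesis .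
    qed
    have "cq Q g $ i $ j \<in> \<int>" for i j
    proof -
      obtain k where k: "g ** al j ** transpose g = al k" using al_surj[OF conj[OF g alF[of j]]] by blast
      have "al k *v (g *v v j) = g *v (al j *v (transpose g *v (g *v v j)))"
        unfolding k[symmetric] by (simp only: matrix_vector_mul_assoc matrix_mul_assoc)
      also have "\<dots> = g *v v j"
        using transpose_vector(1)[of g "v j"] rotR[OF g] v(2)[of j] by (simp add: rotation_matrix_def)
      finally have "al k *v (g *v v j) = g *v v j" .
      moreover have "norm (g *v v j) = 1" using rotation_norm[OF rotR[OF g]] v(1) by simp
      ultimately obtain s where "s = 1 \<or> s = - 1" "g *v v j = s *\<^sub>R v k" using line by blast
      then show ?thesis using ortho[of i k] by (auto simp: entry)
    qed
    then show "cq Q g \<in> oct" using cq_rotation[OF Q rotR[OF g]] by (simp add: oct_def)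
  qed
qed

text \<open>The six quarter turns, paired with their inverses, have three squares, which form a
  normal set of half turns. Once these commute, the group embeds into \<open>oct\<close> by a change
  of basis and fills it for reasons of order.\<close>

lemma trivial_augs_24:
  assumes N: "card R = 24" "ntr 1 = 6"
  shows "trivial_augs (mat_group R)"
proof -
  define X where "X = {g\<in>R. trace g = 1}"
  define F where "F = (\<lambda>g. g ** g) ` X"
  have finX: "finite X" using finR by (simp add: X_def)
  have trt: "transpose g \<in> X" if "g \<in> X" for g
    using that transR by (auto simp: X_def trace_def) (simp add: transpose_def)
  have tsq: "transpose g ** transpose g = g ** g" if "g \<in> X" for g
    using order4_square(2)[of g] that by (simp add: X_def matrix_transpose_mul)
  have fib: "card {h\<in>X. h ** h = a} = 2" if a: "a \<in> F" for a
  proof -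
    obtain g where g: "g \<in> X" "a = g ** g" using a by (auto simp: F_def)
    have "{h\<in>X. h ** h = a} = {g, transpose g}"
      using order4_square(5)[of g] g trt[OF g(1)] tsq[OF g(1)] by (auto simp: X_def)
    then show ?thesis using order4_square(3)[of g] g(1) by (auto simp: X_def)
  qed
  have "card X = (\<Sum>a\<in>F. card {h\<in>X. h ** h = a})"
    using sum.group[OF finX, of F "\<lambda>g. g ** g" "\<lambda>_. 1::nat"] finX by (simp add: F_def)
  then have cardF: "card F = 3" using fib N(2) by (simp add: X_def ntr_def)
  have FR: "a \<in> R \<and> trace a = - 1" if "a \<in> F" for a
    using that order4_square(1) multR by (auto simp: F_def X_def)
  have conj: "t ** a ** transpose t \<in> F" if t: "t \<in> R" and a: "a \<in> F" for t a
  proof -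
    obtain g where g: "g \<in> X" "a = g ** g" using a by (auto simp: F_def)
    have gR: "g \<in> R" "trace g = 1" using g by (auto simp: X_def)
    have "(t ** g ** transpose t) ** (t ** g ** transpose t) = t ** g ** (transpose t ** t) ** g ** transpose t"
      by (simp only: matrix_mul_assoc)
    also have "\<dots> = t ** a ** transpose t"
      by (simp add: rotation_matrixD(1)[OF rotR[OF t]] g(2) matrix_mul_assoc)
    finally have "t ** a ** transpose t = (t ** g ** transpose t) ** (t ** g ** transpose t)" by simp
    moreover have "t ** g ** transpose t \<in> X"
      using trace_conj[of g "t ** g ** transpose t"] conj_classI[of t g] t gR multR transR
      by (simp add: X_def inv_transpose)
    ultimately show ?thesis unfolding F_def by blast
  qed
  have comm: "a ** b = b ** a" if a: "a \<in> F" and b: "b \<in> F" for a b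
  proof (cases "a = b")
    case False
    obtain g where g: "g \<in> X" "a = g ** g" using a by (auto simp: F_def)
    have gR: "g \<in> R" "trace g = 1" using g by (auto simp: X_def)
    note rg = rotation_matrixD(1,2)[OF rotR[OF gR(1)]]
    define cj where "cj = (\<lambda>x. g ** x ** transpose g)"
    have cj_inv: "transpose g ** cj x ** g = x" for x
    proof -
      have "transpose g ** cj x ** g = (transpose g ** g) ** x ** (transpose g ** g)"
        by (simp only: cj_def matrix_mul_assoc)
      then show ?thesis by (simp add: rg)
    qed
    have cja: "cj a = a"
    proof -
      have "cj a = g ** g ** (g ** transpose g)" by (simp only: cj_def g(2) matrix_mul_assoc)
      then show ?thesis by (simp add: rg g(2))
    qed
    \<comment> \<open>A quarter turn \<open>g\<close> with square \<open>a\<close> exchanges the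
      other two members of \<open>F\<close>, since \<open>a\<close> is the only half turn in its
      centraliser. Conjugation by \<open>a\<close> itself then fixes both.\<close>
    have moved: "cj x \<in> F" "cj x \<noteq> a" "cj x \<noteq> x" if x: "x \<in> F" "x \<noteq> a" for x
    proof -
      show "cj x \<in> F" using conj[OF gR(1) x(1)] by (simp add: cj_def)
      show "cj x \<noteq> a" using cj_inv[of x] cj_inv[of a] cja x(2) by metis
      show "cj x \<noteq> x"
      proof
        assume eq: "cj x = x"
        have "cj x ** g = g ** x ** (transpose g ** g)" by (simp only: cj_def matrix_mul_assoc)
        then have "x ** g = g ** x" using eq by (simp add: rg)
        then have "x \<in> centr (mat_group R) g" using FR[OF x(1)] by (auto simp: centr_def)
        then show False
          using order4_square(4)[OF gR] FR[OF x(1)] gR x(2) g(2) trt[OF g(1)] by (auto simp: m9_simps X_def)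
      qed
    qed
    have b': "b \<noteq> a" using False by simp
    note m1 = moved[OF b b']
    note m2 = moved[OF m1(1,2)]
    have "{a, b, cj b} = F"
    proof (rule card_subset_eq)
      show "finite F" using finX by (simp add: F_def)
      show "{a, b, cj b} \<subseteq> F" using a b m1 by simp
      show "card {a, b, cj b} = card F" using cardF False m1 by auto
    qed
    then have "cj (cj b) = b" using m2 by blast
    moreover have "cj (cj b) = a ** b ** transpose a"
      by (simp only: cj_def g(2) matrix_transpose_mul matrix_mul_assoc)
    ultimately have "a ** b ** transpose a ** a = b ** a" by simp
    then have "a ** b ** (transpose a ** a) = b ** a" by (simp only: matrix_mul_assoc)
    then show ?thesis using rotation_matrixD(1)[OF rotR] FR[OF a] by simp
  qed simp
  obtain Q where Q: "orthogonal_matrix Q" "\<And>g. g \<in> R \<Longrightarrow> cq Q g \<in> oct"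
    using commuting_half_turns[OF _ cardF FR conj comm] finX by (auto simp: F_def)
  have "card (cq Q ` R) = 24" using cq_inj[OF Q(1)] N(1) by (subst card_image) (auto intro: inj_onI)
  then have "cq Q ` R = oct" using Q(2) card_oct finite_oct by (intro card_seteq) auto
  then show ?thesis using trivial_augs_cq[OF Q(1)] trivial_augs_oct by simp
qed

end

theorem (in rot_group) trivial_augs_rot_group: "trivial_augs (mat_group R)"
proof (cases "\<exists>v. norm v = 1 \<and> (\<forall>A\<in>R. A *v v = v \<or> A *v v = - v)")
  case True
  then show ?thesis using trivial_augs_reducible by blast
next
  case False
  then interpret irr_rot_group R by unfold_locales blast
  show ?thesis using counting(3) trivial_augs_12 trivial_augs_24 by blast
qed

section \<open>Finite groups of integral matrices\<close>

text \<open>Cholesky factorisation with upper triangular \<open>S\<close>, the change of basis that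
  turns an invariant form into the standard one.\<close>

lemma cholesky_3:
  fixes B :: "real^3^3"
  assumes sym: "transpose B = B" and pos: "\<And>x. x \<noteq> 0 \<Longrightarrow> x \<bullet> (B *v x) > 0"
  obtains S T :: "real^3^3" where "transpose S ** S = B" "S ** T = mat 1" "T ** S = mat 1"
proof -
  obtain a b c b' d e c' e' f where B9: "B = m9 a b c b' d e c' e' f" using m9_collapse by blast
  have "b' = b" "c' = c" "e' = e" using sym unfolding B9 m9_transpose m9_eq by blast+
  then have B: "B = m9 a b c b d e c e f" using B9 by simp
  have q: "x*(a*x + b*y + c*z) + y*(b*x + d*y + e*z) + z*(c*x + e*y + f*z) > 0"
    if "x \<noteq> 0 \<or> y \<noteq> 0 \<or> z \<noteq> 0" for x y z
  proof -
    have "vector [x, y, z] \<noteq> (0 :: real^3)" using that by (auto simp: vec_eq_iff forall_3 vector_3)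
    from pos[OF this] show ?thesis unfolding B m9_vector by (simp add: inner_vec_def sum_3 vector_3)
  qed
  have a: "a > 0" using q[of 1 0 0] by simp
  define p where "p = sqrt a"
  have p: "p > 0" "p * p = a" using a by (simp_all add: p_def)
  have "a * (a*d - b*b) > 0" using q[of "- b" a 0] a by (simp add: algebra_simps)
  then have "a*d - b*b > 0" using a by (simp add: zero_less_mult_iff)
  then have "d - b*b/a > 0" using a by (simp add: field_simps)
  define r where "r = sqrt (d - b*b/a)"
  have r: "r > 0" "r * r = d - b*b/a" using \<open>d - b*b/a > 0\<close> by (simp_all add: r_def)
  define s where "s = (e - b*c/a) / r"
  have rs: "r * s = e - b*c/a" using r by (simp add: s_def)
  have "f - c*c/a - s * s > 0"
  proof -
    \<comment> \<open>The vector \<open>(x, y, 1)\<close> minimises the form among vectors with last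
      coordinate 1, and its value there is the last Schur complement.\<close>
    define y where "y = - s / r"
    define x where "x = - (b*y + c) / a"
    have ry: "r * y = - s" using r by (simp add: y_def)
    have z: "a*x + b*y + c = 0" using a by (simp add: x_def)
    have "0 < x*(a*x + b*y + c*1) + y*(b*x + d*y + e*1) + 1*(c*x + e*y + f*1)" by (rule q) simp
    also have "\<dots> = x*(a*x + b*y + c) + (y*(b*x + d*y + e) + (c*x + e*y + f))" by simp
    also have "\<dots> = y*(b*x + d*y + e) + (c*x + e*y + f)" unfolding z by simp
    also have "\<dots> = (b*y + c) * x + d*y*y + 2*e*y + f" by (simp add: algebra_simps)
    also have "(b*y + c) * x = - (b*y + c)*(b*y + c)/a" by (simp add: x_def)
    also have "- (b*y + c)*(b*y + c)/a + d*y*y + 2*e*y + f = (d - b*b/a)*y*y + 2*(e - b*c/a)*y + (f - c*c/a)"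
      using a by (simp add: field_simps)
    also have "\<dots> = (r*y)*(r*y) + 2 * s * (r*y) + (f - c*c/a)"
      unfolding r(2)[symmetric] rs[symmetric] by (simp add: algebra_simps)
    also have "\<dots> = f - c*c/a - s * s" unfolding ry by simp
    finally show ?thesis .
  qed
  define t where "t = sqrt (f - c*c/a - s * s)"
  have t: "t > 0" "t * t = f - c*c/a - s * s" using \<open>f - c*c/a - s * s > 0\<close> by (simp_all add: t_def)
  define b1 c1 where "b1 = b/p" and "c1 = c/p"
  have b1: "p * b1 = b" "p * c1 = c" using p by (simp_all add: b1_def c1_def)
  have b1': "b1 * b1 = b*b/a" "b1 * c1 = b*c/a" "c1 * c1 = c*c/a"
    using p by (simp_all add: b1_def c1_def)
  define S where "S = m9 p b1 c1 0 r s 0 0 t"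
  have e1: "b1 * b1 + r * r = d" "b1 * c1 + r * s = e" "c1 * c1 + s * s + t * t = f"
    using b1' r(2) rs t(2) by linarith+
  have SB: "transpose S ** S = B"
    unfolding S_def B m9_transpose m9_mult m9_eq using e1 b1 p(2) by (simp add: mult.commute)
  have "invertible S"
    unfolding invertible_det_nz S_def using p r t by (simp add: m9_det)
  then obtain T where T: "S ** T = mat 1" "T ** S = mat 1" unfolding invertible_def by blast
  show thesis by (rule that[OF SB T])
qed

definition real_mat :: "int^3^3 \<Rightarrow> real^3^3" where
  "real_mat A = (\<chi> i j. of_int (A $ i $ j))"

lemma real_mat_simps:
  "real_mat (A ** B) = real_mat A ** real_mat B" "real_mat (mat 1) = mat 1"
  "det (real_mat A) = of_int (det A)" "trace (real_mat A) = of_int (trace A)"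
  "real_mat (- A) = - real_mat A" "real_mat A = real_mat B \<longleftrightarrow> A = B"
  by (auto simp: real_mat_def vec_eq_iff matrix_matrix_mult_def mat_def det_3 trace_def)

text \<open>Averaging the standard form over the group yields an invariant one, so \<open>G\<close>
  becomes orthogonal in suitable coordinates. Multiplication by the determinant maps it to rotations
  and can identify only a matrix with its negative. Hence \<open>G\<close> is either isomorphic to
  its image or an extension with \<open>- mat 1\<close>, where the determinant is the second
  coordinate.\<close>

lemma trivial_augs_GL3Z:
  assumes G: "finite_subgroup_GL3Z G"
  shows "fin_group (mat_group G)" "trivial_augs (mat_group G)"
proof -
  have finG: "finite G" and oneG: "mat 1 \<in> G" and multG: "\<And>A B. A \<in> G \<Longrightarrow> B \<in> G \<Longrightarrow> A ** B \<in> G"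
    and invG: "\<And>A. A \<in> G \<Longrightarrow> \<exists>B\<in>G. A ** B = mat 1 \<and> B ** A = mat 1"
    using G by (auto simp: finite_subgroup_GL3Z_def)
  show fg: "fin_group (mat_group G)"
    by (rule fin_group_mat_group) (use finG oneG multG invG in blast)+
  interpret G: fin_group "mat_group G" by (rule fg)
  have det: "det A = 1 \<or> det A = - 1" if A: "A \<in> G" for A
  proof -
    obtain B where "A ** B = mat 1" using invG[OF A] by blast
    then have "det A * det B = 1" by (metis det_I det_mul)
    then show ?thesis using zmult_eq_1_iff by blast
  qed
  define B where "B = (\<Sum>A\<in>G. transpose (real_mat A) ** real_mat A)"
  have adj: "x \<bullet> (transpose M *v z) = (M *v x) \<bullet> z" for M :: "real^3^3" and x z
    using dot_lmul_matrix[of z M x] by (simp add: inner_commute)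
  have Bv: "x \<bullet> (B *v y) = (\<Sum>A\<in>G. (real_mat A *v x) \<bullet> (real_mat A *v y))" for x y
  proof -
    have "B *v y = (\<Sum>A\<in>G. (transpose (real_mat A) ** real_mat A) *v y)"
      unfolding B_def by (induction G rule: infinite_finite_induct) (simp_all add: matrix_vector_mult_add_rdistrib)
    then have "x \<bullet> (B *v y) = (\<Sum>A\<in>G. x \<bullet> (transpose (real_mat A) *v (real_mat A *v y)))"
      by (simp add: inner_sum_right matrix_vector_mul_assoc)
    then show ?thesis by (simp only: adj)
  qed
  have symB: "transpose B = B"
  proof -
    have "B $ i $ j = B $ j $ i" for i j
      unfolding B_def by (simp add: matrix_matrix_mult_def transpose_def mult.commute)
    then show ?thesis by (simp add: transpose_def vec_eq_iff)
  qed
  have pos: "x \<bullet> (B *v x) > 0" if x: "x \<noteq> 0" for x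
  proof -
    have "x \<bullet> x \<le> (\<Sum>A\<in>G. (real_mat A *v x) \<bullet> (real_mat A *v x))"
      using member_le_sum[OF oneG, of "\<lambda>A. (real_mat A *v x) \<bullet> (real_mat A *v x)"] finG by (simp add: real_mat_simps)
    then show ?thesis using x unfolding Bv by (smt (verit) inner_gt_zero_iff)
  qed
  obtain S T :: "real^3^3" where S: "transpose S ** S = B" "S ** T = mat 1" "T ** S = mat 1" using cholesky_3[OF symB pos] .
  define O1 where "O1 = (\<lambda>A. S ** real_mat A ** T)"
  have O1_mult: "O1 (A ** C) = O1 A ** O1 C" for A C
  proof -
    have "O1 A ** O1 C = S ** real_mat A ** (T ** S) ** real_mat C ** T" by (simp only: O1_def matrix_mul_assoc)
    then show ?thesis by (simp add: O1_def S(3) real_mat_simps matrix_mul_assoc)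
  qed
  have O1_inj: "O1 A = O1 C \<Longrightarrow> A = C" for A C
  proof -
    assume "O1 A = O1 C"
    then have "T ** O1 A ** S = T ** O1 C ** S" by simp
    moreover have "T ** O1 D ** S = (T ** S) ** real_mat D ** (T ** S)" for D by (simp only: O1_def matrix_mul_assoc)
    ultimately have "real_mat A = real_mat C" by (simp add: S(3))
    then show "A = C" by (simp add: real_mat_simps)
  qed
  have inner: "(O1 C *v x) \<bullet> (O1 C *v y) = x \<bullet> y" if C: "C \<in> G" for C x y
  proof -
    have SB: "(S *v x) \<bullet> (S *v y) = x \<bullet> (B *v y)" for x y
    proof -
      have "x \<bullet> (B *v y) = x \<bullet> (transpose S *v (S *v y))" by (simp only: S(1)[symmetric] matrix_vector_mul_assoc)
      also have "\<dots> = (S *v x) \<bullet> (S *v y)" by (rule adj)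
      finally show ?thesis by (rule sym)
    qed
    have Binv: "(real_mat C *v x) \<bullet> (B *v (real_mat C *v y)) = x \<bullet> (B *v y)" for x y
    proof -
      have "(real_mat C *v x) \<bullet> (B *v (real_mat C *v y)) = (\<Sum>A\<in>G. (real_mat (A ** C) *v x) \<bullet> (real_mat (A ** C) *v y))"
        unfolding Bv by (simp add: real_mat_simps matrix_vector_mul_assoc)
      then show ?thesis
        unfolding Bv using G.sum_translate_right[of C "\<lambda>A. (real_mat A *v x) \<bullet> (real_mat A *v y)"] C by simp
    qed
    have "(O1 C *v x) \<bullet> (O1 C *v y) = (S *v (real_mat C *v (T *v x))) \<bullet> (S *v (real_mat C *v (T *v y)))"
      by (simp only: O1_def matrix_vector_mul_assoc matrix_mul_assoc)
    also have "\<dots> = (S *v (T *v x)) \<bullet> (S *v (T *v y))" by (simp only: SB Binv)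
    also have "\<dots> = x \<bullet> y" by (simp only: matrix_vector_mul_assoc S(2) matrix_vector_mul_lid)
    finally show ?thesis .
  qed
  have ortho: "orthogonal_matrix (O1 C)" if C: "C \<in> G" for C
  proof -
    have "orthogonal_transformation ((*v) (O1 C))"
      unfolding orthogonal_transformation_def using inner[OF C] by simp
    then show ?thesis by (simp add: orthogonal_transformation_matrix)
  qed
  \<comment> \<open>In odd dimension the factor \<open>det A\<close> makes the determinant 1, at the
    price that \<open>A\<close> and \<open>- A\<close> get the same image.\<close>
  define \<rho> where "\<rho> = (\<lambda>A. real_of_int (det A) *\<^sub>R O1 A)"
  have \<rho>_mult: "\<rho> (A ** C) = \<rho> A ** \<rho> C" for A C
    by (simp add: \<rho>_def O1_mult det_mul scalar_matrix_assoc[symmetric] matrix_scalar_ac mult.commute)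
  have detST: "det S * det T = 1" using S(2) by (metis det_I det_mul)
  have rot: "rotation_matrix (\<rho> A)" if A: "A \<in> G" for A
  proof -
    have dO: "det (O1 A) = of_int (det A)" using detST by (simp add: O1_def det_mul real_mat_simps)
    have neg: "det (- X) = - det X" for X :: "real^3^3" by (simp add: det_3)
    show ?thesis using det[OF A]
    proof
      assume "det A = 1"
      then show ?thesis using dO ortho[OF A] by (simp add: \<rho>_def rotation_matrix_def)
    next
      assume d: "det A = - 1"
      have "orthogonal_matrix (- O1 A)"
        using ortho[OF A] by (simp add: orthogonal_matrix_def transpose_def vec_eq_iff matrix_matrix_mult_def)
      then show ?thesis using d dO by (simp add: \<rho>_def rotation_matrix_def neg)
    qed
  qed
  have \<rho>_one: "\<rho> (mat 1) = mat 1" by (simp add: \<rho>_def O1_def real_mat_simps S(2))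
  \<comment> \<open>The trace is invariant under the real change of basis and the factor is an
    integer, so integrality of traces persists.\<close>
  have tr: "trace (\<rho> A) \<in> \<int>" for A
  proof -
    have "trace (O1 A) = trace (T ** (S ** real_mat A))" unfolding O1_def by (rule trace_mul_sym)
    also have "\<dots> = of_int (trace A)" by (simp add: matrix_mul_assoc S(3) real_mat_simps)
    finally have tO: "trace (O1 A) = of_int (trace A)" .
    have "trace (\<rho> A) = of_int (det A) * trace (O1 A)" by (simp add: \<rho>_def trace_def sum_distrib_left)
    then have "trace (\<rho> A) = of_int (det A * trace A)" by (simp only: tO of_int_mult)
    then show ?thesis by simp
  qed
  have \<rho>_inj: "A = C" if "\<rho> A = \<rho> C" "det A = det C" "A \<in> G" for A C
  proof -
    have "real_of_int (det A) \<noteq> 0" using det[OF that(3)] by auto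
    then have "O1 A = O1 C" using that(1,2) by (simp add: \<rho>_def)
    then show ?thesis by (rule O1_inj)
  qed
  interpret R: rot_group "\<rho> ` G"
  proof
    show "mat 1 \<in> \<rho> ` G" using oneG \<rho>_one by (metis image_eqI)
    show "A ** C \<in> \<rho> ` G" if "A \<in> \<rho> ` G" "C \<in> \<rho> ` G" for A C
      using that multG by (auto simp: \<rho>_mult[symmetric])
    show "transpose A \<in> \<rho> ` G" if AG: "A \<in> \<rho> ` G" for A
    proof -
      obtain D where D: "D \<in> G" "A = \<rho> D" using AG by blast
      obtain E where E: "E \<in> G" "D ** E = mat 1" using invG[OF D(1)] by blast
      have "A ** \<rho> E = mat 1" using \<rho>_mult[of D E] E(2) \<rho>_one D(2) by simp
      then have "transpose A ** A ** \<rho> E = transpose A" by (simp add: matrix_mul_assoc[symmetric])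
      then have "\<rho> E = transpose A" using rotation_matrixD(1)[OF rot[OF D(1)]] D(2) by simp
      then show ?thesis using E(1) image_eqI[of "transpose A" \<rho> E G] by simp
    qed
  qed (use finG rot tr in auto)
  interpret h: fin_hom "mat_group G" "mat_group (\<rho> ` G)" \<rho>
    by unfold_locales (auto simp: hom_def \<rho>_mult)
  note R = R.trivial_augs_rot_group
  have neg_eq: "- A = (- mat 1) ** A" for A :: "int^3^3"
    by (simp add: vec_eq_iff forall_3 matrix_matrix_mult_def mat_def sum_3)
  have O1_neg: "O1 (- A) = - O1 A" for A
    by (simp add: O1_def real_mat_simps vec_eq_iff matrix_matrix_mult_def sum_negf)
  have det_neg: "det (- A) = - det A" for A :: "int^3^3" by (simp add: det_3)
  show "trivial_augs (mat_group G)"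
  proof (cases "- mat 1 \<in> G")
    case True
    show ?thesis
    proof (rule h.trivial_augs_sign_extension[OF R, of det])
      fix y e assume y: "y \<in> carrier (mat_group (\<rho> ` G))" and e: "e = 1 \<or> e = - (1::int)"
      then obtain A where A: "A \<in> G" "y = \<rho> A" by auto
      have nA: "- A \<in> G" unfolding neg_eq[of A] by (rule multG[OF True A(1)])
      have "\<rho> (- A) = \<rho> A" unfolding \<rho>_def O1_neg det_neg by simp
      then show "\<exists>x\<in>carrier (mat_group G). \<rho> x = y \<and> det x = e"
      proof (cases "det A = e")
        case True
        then show ?thesis using A by auto
      next
        case False
        then have "det (- A) = e" using det[OF A(1)] e det_neg[of A] by auto
        then show ?thesis using nA A(2) \<open>\<rho> (- A) = \<rho> A\<close> by auto
      qed
    next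
      show "det (x \<otimes>\<^bsub>mat_group G\<^esub> y) = det x * det y" for x y by (simp add: det_mul)
      show "det x = 1 \<or> det x = - 1" if "x \<in> carrier (mat_group G)" for x using det that by simp
      show "x = y" if "x \<in> carrier (mat_group G)" "\<rho> x = \<rho> y" "det x = det y" for x y
        using \<rho>_inj[OF that(2,3)] that(1) by simp
    qed
  next
    case False
    \<comment> \<open>Distinct elements with equal image are negatives of each other, and their
      quotient would be \<open>- mat 1\<close>.\<close>
    have "A = C" if AC: "A \<in> G" "C \<in> G" "\<rho> A = \<rho> C" for A C
    proof (rule ccontr)
      assume ne: "A \<noteq> C"
      then have "det A \<noteq> det C" using \<rho>_inj[OF AC(3) _ AC(1)] by blast
      then have "det A = - det C" using det[OF AC(1)] det[OF AC(2)] by auto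
      then have "real_of_int (det C) *\<^sub>R O1 (- A) = real_of_int (det C) *\<^sub>R O1 C"
        using AC(3) by (simp add: \<rho>_def O1_neg)
      moreover have "real_of_int (det C) \<noteq> 0" using det[OF AC(2)] by auto
      ultimately have "- A = C" using O1_inj by simp
      obtain D where D: "D \<in> G" "A ** D = mat 1" using invG[OF AC(1)] by blast
      have "C ** D = (- mat 1) ** (A ** D)" by (simp only: matrix_mul_assoc neg_eq[of A, symmetric] \<open>- A = C\<close>)
      then have "- mat 1 \<in> G" using D multG[OF AC(2) D(1)] by simp
      then show False using False by simp
    qed
    then have "inj_on \<rho> (carrier (mat_group G))" unfolding inj_on_def mat_group_simps by blast
    then show ?thesis by (rule h.trivial_augs_iso[OF _ _ R]) simp
  qed
qed

section \<open>Return to the group ring of the integral matrix group\<close>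

lemma gr_mult_eq: "gr_mult G = grp_mult (mat_group G)"
  by (simp add: gr_mult_def grp_mult_def fun_eq_iff)

lemma gr_one_eq: "gr_one = grp_basis (mat 1)"
  by (simp add: gr_one_def gr_basis_def grp_basis_def fun_eq_iff)

lemma gr_pow_eq: "gr_pow G a n = grp_pow (mat_group G) a n"
  by (induction n) (simp_all add: gr_one_eq gr_mult_eq)

lemma gr_elem_eq: "gr_elem G a = grp_supp (mat_group G) a"
  by (simp add: gr_elem_def grp_supp_def)

theorem mainTheorem3:
  fixes G :: "mat3 set" and u :: "mat3 \<Rightarrow> int"
  assumes "finite_subgroup_GL3Z G"
    and "in_V G u"
    and "torsion G u"
  shows "\<exists>g\<in>G. conj_in_QG G (\<lambda>h. of_int (u h)) (gr_basis g)"
proof -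
  let ?G = "mat_group G"
  interpret G: fin_group ?G using trivial_augs_GL3Z(1)[OF assms(1)] .
  note triv = trivial_augs_GL3Z(2)[OF assms(1)]
  obtain n where n: "n > 0" "grp_pow ?G u n = grp_basis (mat 1)"
    using assms(3) by (auto simp: torsion_def gr_pow_eq gr_one_eq)
  have u: "tors1 ?G u"
    using assms(2) n by (auto simp: tors1_def in_V_def gr_unit_def gr_elem_eq augmentation_def)
  obtain g where g: "aug_at ?G u g" using triv u by (auto simp: trivial_augs_def)
  have gG: "g \<in> carrier ?G" using g by (simp add: aug_at_def)
  define U where "U = (\<lambda>h. rat_of_int (u h))"
  have U_pow: "grp_pow ?G U j = (\<lambda>h. of_int (grp_pow ?G u j h))" for j
    by (induction j) (auto simp: U_def grp_basis_def grp_mult_def fun_eq_iff)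
  have class_one: "conj_class ?G (mat 1) = {mat 1}" using G.conj_class_central[of "mat 1"] G.one_closed by simp
  \<comment> \<open>The relation \<open>u\<close> to the power \<open>n\<close> equal to 1 must pass
    to \<open>g\<close>, since the conjugacy criterion averages both over the same cyclic group. It
    does, because \<open>g [^] n\<close> lies in the class of the identity.\<close>
  have "aug_at ?G (grp_pow ?G u n) (g [^]\<^bsub>?G\<^esub> n)" by (rule G.aug_at_pow[OF triv u g n(1)])
  moreover have "class_sum ?G (grp_basis (mat 1)) (mat 1) = (1::int)"
    by (simp add: class_sum_def class_one grp_basis_def)
  ultimately have "mat 1 \<in> conj_class ?G (g [^]\<^bsub>?G\<^esub> n)"
    using n(2) G.one_closed by (auto simp: aug_at_def split: if_splits)
  then have "g [^]\<^bsub>?G\<^esub> n \<in> conj_class ?G (mat 1)" using G.conj_class_sym[OF G.nat_pow_closed[OF gG]] by blast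
  then have gn: "g [^]\<^bsub>?G\<^esub> n = mat 1" using class_one by simp
  have class_basis: "class_sum ?G (grp_basis k) h = (if h \<in> conj_class ?G k then 1 else 0 :: rat)"
    if "h \<in> carrier ?G" "k \<in> carrier ?G" for h k
    using G.conj_class_sym[OF that(1), of k] G.conj_class_sym[OF that(2), of h]
    by (auto simp: class_sum_def grp_basis_def)
  \<comment> \<open>The exponent 0 is treated apart, as \<open>aug_at_pow\<close> concerns positive
    exponents; both sides are then the class sum of 1.\<close>
  have cs: "class_sum ?G (grp_pow ?G (grp_basis g) j) h = class_sum ?G (grp_pow ?G U j) h" if h: "h \<in> carrier ?G" for j h
  proof (cases "j = 0")
    case False
    have "class_sum ?G (grp_pow ?G U j) h = of_int (class_sum ?G (grp_pow ?G u j) h)"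
      by (simp add: U_pow class_sum_def)
    also have "\<dots> = (if h \<in> conj_class ?G (g [^]\<^bsub>?G\<^esub> j) then 1 else 0)"
      using G.aug_at_pow[OF triv u g, of j] False h by (simp add: aug_at_def)
    finally show ?thesis using class_basis[OF h G.nat_pow_closed[OF gG]] by (simp add: G.basis_pow[OF gG])
  qed simp
  have "grp_supp ?G U" using u by (auto simp: U_def tors1_def grp_supp_def)
  moreover have "grp_pow ?G U n = grp_basis \<one>\<^bsub>?G\<^esub>" by (auto simp: U_pow n(2) grp_basis_def fun_eq_iff)
  moreover have "grp_pow ?G (grp_basis g) n = (grp_basis \<one>\<^bsub>?G\<^esub> :: mat3 \<Rightarrow> rat)" using gn gG by (simp add: G.basis_pow)
  ultimately obtain x y where xy: "grp_supp ?G x" "grp_supp ?G y" "grp_mult ?G x y = grp_basis \<one>\<^bsub>?G\<^esub>"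
    "grp_mult ?G y x = grp_basis \<one>\<^bsub>?G\<^esub>" "grp_mult ?G U x = grp_mult ?G x (grp_basis g)"
    using G.class_sums_imp_conjugate[OF n(1), of U "grp_basis g"] cs G.supp_basis[OF gG] by blast
  \<comment> \<open>The intertwining relation multiplied by the inverse \<open>y\<close> on the
    left.\<close>
  have "grp_mult ?G (grp_mult ?G y U) x = grp_mult ?G (grp_mult ?G y x) (grp_basis g)"
    by (simp only: G.mult_assoc xy(5))
  also have "\<dots> = grp_basis g" unfolding xy(4) by (rule G.one_mult[OF G.supp_basis[OF gG]])
  finally have "conj_in_QG G U (gr_basis g)"
    unfolding conj_in_QG_def gr_mult_eq gr_one_eq gr_elem_eq using xy
    by (intro exI[of _ x] exI[of _ y]) (auto simp: gr_basis_def grp_basis_def)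
  then show ?thesis using gG by (auto simp: U_def)
qed

end
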